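(* For all $n$, $T^2_{A_n}=0$, where $A_n$ is the Stanley--Reisner ring of the boundary complex $\mathcal{A}_n$ of the dual polytope of the $(n-4)$-dimensional associahedron as indexed by the $n$-gon.
   Context: $\mathcal{A}_n$ is the following $(n-4)$-dimensional simplicial complex ($n\ge 3$): label the vertices of a convex $n$-gon cyclically by $1,\dots,n$ and let $\delta_{ij}$ be the diagonal joining $i$ and $j$. The vertices of $\mathcal{A}_n$ are the $\tfrac12 n(n-3)$ diagonals, and a set of diagonals is a face if and only if no two of them cross (in the interior of the polygon). E.g. $\mathcal{A}_3=\{\emptyset\}$, $\mathcal{A}_4$ is two disjoint points, $\mathcal{A}_5$ is the boundary of a pentagon. (The dimension of the associahedron is stated in the convention in which $\mathcal{A}_n$ has dimension $n-4$; the complex itself is the one just described.) The Stanley--Reisner ring over $\mathbb{C}$ of $\mathcal{A}_n$ is $A_n=\mathbb{C}[x_{ij}]/I$, with one variable for each diagonal $\delta_{ij}$ and $I$ generated by the square-free monomials corresponding to non-faces; thus $I$ is generated by the $\binom n4$ monomials $x_{ik}x_{jl}$ with $1\le i<j<k<l\le n$. For a $\mathbb{C}$-algebra $A$, $T^i_A=T^i(A/\mathbb{C};A)=H^i(\operatorname{Hom}_A(L_{A/\mathbb{C}},A))$ is the cotangent (André--Quillen) cohomology. *)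

theory Defs
  imports Complex_Main "HOL-Library.Poly_Mapping" "HOL-Library.FuncSet"
    "HOL-Algebra.Module" "HOL-Algebra.QuotRing"
begin

section \<open>Modules: quotients, presentations, homomorphisms, base change\<close>

text \<open>A \<^typ>\<open>('a, 'b) module\<close> record carries both a ring structure and a scalar multiplication; as in
  \<^theory>\<open>HOL-Algebra.Module\<close> it is used both for modules (where \<open>mult\<close> and \<open>one\<close> are junk) and for
  algebras (locale \<^locale>\<open>algebra\<close>).  The quotient below serves both uses: \<open>N\<close> is a submodule,
  respectively an ideal, and scalars act by \<open>c (N + x) = N + c x\<close>.\<close>

definition quot_module :: "('r, 'm, 'z) module_scheme \<Rightarrow> 'm set \<Rightarrow> ('r, 'm set) module" where
  "quot_module M N = ring.extend (M Quot N)
     (module.fields (\<lambda>r X. N <+>\<^bsub>M\<^esub> ((\<lambda>x. r \<odot>\<^bsub>M\<^esub> x) ` X)))"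

definition submodule_span ::
    "('r, 'y) ring_scheme \<Rightarrow> ('r, 'm, 'z) module_scheme \<Rightarrow> 'm set \<Rightarrow> 'm set" where
  "submodule_span R M X = \<Inter>{N. submodule N R M \<and> X \<subseteq> N}"

definition free_module :: "('r, 'y) ring_scheme \<Rightarrow> 's set \<Rightarrow> ('r, 's \<Rightarrow> 'r) module" where
  "free_module R S =
     \<lparr>carrier = {x. (\<forall>s. x s \<in> carrier R) \<and> (\<forall>s. s \<notin> S \<longrightarrow> x s = \<zero>\<^bsub>R\<^esub>) \<and> finite {s. x s \<noteq> \<zero>\<^bsub>R\<^esub>}},
      mult = undefined, one = undefined,
      zero = (\<lambda>s. \<zero>\<^bsub>R\<^esub>), add = (\<lambda>x y s. x s \<oplus>\<^bsub>R\<^esub> y s),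
      smult = (\<lambda>r x s. r \<otimes>\<^bsub>R\<^esub> x s)\<rparr>"

definition unit_vec :: "('r, 'y) ring_scheme \<Rightarrow> 's \<Rightarrow> 's \<Rightarrow> 'r" where
  "unit_vec R s = (\<lambda>t. if t = s then \<one>\<^bsub>R\<^esub> else \<zero>\<^bsub>R\<^esub>)"

definition presented_module ::
    "('r, 'y) ring_scheme \<Rightarrow> 's set \<Rightarrow> ('s \<Rightarrow> 'r) set \<Rightarrow> ('r, ('s \<Rightarrow> 'r) set) module" where
  "presented_module R S Rel = quot_module (free_module R S) (submodule_span R (free_module R S) Rel)"

definition presented_gen ::
    "('r, 'y) ring_scheme \<Rightarrow> 's set \<Rightarrow> ('s \<Rightarrow> 'r) set \<Rightarrow> 's \<Rightarrow> ('s \<Rightarrow> 'r) set" where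
  "presented_gen R S Rel s =
     submodule_span R (free_module R S) Rel +>\<^bsub>free_module R S\<^esub> unit_vec R s"

text \<open>The \<open>\<phi>\<close>-semilinear map from a presented \<open>R\<close>-module (whose elements are cosets \<open>X\<close>) to \<open>M\<close> sending
  each generator \<open>s\<close> to \<open>g s\<close>.  It is meaningful only if that assignment respects the relations;
  otherwise \<^const>\<open>the_elem\<close> may be applied to a non-singleton.\<close>

definition presented_lift ::
    "('r, 'y) ring_scheme \<Rightarrow> ('t, 'm, 'z) module_scheme \<Rightarrow> ('r \<Rightarrow> 't) \<Rightarrow> ('s \<Rightarrow> 'm) \<Rightarrow> ('s \<Rightarrow> 'r) set \<Rightarrow> 'm" where
  "presented_lift R M \<phi> g X =
     the_elem ((\<lambda>x. \<Oplus>\<^bsub>M\<^esub>s\<in>{s. x s \<noteq> \<zero>\<^bsub>R\<^esub>}. \<phi> (x s) \<odot>\<^bsub>M\<^esub> g s) ` X)"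

definition hom_module ::
    "('r, 'y) ring_scheme \<Rightarrow> ('r, 'm, 'z) module_scheme \<Rightarrow> ('r, 'n, 'w) module_scheme
     \<Rightarrow> ('r, 'm \<Rightarrow> 'n) module" where
  "hom_module R M N =
     \<lparr>carrier = {f \<in> carrier M \<rightarrow>\<^sub>E carrier N.
         (\<forall>x\<in>carrier M. \<forall>y\<in>carrier M. f (x \<oplus>\<^bsub>M\<^esub> y) = f x \<oplus>\<^bsub>N\<^esub> f y) \<and>
         (\<forall>r\<in>carrier R. \<forall>x\<in>carrier M. f (r \<odot>\<^bsub>M\<^esub> x) = r \<odot>\<^bsub>N\<^esub> f x)},
      mult = undefined, one = undefined,
      zero = (\<lambda>x\<in>carrier M. \<zero>\<^bsub>N\<^esub>), add = (\<lambda>f g. \<lambda>x\<in>carrier M. f x \<oplus>\<^bsub>N\<^esub> g x),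
      smult = (\<lambda>r f. \<lambda>x\<in>carrier M. r \<odot>\<^bsub>N\<^esub> f x)\<rparr>"

definition regular_module :: "('r, 'y) ring_scheme \<Rightarrow> ('r, 'r) module" where
  "regular_module R =
     \<lparr>carrier = carrier R, mult = mult R, one = one R, zero = zero R, add = add R, smult = mult R\<rparr>"

text \<open>Extension of scalars \<open>M \<otimes>\<^sub>P A\<close> of a \<open>P\<close>-module \<open>M\<close> along a ring homomorphism \<open>e : P \<rightarrow> A\<close>, presented
  as an \<open>A\<close>-module by generators \<open>m \<otimes> 1\<close> for \<open>m \<in> M\<close>.\<close>

definition base_change_rels ::
    "('p, 'x) ring_scheme \<Rightarrow> ('a, 'y) ring_scheme \<Rightarrow> ('p \<Rightarrow> 'a) \<Rightarrow> ('p, 'm, 'z) module_scheme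
     \<Rightarrow> ('m \<Rightarrow> 'a) set" where
  "base_change_rels P A e M =
     (let F = free_module A (carrier M); u = unit_vec A in
       {u (m \<oplus>\<^bsub>M\<^esub> m') \<ominus>\<^bsub>F\<^esub> (u m \<oplus>\<^bsub>F\<^esub> u m') |m m'. m \<in> carrier M \<and> m' \<in> carrier M} \<union>
       {u (p \<odot>\<^bsub>M\<^esub> m) \<ominus>\<^bsub>F\<^esub> e p \<odot>\<^bsub>F\<^esub> u m |p m. p \<in> carrier P \<and> m \<in> carrier M})"

definition base_change ::
    "('p, 'x) ring_scheme \<Rightarrow> ('a, 'y) ring_scheme \<Rightarrow> ('p \<Rightarrow> 'a) \<Rightarrow> ('p, 'm, 'z) module_scheme
     \<Rightarrow> ('a, ('m \<Rightarrow> 'a) set) module" where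
  "base_change P A e M = presented_module A (carrier M) (base_change_rels P A e M)"

definition base_change_gen ::
    "('p, 'x) ring_scheme \<Rightarrow> ('a, 'y) ring_scheme \<Rightarrow> ('p \<Rightarrow> 'a) \<Rightarrow> ('p, 'm, 'z) module_scheme
     \<Rightarrow> 'm \<Rightarrow> ('m \<Rightarrow> 'a) set" where
  "base_change_gen P A e M = presented_gen A (carrier M) (base_change_rels P A e M)"


section \<open>Kaehler differentials of complex algebras\<close>

text \<open>\<open>\<Omega>\<close> of a complex algebra \<open>P\<close>: the \<open>P\<close>-module generated by symbols \<open>dp\<close> for \<open>p \<in> P\<close>, subject to
  additivity, complex-linearity and the Leibniz rule.\<close>

definition kaehler_rels :: "(complex, 'p, 'z) module_scheme \<Rightarrow> ('p \<Rightarrow> 'p) set" where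
  "kaehler_rels P =
     (let F = free_module P (carrier P); u = unit_vec P in
       {u (p \<oplus>\<^bsub>P\<^esub> q) \<ominus>\<^bsub>F\<^esub> (u p \<oplus>\<^bsub>F\<^esub> u q) |p q. p \<in> carrier P \<and> q \<in> carrier P} \<union>
       {u (c \<odot>\<^bsub>P\<^esub> p) \<ominus>\<^bsub>F\<^esub> (c \<odot>\<^bsub>P\<^esub> \<one>\<^bsub>P\<^esub>) \<odot>\<^bsub>F\<^esub> u p |c p. p \<in> carrier P} \<union>
       {u (p \<otimes>\<^bsub>P\<^esub> q) \<ominus>\<^bsub>F\<^esub> (p \<odot>\<^bsub>F\<^esub> u q \<oplus>\<^bsub>F\<^esub> q \<odot>\<^bsub>F\<^esub> u p) |p q. p \<in> carrier P \<and> q \<in> carrier P})"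

definition kaehler :: "(complex, 'p, 'z) module_scheme \<Rightarrow> ('p, ('p \<Rightarrow> 'p) set) module" where
  "kaehler P = presented_module P (carrier P) (kaehler_rels P)"

definition kaehler_d :: "(complex, 'p, 'z) module_scheme \<Rightarrow> 'p \<Rightarrow> ('p \<Rightarrow> 'p) set" where
  "kaehler_d P = presented_gen P (carrier P) (kaehler_rels P)"

definition kaehler_map ::
    "(complex, 'p, 'z) module_scheme \<Rightarrow> (complex, 'q, 'w) module_scheme \<Rightarrow> ('p \<Rightarrow> 'q)
     \<Rightarrow> ('p \<Rightarrow> 'p) set \<Rightarrow> ('q \<Rightarrow> 'q) set" where
  "kaehler_map P Q f = presented_lift P (kaehler Q) f (\<lambda>p. kaehler_d Q (f p))"

text \<open>The \<open>A\<close>-module \<open>\<Omega>\<^sub>P \<otimes>\<^sub>P A\<close> for an augmentation \<open>e : P \<rightarrow> A\<close>, and the \<open>A\<close>-linear map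
  \<open>\<Omega>\<^sub>P \<otimes>\<^sub>P A \<rightarrow> \<Omega>\<^sub>Q \<otimes>\<^sub>Q A\<close> induced by an algebra homomorphism \<open>f : P \<rightarrow> Q\<close> over \<open>A\<close>, where \<open>e\<close> is the
  augmentation of \<open>Q\<close>.\<close>

definition differentials_over ::
    "('a, 'y) ring_scheme \<Rightarrow> (complex, 'p, 'z) module_scheme \<Rightarrow> ('p \<Rightarrow> 'a)
     \<Rightarrow> ('a, (('p \<Rightarrow> 'p) set \<Rightarrow> 'a) set) module" where
  "differentials_over A P e = base_change P A e (kaehler P)"

definition differentials_over_map ::
    "('a, 'y) ring_scheme \<Rightarrow> (complex, 'p, 'z) module_scheme \<Rightarrow> (complex, 'q, 'w) module_scheme
     \<Rightarrow> ('q \<Rightarrow> 'a) \<Rightarrow> ('p \<Rightarrow> 'q) \<Rightarrow> (('p \<Rightarrow> 'p) set \<Rightarrow> 'a) set \<Rightarrow> (('q \<Rightarrow> 'q) set \<Rightarrow> 'a) set" where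
  "differentials_over_map A P Q e f =
     presented_lift A (differentials_over A Q e) (\<lambda>a. a)
       (\<lambda>\<omega>. base_change_gen Q A e (kaehler Q) (kaehler_map P Q f \<omega>))"


section \<open>Polynomial algebras and the standard simplicial resolution\<close>

type_synonym 'v cpoly = "('v \<Rightarrow>\<^sub>0 nat) \<Rightarrow>\<^sub>0 complex"

definition poly_var :: "'v \<Rightarrow> 'v cpoly" where
  "poly_var v = Poly_Mapping.single (Poly_Mapping.single v 1) 1"

definition poly_algebra :: "'v set \<Rightarrow> (complex, 'v cpoly) module" where
  "poly_algebra V =
     \<lparr>carrier = {p. \<forall>m\<in>Poly_Mapping.keys p. Poly_Mapping.keys m \<subseteq> V},
      mult = (*), one = 1, zero = 0, add = (+),
      smult = (\<lambda>c p. Poly_Mapping.single 0 c * p)\<rparr>"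

definition poly_eval :: "(complex, 'b, 'z) module_scheme \<Rightarrow> ('v \<Rightarrow> 'b) \<Rightarrow> 'v cpoly \<Rightarrow> 'b" where
  "poly_eval B g p =
     (\<Oplus>\<^bsub>B\<^esub>m\<in>Poly_Mapping.keys p. Poly_Mapping.lookup p m \<odot>\<^bsub>B\<^esub>
        (\<Otimes>\<^bsub>B\<^esub>v\<in>Poly_Mapping.keys m. g v [^]\<^bsub>B\<^esub> Poly_Mapping.lookup m v))"

text \<open>The comonad \<open>B \<mapsto> \<complex>[B]\<close> sending an algebra to the polynomial algebra on its underlying set, with
  counit \<open>\<complex>[B] \<rightarrow> B\<close> evaluating each variable at itself.\<close>

abbreviation free_alg :: "(complex, 'b, 'z) module_scheme \<Rightarrow> (complex, 'b cpoly) module" where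
  "free_alg B \<equiv> poly_algebra (carrier B)"

definition counit :: "(complex, 'b, 'z) module_scheme \<Rightarrow> 'b cpoly \<Rightarrow> 'b" where
  "counit B = poly_eval B (\<lambda>b. b)"

definition free_alg_map ::
    "(complex, 'c, 'z) module_scheme \<Rightarrow> ('b \<Rightarrow> 'c) \<Rightarrow> 'b cpoly \<Rightarrow> 'c cpoly" where
  "free_alg_map C f = poly_eval (free_alg C) (\<lambda>b. poly_var (f b))"

text \<open>The standard resolution of \<open>A\<close> is \<open>P\<^sub>k = G\<^sup>k\<^sup>+\<^sup>1 A\<close>, \<open>G\<close> the comonad above, with face maps
  \<open>d\<^sub>i = G\<^sup>i (counit (G\<^sup>k\<^sup>-\<^sup>i A)) : P\<^sub>k \<rightarrow> P\<^sub>k\<^sub>-\<^sub>1\<close> for \<open>i = 0, ..., k\<close>.  Since each \<open>P\<^sub>k\<close> lives in its own HOL type,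
  the terms are written out one at a time; the cohomology in degree 2 involves exactly \<open>P\<^sub>1\<close>, \<open>P\<^sub>2\<close>
  and \<open>P\<^sub>3\<close>.\<close>

type_synonym 'a res0 = "'a cpoly"
type_synonym 'a res1 = "'a res0 cpoly"
type_synonym 'a res2 = "'a res1 cpoly"
type_synonym 'a res3 = "'a res2 cpoly"

definition res0 :: "(complex, 'a, 'z) module_scheme \<Rightarrow> (complex, 'a res0) module" where
  "res0 A = free_alg A"

definition res1 :: "(complex, 'a, 'z) module_scheme \<Rightarrow> (complex, 'a res1) module" where
  "res1 A = free_alg (res0 A)"

definition res2 :: "(complex, 'a, 'z) module_scheme \<Rightarrow> (complex, 'a res2) module" where
  "res2 A = free_alg (res1 A)"

definition res3 :: "(complex, 'a, 'z) module_scheme \<Rightarrow> (complex, 'a res3) module" where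
  "res3 A = free_alg (res2 A)"

definition aug0 :: "(complex, 'a, 'z) module_scheme \<Rightarrow> 'a res0 \<Rightarrow> 'a" where
  "aug0 A = counit A"

definition aug1 :: "(complex, 'a, 'z) module_scheme \<Rightarrow> 'a res1 \<Rightarrow> 'a" where
  "aug1 A = aug0 A \<circ> counit (res0 A)"

definition aug2 :: "(complex, 'a, 'z) module_scheme \<Rightarrow> 'a res2 \<Rightarrow> 'a" where
  "aug2 A = aug1 A \<circ> counit (res1 A)"

definition aug3 :: "(complex, 'a, 'z) module_scheme \<Rightarrow> 'a res3 \<Rightarrow> 'a" where
  "aug3 A = aug2 A \<circ> counit (res2 A)"

definition faces1 :: "(complex, 'a, 'z) module_scheme \<Rightarrow> ('a res1 \<Rightarrow> 'a res0) list" where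
  "faces1 A = [counit (res0 A), free_alg_map A (aug0 A)]"

definition faces2 :: "(complex, 'a, 'z) module_scheme \<Rightarrow> ('a res2 \<Rightarrow> 'a res1) list" where
  "faces2 A = counit (res1 A) # map (free_alg_map (res0 A)) (faces1 A)"

definition faces3 :: "(complex, 'a, 'z) module_scheme \<Rightarrow> ('a res3 \<Rightarrow> 'a res2) list" where
  "faces3 A = counit (res2 A) # map (free_alg_map (res1 A)) (faces2 A)"


section \<open>The cotangent complex and the module \<open>T\<^sup>2\<close>\<close>

text \<open>The cotangent complex \<open>L\<^bsub>A/\<complex>\<^esub>\<close> is the complex of \<open>A\<close>-modules associated with the simplicial module
  \<open>\<Omega>\<^bsub>P\<^esub> \<otimes>\<^sub>P A\<close>, so its differentials are the alternating sums \<open>d\<^sub>0 - d\<^sub>1 + d\<^sub>2 - ...\<close> of the face maps.\<close>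

primrec alternating_sum :: "('r, 'm, 'z) module_scheme \<Rightarrow> ('x \<Rightarrow> 'm) list \<Rightarrow> 'x \<Rightarrow> 'm" where
  "alternating_sum M [] x = \<zero>\<^bsub>M\<^esub>"
| "alternating_sum M (f # fs) x = f x \<ominus>\<^bsub>M\<^esub> alternating_sum M fs x"

type_synonym ('a, 'p) diff_over = "(('p \<Rightarrow> 'p) set \<Rightarrow> 'a) set"

definition cotangent1 ::
    "(complex, 'a, 'z) module_scheme \<Rightarrow> ('a, ('a, 'a res1) diff_over) module" where
  "cotangent1 A = differentials_over A (res1 A) (aug1 A)"

definition cotangent2 ::
    "(complex, 'a, 'z) module_scheme \<Rightarrow> ('a, ('a, 'a res2) diff_over) module" where
  "cotangent2 A = differentials_over A (res2 A) (aug2 A)"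

definition cotangent3 ::
    "(complex, 'a, 'z) module_scheme \<Rightarrow> ('a, ('a, 'a res3) diff_over) module" where
  "cotangent3 A = differentials_over A (res3 A) (aug3 A)"

definition cotangent_d2 ::
    "(complex, 'a, 'z) module_scheme \<Rightarrow> ('a, 'a res2) diff_over \<Rightarrow> ('a, 'a res1) diff_over" where
  "cotangent_d2 A = alternating_sum (cotangent1 A)
     (map (differentials_over_map A (res2 A) (res1 A) (aug1 A)) (faces2 A))"

definition cotangent_d3 ::
    "(complex, 'a, 'z) module_scheme \<Rightarrow> ('a, 'a res3) diff_over \<Rightarrow> ('a, 'a res2) diff_over" where
  "cotangent_d3 A = alternating_sum (cotangent2 A)
     (map (differentials_over_map A (res3 A) (res2 A) (aug2 A)) (faces3 A))"

text \<open>\<open>Hom(d, N) : Hom(M, N) \<rightarrow> Hom(M', N)\<close> for a linear map \<open>d : M' \<rightarrow> M\<close>.\<close>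

definition hom_precomp ::
    "('r, 'm, 'z) module_scheme \<Rightarrow> ('m \<Rightarrow> 'l) \<Rightarrow> ('l \<Rightarrow> 'n) \<Rightarrow> 'm \<Rightarrow> 'n" where
  "hom_precomp M' d f = restrict (f \<circ> d) (carrier M')"

text \<open>The cohomology \<open>ker g / im f\<close> at the middle term of a complex \<open>X \<rightarrow> Y \<rightarrow> Z\<close> with maps \<open>f\<close> and \<open>g\<close>.\<close>

definition cohomology ::
    "('r, 'x, 'u) module_scheme \<Rightarrow> ('r, 'y, 'v) module_scheme \<Rightarrow> ('r, 'z, 'w) module_scheme
     \<Rightarrow> ('x \<Rightarrow> 'y) \<Rightarrow> ('y \<Rightarrow> 'z) \<Rightarrow> ('r, 'y set) module" where
  "cohomology X Y Z f g =
     quot_module (Y\<lparr>carrier := {y \<in> carrier Y. g y = \<zero>\<^bsub>Z\<^esub>}\<rparr>) (f ` carrier X)"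

text \<open>\<open>T\<^sup>2(A/\<complex>; N) = H\<^sup>2(Hom\<^sub>A(L\<^bsub>A/\<complex>\<^esub>, N))\<close>.\<close>

definition T2_module ::
    "(complex, 'a, 'z) module_scheme \<Rightarrow> ('a, 'n, 'w) module_scheme
     \<Rightarrow> ('a, (('a, 'a res2) diff_over \<Rightarrow> 'n) set) module" where
  "T2_module A N = cohomology
     (hom_module A (cotangent1 A) N) (hom_module A (cotangent2 A) N) (hom_module A (cotangent3 A) N)
     (hom_precomp (cotangent2 A) (cotangent_d2 A)) (hom_precomp (cotangent3 A) (cotangent_d3 A))"

abbreviation T2 ::
    "(complex, 'a, 'z) module_scheme \<Rightarrow> ('a, (('a, 'a res2) diff_over \<Rightarrow> 'a) set) module" where
  "T2 A \<equiv> T2_module A (regular_module A)"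


section \<open>Stanley--Reisner rings and the complex of non-crossing diagonals\<close>

text \<open>A simplicial complex is given by its vertex set \<open>V\<close> and its set of faces \<open>K\<close>.\<close>

definition stanley_reisner_ideal :: "'v set \<Rightarrow> 'v set set \<Rightarrow> 'v cpoly set" where
  "stanley_reisner_ideal V K =
     Idl\<^bsub>poly_algebra V\<^esub> {\<Prod>v\<in>F. poly_var v |F. finite F \<and> F \<subseteq> V \<and> F \<notin> K}"

definition stanley_reisner_ring :: "'v set \<Rightarrow> 'v set set \<Rightarrow> (complex, 'v cpoly set) module" where
  "stanley_reisner_ring V K = quot_module (poly_algebra V) (stanley_reisner_ideal V K)"

text \<open>The diagonal joining the vertices \<open>i < j\<close> of the \<open>n\<close>-gon, labelled cyclically by \<open>1, ..., n\<close>, is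
  the pair \<open>(i, j)\<close>.  Two diagonals meet in the interior of the convex polygon iff their end points
  are four distinct vertices that interlace.\<close>

definition diagonals :: "nat \<Rightarrow> (nat \<times> nat) set" where
  "diagonals n = {(i, j). 1 \<le> i \<and> i < j \<and> j \<le> n \<and> j \<noteq> i + 1 \<and> \<not> (i = 1 \<and> j = n)}"

definition crossing :: "nat \<times> nat \<Rightarrow> nat \<times> nat \<Rightarrow> bool" where
  "crossing d e \<longleftrightarrow> fst d < fst e \<and> fst e < snd d \<and> snd d < snd e \<or>
                   fst e < fst d \<and> fst d < snd e \<and> snd e < snd d"

definition assoc_complex :: "nat \<Rightarrow> (nat \<times> nat) set set" where
  "assoc_complex n = {F. F \<subseteq> diagonals n \<and> (\<forall>d\<in>F. \<forall>e\<in>F. \<not> crossing d e)}"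

definition assoc_SR_ring :: "nat \<Rightarrow> (complex, (nat \<times> nat) cpoly set) module" where
  "assoc_SR_ring n = stanley_reisner_ring (diagonals n) (assoc_complex n)"

end

theory Submission
  imports Defs
begin

text \<open>A cochain of degree \<open>k\<close> of the standard resolution with values in \<open>A\<close> is a derivation on a
  polynomial algebra, that is, a function on the set of variables.  Write \<open>A = R / I\<close> with \<open>R\<close> a
  polynomial ring.  A 2-cocycle becomes a coboundary after pulling it back to \<open>R\<close>, and the primitive
  can be corrected by cochains on \<open>R\<close> until the only obstruction to its descending to \<open>A\<close> is a
  symmetric bilinear map \<open>\<beta>\<close> on \<open>R \<times> I\<close>, the cocycle of an extension of \<open>R\<close>-modules
  \<open>0 \<rightarrow> A \<rightarrow> E \<rightarrow> I \<rightarrow> 0\<close> in which \<open>i j' = j i'\<close> for lifts \<open>i', j' \<in> E\<close> of \<open>i, j \<in> I\<close>.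
  The cocycle is a coboundary as soon as all such extensions split.

  If \<open>I\<close> is generated by the products \<open>x y\<close> of crossing diagonals, splitting is a linear problem in
  every degree \<open>c\<close> of the fine grading.  Let \<open>b\<close> be the set of variables of negative degree in \<open>c\<close>.
  The Koszul symmetry leaves only obstructions for syzygies between \<open>x y\<close> and \<open>x z\<close> with
  \<open>x \<in> b \<subseteq> {x, y, z}\<close>.  They vanish if \<open>b\<close> has three elements.  If \<open>b = {p, q}\<close> they are a function on
  diagonals crossing \<open>p\<close> or \<open>q\<close> that is constant because these are connected under non-crossing; if
  \<open>b = {p}\<close> they are a 1-cocycle on the complex of diagonals crossing \<open>p\<close>, which is a cone.\<close>

section \<open>Modules presented by generators and relations\<close>

text \<open>In classical terms, with F free on generators of \<open>I\<close>, Rel its syzygies and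
  Kos the Koszul ones, the group is the cokernel of Hom(F, A) in Hom(Rel / Kos, A). The definition
  at hand is the standard resolution, whose terms are polynomial rings on whole algebras, so this
  description has to be recovered on cochains. Two facts make that possible: \<pi> lifts to a
  homomorphism from \<open>R\<close> to \<open>\<complex>[A]\<close>, because \<open>R\<close> is
  free, and this gives an explicit primitive of the pulled-back cocycle; and \<open>A\<close> has a
  linear section into \<open>R\<close>, so values in \<open>A\<close> can be stored as polynomials.
  The symmetry of \<beta> is the commutativity of a product of two variables; it makes the induced
  map on Rel vanish on Kos. In the fine grading every component of \<open>A\<close> has dimension at
  most one, so a map on syzygies becomes a scalar function on triples of diagonals. The geometry of
  the polygon enters through the cone and the connectedness statement.\<close>

lemma free_module_simps [simp]:
  "zero (free_module R S) = (\<lambda>s. \<zero>\<^bsub>R\<^esub>)"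
  "add (free_module R S) = (\<lambda>x y s. x s \<oplus>\<^bsub>R\<^esub> y s)"
  "smult (free_module R S) = (\<lambda>r x s. r \<otimes>\<^bsub>R\<^esub> x s)"
  by (simp_all add: free_module_def)

lemma free_module_carrier:
  "x \<in> carrier (free_module R S) \<longleftrightarrow>
    (\<forall>s. x s \<in> carrier R) \<and> (\<forall>s. s \<notin> S \<longrightarrow> x s = \<zero>\<^bsub>R\<^esub>) \<and> finite {s. x s \<noteq> \<zero>\<^bsub>R\<^esub>}"
  by (simp add: free_module_def)

lemma free_module_module:
  assumes "cring R"
  shows "module R (free_module R S)"
proof -
  interpret cring R by fact
  have fin_add: "finite {s. x s \<oplus>\<^bsub>R\<^esub> y s \<noteq> \<zero>\<^bsub>R\<^esub>}"
    if "finite {s. x s \<noteq> \<zero>\<^bsub>R\<^esub>}" "finite {s. y s \<noteq> \<zero>\<^bsub>R\<^esub>}" "\<forall>s. x s \<in> carrier R" "\<forall>s. y s \<in> carrier R" for x y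
    by (rule finite_subset[of _ "{s. x s \<noteq> \<zero>\<^bsub>R\<^esub>} \<union> {s. y s \<noteq> \<zero>\<^bsub>R\<^esub>}"]) (use that in auto)
  have fin_smult: "finite {s. r \<otimes>\<^bsub>R\<^esub> x s \<noteq> \<zero>\<^bsub>R\<^esub>}"
    if "finite {s. x s \<noteq> \<zero>\<^bsub>R\<^esub>}" "r \<in> carrier R" for r x
    by (rule finite_subset[OF _ that(1)]) (use that in auto)
  show ?thesis
  proof (rule moduleI)
    show "abelian_group (free_module R S)"
    proof (rule abelian_groupI)
      fix x assume x: "x \<in> carrier (free_module R S)"
      have "(\<lambda>s. \<ominus>\<^bsub>R\<^esub> x s) \<in> carrier (free_module R S)"
        by (rule free_module_carrier[THEN iffD2])
           (use x in \<open>auto simp: free_module_carrier intro: finite_subset[of _ "{s. x s \<noteq> \<zero>\<^bsub>R\<^esub>}"]\<close>)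
      moreover have "(\<lambda>s. \<ominus>\<^bsub>R\<^esub> x s) \<oplus>\<^bsub>free_module R S\<^esub> x = \<zero>\<^bsub>free_module R S\<^esub>"
        using x by (auto simp: free_module_carrier l_neg)
      ultimately show "\<exists>y\<in>carrier (free_module R S). y \<oplus>\<^bsub>free_module R S\<^esub> x = \<zero>\<^bsub>free_module R S\<^esub>"
        by blast
    qed (auto simp: free_module_carrier fin_add a_ac)
  qed (use assms in \<open>auto simp: free_module_carrier fin_smult l_distr r_distr m_assoc\<close>)
qed

lemma unit_vec_closed:
  assumes "cring R" "s \<in> S"
  shows "unit_vec R s \<in> carrier (free_module R S)"
proof -
  interpret cring R by fact
  have "{t. unit_vec R s t \<noteq> \<zero>\<^bsub>R\<^esub>} \<subseteq> {s}" by (auto simp: unit_vec_def)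
  then have "finite {t. unit_vec R s t \<noteq> \<zero>\<^bsub>R\<^esub>}" by (meson finite.simps finite_subset)
  then show ?thesis using assms(2)
    by (auto simp: free_module_carrier unit_vec_def)
qed

text \<open>Induction over the finite support: setting one coordinate to zero splits off a multiple
  of a unit vector.\<close>

lemma free_module_induct [consumes 2, case_names zero step]:
  assumes "cring R" "x \<in> carrier (free_module R S)"
    and zero: "P (zero (free_module R S))"
    and step: "\<And>r s y. r \<in> carrier R \<Longrightarrow> s \<in> S \<Longrightarrow> y \<in> carrier (free_module R S) \<Longrightarrow> P y \<Longrightarrow>
      P (r \<odot>\<^bsub>free_module R S\<^esub> unit_vec R s \<oplus>\<^bsub>free_module R S\<^esub> y)"
  shows "P x"
proof -
  interpret cring R by fact
  have "\<forall>x. {s. x s \<noteq> \<zero>\<^bsub>R\<^esub>} = A \<longrightarrow> x \<in> carrier (free_module R S) \<longrightarrow> P x" if "finite A" for A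
    using that
  proof (induction A)
    case empty
    show ?case
    proof (intro allI impI)
      fix x assume "{s. x s \<noteq> \<zero>\<^bsub>R\<^esub>} = {}" "x \<in> carrier (free_module R S)"
      then have "x = zero (free_module R S)" by (auto simp: fun_eq_iff)
      then show "P x" using zero by simp
    qed
  next
    case (insert t A)
    show ?case
    proof (intro allI impI)
      fix x assume supp: "{s. x s \<noteq> \<zero>\<^bsub>R\<^esub>} = insert t A" and x: "x \<in> carrier (free_module R S)"
      define y where "y = x(t := \<zero>\<^bsub>R\<^esub>)"
      have sy: "{s. y s \<noteq> \<zero>\<^bsub>R\<^esub>} = A" using supp insert.hyps by (auto simp: y_def)
      then have y: "y \<in> carrier (free_module R S)"
        using x insert.hyps by (auto simp: free_module_carrier y_def)
      have "x t \<noteq> \<zero>\<^bsub>R\<^esub>" using supp by auto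
      then have t: "t \<in> S" "x t \<in> carrier R" using x by (auto simp: free_module_carrier)
      have "x = x t \<odot>\<^bsub>free_module R S\<^esub> unit_vec R t \<oplus>\<^bsub>free_module R S\<^esub> y"
        using x t by (auto simp: fun_eq_iff unit_vec_def y_def free_module_carrier)
      then show "P x" using step[OF t(2) t(1) y] insert.IH sy y by metis
    qed
  qed
  moreover have "finite {s. x s \<noteq> \<zero>\<^bsub>R\<^esub>}" using assms(2) by (simp add: free_module_carrier)
  ultimately show ?thesis using assms(2) by blast
qed

text \<open>The sum that \<open>presented_lift\<close> forms on every element of a coset, taken here
  on one vector. Constancy on cosets is what makes \<open>presented_lift\<close> meaningful.\<close>

definition free_lift where
  "free_lift R M \<phi> g x = (\<Oplus>\<^bsub>M\<^esub>s\<in>{s. x s \<noteq> \<zero>\<^bsub>R\<^esub>}. \<phi> (x s) \<odot>\<^bsub>M\<^esub> g s)"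

locale free_module_lift = B: cring R + module T M for R :: "('r,'y) ring_scheme"
    and T :: "('t,'u) ring_scheme" and M :: "('t,'m,'z) module_scheme" +
  fixes S :: "'s set" and \<phi> g
  assumes \<phi>: "\<phi> \<in> ring_hom R T" and g: "\<And>s. s \<in> S \<Longrightarrow> g s \<in> carrier M"
begin

abbreviation "F \<equiv> free_module R S"
abbreviation "L \<equiv> free_lift R M \<phi> g"

lemma \<phi>_zero: "\<phi> \<zero>\<^bsub>R\<^esub> = \<zero>\<^bsub>T\<^esub>"
  by (rule ring_hom_zero[OF \<phi> B.ring_axioms R.ring_axioms])

lemma \<phi>_closed: "r \<in> carrier R \<Longrightarrow> \<phi> r \<in> carrier T"
  by (rule ring_hom_closed[OF \<phi>])

text \<open>The summands outside the support vanish, as \<phi> sends zero to zero. Enlarging the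
  index set lets the sums for two vectors run over a common set, which additivity requires.\<close>

lemma eq_sum:
  assumes "x \<in> carrier F" "finite A" "{s. x s \<noteq> \<zero>\<^bsub>R\<^esub>} \<subseteq> A" "A \<subseteq> S"
  shows "L x = (\<Oplus>\<^bsub>M\<^esub>s\<in>A. \<phi> (x s) \<odot>\<^bsub>M\<^esub> g s)"
  unfolding free_lift_def
proof (rule M.add.finprod_mono_neutral_cong_left)
  show "\<phi> (x i) \<odot>\<^bsub>M\<^esub> g i = \<zero>\<^bsub>M\<^esub>" if "i \<in> A - {s. x s \<noteq> \<zero>\<^bsub>R\<^esub>}" for i
    using that assms g by (auto simp: \<phi>_zero)
  show "(\<lambda>s. \<phi> (x s) \<odot>\<^bsub>M\<^esub> g s) \<in> A \<rightarrow> carrier M"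
    using assms g by (auto simp: free_module_carrier intro!: smult_closed \<phi>_closed)
qed (use assms in auto)

lemma summand_closed: "x \<in> carrier F \<Longrightarrow> A \<subseteq> S \<Longrightarrow> (\<lambda>s. \<phi> (x s) \<odot>\<^bsub>M\<^esub> g s) \<in> A \<rightarrow> carrier M"
  using g by (auto simp: free_module_carrier intro!: smult_closed \<phi>_closed)

lemma supp: "x \<in> carrier F \<Longrightarrow> {s. x s \<noteq> \<zero>\<^bsub>R\<^esub>} \<subseteq> S" "x \<in> carrier F \<Longrightarrow> finite {s. x s \<noteq> \<zero>\<^bsub>R\<^esub>}"
  by (auto simp: free_module_carrier)

lemma closed: "x \<in> carrier F \<Longrightarrow> L x \<in> carrier M"
  unfolding free_lift_def by (rule M.add.finprod_closed) (rule summand_closed[OF _ supp(1)])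

lemma add:
  assumes "x \<in> carrier F" "y \<in> carrier F"
  shows "L (x \<oplus>\<^bsub>F\<^esub> y) = L x \<oplus>\<^bsub>M\<^esub> L y"
proof -
  interpret F: module R F by (rule free_module_module) (rule B.cring_axioms)
  let ?A = "{s. x s \<noteq> \<zero>\<^bsub>R\<^esub>} \<union> {s. y s \<noteq> \<zero>\<^bsub>R\<^esub>}"
  have A: "finite ?A" "?A \<subseteq> S" using supp assms by auto
  have xy: "x \<oplus>\<^bsub>F\<^esub> y \<in> carrier F" using assms by (rule F.a_closed)
  have "L (x \<oplus>\<^bsub>F\<^esub> y) = (\<Oplus>\<^bsub>M\<^esub>s\<in>?A. \<phi> (x s \<oplus>\<^bsub>R\<^esub> y s) \<odot>\<^bsub>M\<^esub> g s)"
    by (subst eq_sum[OF xy A(1) _ A(2)]) (use assms in \<open>auto simp: free_module_carrier\<close>)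
  also have "\<dots> = (\<Oplus>\<^bsub>M\<^esub>s\<in>?A. \<phi> (x s) \<odot>\<^bsub>M\<^esub> g s \<oplus>\<^bsub>M\<^esub> \<phi> (y s) \<odot>\<^bsub>M\<^esub> g s)"
  proof (rule M.add.finprod_cong')
    show "(\<lambda>s. \<phi> (x s) \<odot>\<^bsub>M\<^esub> g s \<oplus>\<^bsub>M\<^esub> \<phi> (y s) \<odot>\<^bsub>M\<^esub> g s) \<in> ?A \<rightarrow> carrier M"
      using summand_closed[OF assms(1) A(2)] summand_closed[OF assms(2) A(2)] by auto
    fix s assume "s \<in> ?A"
    then have "x s \<in> carrier R" "y s \<in> carrier R" "s \<in> S" using assms A by (auto simp: free_module_carrier)
    then show "\<phi> (x s \<oplus>\<^bsub>R\<^esub> y s) \<odot>\<^bsub>M\<^esub> g s = \<phi> (x s) \<odot>\<^bsub>M\<^esub> g s \<oplus>\<^bsub>M\<^esub> \<phi> (y s) \<odot>\<^bsub>M\<^esub> g s"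
      using g \<phi>_closed by (simp add: ring_hom_add[OF \<phi>] smult_l_distr)
  qed simp
  also have "\<dots> = (\<Oplus>\<^bsub>M\<^esub>s\<in>?A. \<phi> (x s) \<odot>\<^bsub>M\<^esub> g s) \<oplus>\<^bsub>M\<^esub> (\<Oplus>\<^bsub>M\<^esub>s\<in>?A. \<phi> (y s) \<odot>\<^bsub>M\<^esub> g s)"
    by (rule M.add.finprod_multf) (rule summand_closed[OF assms(1) A(2)], rule summand_closed[OF assms(2) A(2)])
  also have "\<dots> = L x \<oplus>\<^bsub>M\<^esub> L y"
    using eq_sum[OF assms(1) A(1) _ A(2)] eq_sum[OF assms(2) A(1) _ A(2)] by auto
  finally show ?thesis .
qed

lemma smult:
  assumes "r \<in> carrier R" "x \<in> carrier F"
  shows "L (r \<odot>\<^bsub>F\<^esub> x) = \<phi> r \<odot>\<^bsub>M\<^esub> L x"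
proof -
  interpret F: module R F by (rule free_module_module) (rule B.cring_axioms)
  let ?A = "{s. x s \<noteq> \<zero>\<^bsub>R\<^esub>}"
  note A = supp[OF assms(2)]
  have rx: "r \<odot>\<^bsub>F\<^esub> x \<in> carrier F" using assms by (rule F.smult_closed)
  have "L (r \<odot>\<^bsub>F\<^esub> x) = (\<Oplus>\<^bsub>M\<^esub>s\<in>?A. \<phi> (r \<otimes>\<^bsub>R\<^esub> x s) \<odot>\<^bsub>M\<^esub> g s)"
    by (subst eq_sum[OF rx A(2) _ A(1)]) (use assms in auto)
  also have "\<dots> = (\<Oplus>\<^bsub>M\<^esub>s\<in>?A. \<phi> r \<odot>\<^bsub>M\<^esub> (\<phi> (x s) \<odot>\<^bsub>M\<^esub> g s))"
  proof (rule M.add.finprod_cong')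
    show "(\<lambda>s. \<phi> r \<odot>\<^bsub>M\<^esub> (\<phi> (x s) \<odot>\<^bsub>M\<^esub> g s)) \<in> ?A \<rightarrow> carrier M"
      using summand_closed[OF assms(2) A(1)] \<phi>_closed[OF assms(1)] by auto
    fix s assume "s \<in> ?A"
    then have "x s \<in> carrier R" "s \<in> S" using assms A by (auto simp: free_module_carrier)
    then show "\<phi> (r \<otimes>\<^bsub>R\<^esub> x s) \<odot>\<^bsub>M\<^esub> g s = \<phi> r \<odot>\<^bsub>M\<^esub> (\<phi> (x s) \<odot>\<^bsub>M\<^esub> g s)"
      using g \<phi>_closed assms by (simp add: ring_hom_mult[OF \<phi>] smult_assoc1)
  qed simp
  also have "\<dots> = \<phi> r \<odot>\<^bsub>M\<^esub> L x" unfolding free_lift_def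
    by (rule finsum_smult_ldistr[symmetric]) (use A \<phi>_closed assms(1) summand_closed[OF assms(2) A(1)] in auto)
  finally show ?thesis .
qed

lemma unit_vec:
  assumes "s \<in> S"
  shows "L (unit_vec R s) = g s"
proof -
  have "L (unit_vec R s) = (\<Oplus>\<^bsub>M\<^esub>t\<in>{s}. \<phi> (unit_vec R s t) \<odot>\<^bsub>M\<^esub> g t)"
    by (rule eq_sum[OF unit_vec_closed[OF B.cring_axioms assms]]) (use assms in \<open>auto simp: unit_vec_def\<close>)
  also have "\<dots> = g s"
    using g[OF assms] by (simp add: unit_vec_def ring_hom_one[OF \<phi>])
  finally show ?thesis .
qed

lemma zero: "L \<zero>\<^bsub>F\<^esub> = \<zero>\<^bsub>M\<^esub>"
  unfolding free_lift_def by simp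

end


section \<open>Quotient modules and submodule spans\<close>

lemma quot_module_simps:
  "carrier (quot_module M N) = (\<lambda>x. N +>\<^bsub>M\<^esub> x) ` carrier M"
  "zero (quot_module M N) = N"
  "add (quot_module M N) = set_add M"
  "smult (quot_module M N) = (\<lambda>r X. N <+>\<^bsub>M\<^esub> ((\<lambda>x. r \<odot>\<^bsub>M\<^esub> x) ` X))"
  "mult (quot_module M N) = rcoset_mult M N"
  "one (quot_module M N) = N +>\<^bsub>M\<^esub> \<one>\<^bsub>M\<^esub>"
  by (auto simp: quot_module_def ring.defs module.defs FactRing_def A_RCOSETS_def')

context module
begin

context
  fixes N assumes N: "submodule N R M"
begin

lemma submodule_abelian_subgroup: "abelian_subgroup N M"
  by (rule abelian_subgroupI3)
     (use N submodule.axioms(1)[OF N] in \<open>auto intro: additive_subgroupI M.abelian_group_axioms\<close>)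

lemma quot_add:
  assumes "x \<in> carrier M" "y \<in> carrier M"
  shows "(N +>\<^bsub>M\<^esub> x) \<oplus>\<^bsub>quot_module M N\<^esub> (N +>\<^bsub>M\<^esub> y) = N +>\<^bsub>M\<^esub> (x \<oplus>\<^bsub>M\<^esub> y)"
  using abelian_subgroup.a_rcos_sum[OF submodule_abelian_subgroup assms]
  by (simp add: quot_module_simps)

text \<open>Scaling a coset elementwise gives \<open>r N + r x\<close>, in general smaller than a
  coset; the summand \<open>N\<close> in the definition of \<open>quot_module\<close> fills it up
  again.\<close>

lemma quot_smult:
  assumes "r \<in> carrier R" "x \<in> carrier M"
  shows "r \<odot>\<^bsub>quot_module M N\<^esub> (N +>\<^bsub>M\<^esub> x) = N +>\<^bsub>M\<^esub> (r \<odot>\<^bsub>M\<^esub> x)"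
proof -
  note E = submoduleE[OF N]
  have "r \<odot>\<^bsub>quot_module M N\<^esub> (N +>\<^bsub>M\<^esub> x)
      = {n \<oplus>\<^bsub>M\<^esub> r \<odot>\<^bsub>M\<^esub> (h \<oplus>\<^bsub>M\<^esub> x) |n h. n \<in> N \<and> h \<in> N}"
    by (auto simp: quot_module_simps set_add_def' a_r_coset_def')
  also have "\<dots> = {n \<oplus>\<^bsub>M\<^esub> r \<odot>\<^bsub>M\<^esub> x |n. n \<in> N}"
  proof (intro equalityI subsetI)
    fix z assume "z \<in> {n \<oplus>\<^bsub>M\<^esub> r \<odot>\<^bsub>M\<^esub> (h \<oplus>\<^bsub>M\<^esub> x) |n h. n \<in> N \<and> h \<in> N}"
    then obtain n h where nh: "n \<in> N" "h \<in> N" "z = n \<oplus>\<^bsub>M\<^esub> r \<odot>\<^bsub>M\<^esub> (h \<oplus>\<^bsub>M\<^esub> x)" by blast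
    then have "z = (n \<oplus>\<^bsub>M\<^esub> r \<odot>\<^bsub>M\<^esub> h) \<oplus>\<^bsub>M\<^esub> r \<odot>\<^bsub>M\<^esub> x"
      using E(1) assms by (simp add: smult_r_distr subset_iff M.a_assoc)
    moreover have "n \<oplus>\<^bsub>M\<^esub> r \<odot>\<^bsub>M\<^esub> h \<in> N" using nh assms E by auto
    ultimately show "z \<in> {n \<oplus>\<^bsub>M\<^esub> r \<odot>\<^bsub>M\<^esub> x |n. n \<in> N}" by blast
  next
    fix z assume "z \<in> {n \<oplus>\<^bsub>M\<^esub> r \<odot>\<^bsub>M\<^esub> x |n. n \<in> N}"
    then obtain n where n: "n \<in> N" "z = n \<oplus>\<^bsub>M\<^esub> r \<odot>\<^bsub>M\<^esub> x" by blast
    have z: "\<zero>\<^bsub>M\<^esub> \<in> N" using N subgroup.one_closed submodule.axioms(1) by fastforce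
    have "z = n \<oplus>\<^bsub>M\<^esub> r \<odot>\<^bsub>M\<^esub> (\<zero>\<^bsub>M\<^esub> \<oplus>\<^bsub>M\<^esub> x)" using n assms by simp
    then show "z \<in> {n \<oplus>\<^bsub>M\<^esub> r \<odot>\<^bsub>M\<^esub> (h \<oplus>\<^bsub>M\<^esub> x) |n h. n \<in> N \<and> h \<in> N}" using n z by blast
  qed
  also have "\<dots> = N +>\<^bsub>M\<^esub> (r \<odot>\<^bsub>M\<^esub> x)" by (auto simp: a_r_coset_def')
  finally show ?thesis .
qed

lemma quot_zero: "\<zero>\<^bsub>quot_module M N\<^esub> = N +>\<^bsub>M\<^esub> \<zero>\<^bsub>M\<^esub>"
  using submoduleE(1)[OF N] by (simp add: quot_module_simps)

lemma quot_module_module: "module R (quot_module M N)"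
proof (rule moduleI)
  interpret N: abelian_subgroup N M by (rule submodule_abelian_subgroup)
  show "abelian_group (quot_module M N)"
  proof (rule abelian_groupI)
    fix X assume "X \<in> carrier (quot_module M N)"
    then obtain x where x: "x \<in> carrier M" "X = N +>\<^bsub>M\<^esub> x" by (auto simp: quot_module_simps(1))
    then have "(N +>\<^bsub>M\<^esub> (\<ominus>\<^bsub>M\<^esub> x)) \<oplus>\<^bsub>quot_module M N\<^esub> X = \<zero>\<^bsub>quot_module M N\<^esub>"
      by (simp add: quot_add quot_zero M.l_neg)
    then show "\<exists>Y\<in>carrier (quot_module M N). Y \<oplus>\<^bsub>quot_module M N\<^esub> X = \<zero>\<^bsub>quot_module M N\<^esub>"
      using x by (auto simp: quot_module_simps(1))
  qed (auto simp: quot_module_simps(1) quot_add quot_zero M.a_ac)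
  fix a b X Y assume "a \<in> carrier R" "b \<in> carrier R" "X \<in> carrier (quot_module M N)" "Y \<in> carrier (quot_module M N)"
  then obtain x y where "a \<in> carrier R" "b \<in> carrier R" "x \<in> carrier M" "y \<in> carrier M" "X = N +>\<^bsub>M\<^esub> x" "Y = N +>\<^bsub>M\<^esub> y"
    by (auto simp: quot_module_simps(1))
  then show "a \<odot>\<^bsub>quot_module M N\<^esub> (X \<oplus>\<^bsub>quot_module M N\<^esub> Y) =
       a \<odot>\<^bsub>quot_module M N\<^esub> X \<oplus>\<^bsub>quot_module M N\<^esub> a \<odot>\<^bsub>quot_module M N\<^esub> Y"
    by (simp add: quot_add quot_smult smult_r_distr)
qed (auto simp: quot_module_simps(1) quot_add quot_smult smult_l_distr smult_assoc1 intro: R.cring_axioms)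

lemma quot_eq_iff:
  assumes "x \<in> carrier M" "y \<in> carrier M"
  shows "N +>\<^bsub>M\<^esub> x = N +>\<^bsub>M\<^esub> y \<longleftrightarrow> x \<ominus>\<^bsub>M\<^esub> y \<in> N"
proof -
  interpret N: abelian_subgroup N M by (rule submodule_abelian_subgroup)
  show ?thesis using assms
    by (metis N.a_subset M.a_coset_add_inv1 M.a_coset_add_inv2 M.a_coset_join1 M.a_coset_join2 M.minus_closed
        M.minus_eq N.a_subgroup)
qed

end

lemma submodule_span_submodule:
  assumes "X \<subseteq> carrier M"
  shows "submodule (submodule_span R M X) R M"
proof -
  have c: "carrier M \<in> {N. submodule N R M \<and> X \<subseteq> N}" using carrier_is_submodule assms by auto
  show ?thesis
    unfolding submodule_span_def
  proof (rule submoduleI)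
    show "\<Inter> {N. submodule N R M \<and> X \<subseteq> N} \<subseteq> carrier M" using c by blast
    show "\<zero>\<^bsub>M\<^esub> \<in> \<Inter> {N. submodule N R M \<and> X \<subseteq> N}"
      using subgroup.one_closed submodule.axioms(1) by fastforce
  qed (use submoduleE in auto)
qed

lemma submodule_span_incl: "X \<subseteq> submodule_span R M X"
  by (auto simp: submodule_span_def)

lemma submodule_span_least: "submodule N R M \<Longrightarrow> X \<subseteq> N \<Longrightarrow> submodule_span R M X \<subseteq> N"
  by (auto simp: submodule_span_def)

end

lemma regular_module_simps [simp]:
  "carrier (regular_module R) = carrier R" "add (regular_module R) = add R"
  "zero (regular_module R) = zero R" "smult (regular_module R) = mult R"
  by (simp_all add: regular_module_def)

lemma regular_module_module:
  assumes "cring R"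
  shows "module R (regular_module R)"
proof -
  interpret cring R by fact
  show ?thesis
    by (rule moduleI[OF assms])
       (auto intro!: abelian_groupI simp: a_ac l_distr r_distr m_assoc intro: l_neg)
qed

section \<open>Semilinear maps, differentials and base change\<close>

text \<open>One notion for three uses: linear maps, with \<phi> the identity; maps out of
  \<open>\<Omega>\<close> along an algebra homomorphism; and
  \<open>m \<mapsto> m \<otimes> 1\<close> along an augmentation.\<close>

definition semilinear where
  "semilinear R \<phi> M N f \<longleftrightarrow>
     (\<forall>x\<in>carrier M. f x \<in> carrier N) \<and>
     (\<forall>x\<in>carrier M. \<forall>y\<in>carrier M. f (x \<oplus>\<^bsub>M\<^esub> y) = f x \<oplus>\<^bsub>N\<^esub> f y) \<and>
     (\<forall>r\<in>carrier R. \<forall>x\<in>carrier M. f (r \<odot>\<^bsub>M\<^esub> x) = \<phi> r \<odot>\<^bsub>N\<^esub> f x)"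

lemma semilinearI:
  assumes "\<And>x. x \<in> carrier M \<Longrightarrow> f x \<in> carrier N"
    and "\<And>x y. x \<in> carrier M \<Longrightarrow> y \<in> carrier M \<Longrightarrow> f (x \<oplus>\<^bsub>M\<^esub> y) = f x \<oplus>\<^bsub>N\<^esub> f y"
    and "\<And>r x. r \<in> carrier R \<Longrightarrow> x \<in> carrier M \<Longrightarrow> f (r \<odot>\<^bsub>M\<^esub> x) = \<phi> r \<odot>\<^bsub>N\<^esub> f x"
  shows "semilinear R \<phi> M N f"
  using assms by (auto simp: semilinear_def)

lemma semilinearD:
  assumes "semilinear R \<phi> M N f"
  shows "x \<in> carrier M \<Longrightarrow> f x \<in> carrier N"
    and "x \<in> carrier M \<Longrightarrow> y \<in> carrier M \<Longrightarrow> f (x \<oplus>\<^bsub>M\<^esub> y) = f x \<oplus>\<^bsub>N\<^esub> f y"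
    and "r \<in> carrier R \<Longrightarrow> x \<in> carrier M \<Longrightarrow> f (r \<odot>\<^bsub>M\<^esub> x) = \<phi> r \<odot>\<^bsub>N\<^esub> f x"
  using assms by (auto simp: semilinear_def)

lemma semilinear_zero:
  assumes "semilinear R \<phi> M N f" "abelian_group M" "abelian_group N"
  shows "f \<zero>\<^bsub>M\<^esub> = \<zero>\<^bsub>N\<^esub>"
proof -
  interpret M: abelian_group M by fact
  interpret N: abelian_group N by fact
  have "f \<zero>\<^bsub>M\<^esub> \<oplus>\<^bsub>N\<^esub> f \<zero>\<^bsub>M\<^esub> = f \<zero>\<^bsub>M\<^esub>"
    using semilinearD(2)[OF assms(1) M.zero_closed M.zero_closed] by simp
  then show ?thesis using semilinearD(1)[OF assms(1) M.zero_closed] by (metis N.add.l_cancel_one)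
qed

lemma semilinear_minus:
  assumes "semilinear R \<phi> M N f" "abelian_group M" "abelian_group N" "x \<in> carrier M" "y \<in> carrier M"
  shows "f (x \<ominus>\<^bsub>M\<^esub> y) = f x \<ominus>\<^bsub>N\<^esub> f y"
proof -
  interpret M: abelian_group M by fact
  interpret N: abelian_group N by fact
  note c = semilinearD(1)[OF assms(1)]
  have "f (x \<ominus>\<^bsub>M\<^esub> y) \<oplus>\<^bsub>N\<^esub> f y = f (x \<ominus>\<^bsub>M\<^esub> y \<oplus>\<^bsub>M\<^esub> y)"
    using assms semilinearD(2)[OF assms(1)] by simp
  also have "x \<ominus>\<^bsub>M\<^esub> y \<oplus>\<^bsub>M\<^esub> y = x" using assms(4,5) by (simp add: M.minus_eq M.a_assoc M.l_neg)
  finally show ?thesis using c assms(4,5)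
    by (metis M.minus_closed N.add.inv_solve_right N.minus_eq)
qed

lemma semilinear_comp:
  assumes "semilinear R \<phi> M N f" "semilinear T \<psi> N K g" "\<phi> \<in> carrier R \<rightarrow> carrier T"
  shows "semilinear R (\<lambda>r. \<psi> (\<phi> r)) M K (\<lambda>x. g (f x))"
  using assms by (auto simp: semilinear_def Pi_def)

section \<open>Universal property of a presented module\<close>

context
  fixes R :: "('r,'y) ring_scheme" and S :: "'s set" and Rel
  assumes R: "cring R" and Rel: "Rel \<subseteq> carrier (free_module R S)"
begin

abbreviation (input) "FM \<equiv> free_module R S"
abbreviation (input) "SP \<equiv> submodule_span R FM Rel"
abbreviation (input) "PM \<equiv> presented_module R S Rel"
abbreviation (input) "gen \<equiv> presented_gen R S Rel"

interpretation F: module R FM by (rule free_module_module[OF R])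

lemma span_submodule: "submodule SP R FM"
  by (rule F.submodule_span_submodule[OF Rel])

lemma presented_module_module: "module R PM"
  unfolding presented_module_def by (rule F.quot_module_module[OF span_submodule])

lemma presented_carrier: "carrier PM = (\<lambda>x. SP +>\<^bsub>FM\<^esub> x) ` carrier FM"
  by (simp add: presented_module_def quot_module_simps)

lemmas presented_add = F.quot_add[OF span_submodule, folded presented_module_def]
lemmas presented_smult = F.quot_smult[OF span_submodule, folded presented_module_def]
lemmas presented_zero = F.quot_zero[OF span_submodule, folded presented_module_def]

lemma presented_gen_closed: "s \<in> S \<Longrightarrow> gen s \<in> carrier PM"
  unfolding presented_carrier presented_gen_def by (intro imageI unit_vec_closed[OF R])

lemma presented_rel:
  assumes "u \<ominus>\<^bsub>FM\<^esub> v \<in> Rel" "u \<in> carrier FM" "v \<in> carrier FM"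
  shows "SP +>\<^bsub>FM\<^esub> u = SP +>\<^bsub>FM\<^esub> v"
  using F.quot_eq_iff[OF span_submodule assms(2,3)] F.submodule_span_incl[of Rel] assms(1) by auto

lemma presented_induct [consumes 1, case_names zero step]:
  assumes "X \<in> carrier PM"
    and "P (zero PM)"
    and "\<And>r s Y. r \<in> carrier R \<Longrightarrow> s \<in> S \<Longrightarrow> Y \<in> carrier PM \<Longrightarrow> P Y \<Longrightarrow> P (r \<odot>\<^bsub>PM\<^esub> gen s \<oplus>\<^bsub>PM\<^esub> Y)"
  shows "P X"
proof -
  obtain x where x: "x \<in> carrier FM" and X: "X = SP +>\<^bsub>FM\<^esub> x" using assms(1) by (auto simp: presented_carrier)
  have "P (SP +>\<^bsub>FM\<^esub> x)" using R x
  proof (induction rule: free_module_induct)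
    case zero
    then show ?case using assms(2) presented_zero by simp
  next
    case (step r s y)
    have u: "unit_vec R s \<in> carrier FM" using unit_vec_closed[OF R step(2)] .
    have "SP +>\<^bsub>FM\<^esub> (r \<odot>\<^bsub>FM\<^esub> unit_vec R s \<oplus>\<^bsub>FM\<^esub> y) = r \<odot>\<^bsub>PM\<^esub> gen s \<oplus>\<^bsub>PM\<^esub> (SP +>\<^bsub>FM\<^esub> y)"
      using presented_add[OF F.smult_closed[OF step(1) u] step(3)] presented_smult[OF step(1) u]
      by (simp add: presented_gen_def)
    moreover have "P (r \<odot>\<^bsub>PM\<^esub> gen s \<oplus>\<^bsub>PM\<^esub> (SP +>\<^bsub>FM\<^esub> y))"
      using assms(3) step by (auto simp: presented_carrier)
    ultimately show ?case by simp
  qed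
  then show ?thesis using X by simp
qed

lemma presented_ext:
  assumes f: "semilinear R \<phi> PM N f" and g: "semilinear R \<phi> PM N g" and N: "abelian_group N"
    and eq: "\<And>s. s \<in> S \<Longrightarrow> f (gen s) = g (gen s)" and X: "X \<in> carrier PM"
  shows "f X = g X"
proof -
  interpret M: module R PM by (rule presented_module_module)
  show ?thesis using X
  proof (induction rule: presented_induct)
    case zero
    then show ?case using semilinear_zero[OF f M.abelian_group_axioms N] semilinear_zero[OF g M.abelian_group_axioms N] by simp
  next
    case (step r s Y)
    then show ?case using presented_gen_closed[OF step(2)] eq
      by (simp add: semilinearD[OF f] semilinearD[OF g])
  qed
qed

text \<open>The kernel of the lift on the free module is a submodule containing the relations, hence
  their span. The lift is then constant on cosets, so \<open>the_elem\<close> is applied to a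
  singleton.\<close>

lemma presented_lift:
  assumes "module T M" and \<phi>: "\<phi> \<in> ring_hom R T" and g: "\<And>s. s \<in> S \<Longrightarrow> g s \<in> carrier M"
    and rel: "\<And>x. x \<in> Rel \<Longrightarrow> free_lift R M \<phi> g x = \<zero>\<^bsub>M\<^esub>"
  shows "semilinear R \<phi> PM M (presented_lift R M \<phi> g)"
    and "s \<in> S \<Longrightarrow> presented_lift R M \<phi> g (gen s) = g s"
proof -
  interpret L: free_module_lift R T M S \<phi> g
    by (intro free_module_lift.intro free_module_lift_axioms.intro) (use R assms in auto)
  have lin: "semilinear R \<phi> FM M L.L"
    by (rule semilinearI) (use L.closed L.add L.smult in \<open>auto\<close>)
  have ker: "submodule {x \<in> carrier FM. L.L x = \<zero>\<^bsub>M\<^esub>} R FM"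
  proof (rule F.submoduleI)
    fix a assume a: "a \<in> {x \<in> carrier FM. L.L x = \<zero>\<^bsub>M\<^esub>}"
    have "L.L (\<ominus>\<^bsub>FM\<^esub> a) = L.L (\<zero>\<^bsub>FM\<^esub> \<ominus>\<^bsub>FM\<^esub> a)" using a by (simp add: F.minus_eq del: free_module_simps)
    also have "\<dots> = \<zero>\<^bsub>M\<^esub>" using a
      by (subst semilinear_minus[OF lin F.abelian_group_axioms L.abelian_group_axioms])
         (use L.zero in \<open>auto simp: L.M.minus_eq simp del: free_module_simps\<close>)
    finally show "\<ominus>\<^bsub>FM\<^esub> a \<in> {x \<in> carrier FM. L.L x = \<zero>\<^bsub>M\<^esub>}" using a by simp
  qed (use L.zero L.add L.smult L.\<phi>_closed in \<open>auto simp del: free_module_simps\<close>)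
  have span: "SP \<subseteq> {x \<in> carrier FM. L.L x = \<zero>\<^bsub>M\<^esub>}"
    by (rule F.submodule_span_least[OF ker]) (use Rel rel in auto)
  have val: "presented_lift R M \<phi> g (SP +>\<^bsub>FM\<^esub> x) = L.L x" if x: "x \<in> carrier FM" for x
  proof -
    have "L.L ` (SP +>\<^bsub>FM\<^esub> x) = {L.L x}"
    proof -
      have "L.L y = L.L x" if y: "y \<in> SP +>\<^bsub>FM\<^esub> x" for y
      proof -
        obtain h where h: "h \<in> SP" "y = h \<oplus>\<^bsub>FM\<^esub> x" using y by (auto simp: a_r_coset_def')
        then have "h \<in> carrier FM" "L.L h = \<zero>\<^bsub>M\<^esub>" using span by auto
        then show ?thesis using h x L.add[of h x] L.closed[OF x] by simp
      qed
      moreover have "x \<in> SP +>\<^bsub>FM\<^esub> x"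
        using abelian_subgroup.a_rcos_self[OF F.submodule_abelian_subgroup[OF span_submodule] x] .
      ultimately show ?thesis by blast
    qed
    then show ?thesis by (simp add: presented_lift_def free_lift_def[abs_def])
  qed
  show "semilinear R \<phi> PM M (presented_lift R M \<phi> g)"
  proof (rule semilinearI)
    fix X assume "X \<in> carrier PM"
    then obtain x where x: "x \<in> carrier FM" "X = SP +>\<^bsub>FM\<^esub> x" by (auto simp: presented_carrier)
    show "presented_lift R M \<phi> g X \<in> carrier M" using x val L.closed by simp
    show "presented_lift R M \<phi> g (r \<odot>\<^bsub>PM\<^esub> X) = \<phi> r \<odot>\<^bsub>M\<^esub> presented_lift R M \<phi> g X" if r: "r \<in> carrier R" for r
      using x(2) presented_smult[OF r x(1)] val[OF x(1)] val[OF F.smult_closed[OF r x(1)]] L.smult[OF r x(1)]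
      by simp
    fix Y assume "Y \<in> carrier PM"
    then obtain y where y: "y \<in> carrier FM" "Y = SP +>\<^bsub>FM\<^esub> y" by (auto simp: presented_carrier)
    show "presented_lift R M \<phi> g (X \<oplus>\<^bsub>PM\<^esub> Y) = presented_lift R M \<phi> g X \<oplus>\<^bsub>M\<^esub> presented_lift R M \<phi> g Y"
      using x y presented_add[OF x(1) y(1)] val[OF x(1)] val[OF y(1)] val[OF F.add.m_closed[OF x(1) y(1)]] L.add[OF x(1) y(1)]
      by simp
  qed
  show "presented_lift R M \<phi> g (gen s) = g s" if "s \<in> S"
    using val[OF unit_vec_closed[OF R that]] L.unit_vec[OF that] by (simp add: presented_gen_def)
qed

end

section \<open>Complex algebras, derivations and Kaehler differentials\<close>

locale calg = cring A for A :: "(complex, 'a, 'z) module_scheme" (structure) +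
  assumes smult_closed [simp, intro]: "x \<in> carrier A \<Longrightarrow> c \<odot> x \<in> carrier A"
    and smult_l_distr: "x \<in> carrier A \<Longrightarrow> (c + d) \<odot> x = c \<odot> x \<oplus> d \<odot> x"
    and smult_r_distr: "x \<in> carrier A \<Longrightarrow> y \<in> carrier A \<Longrightarrow> c \<odot> (x \<oplus> y) = c \<odot> x \<oplus> c \<odot> y"
    and smult_assoc1: "x \<in> carrier A \<Longrightarrow> (c * d) \<odot> x = c \<odot> (d \<odot> x)"
    and smult_one: "x \<in> carrier A \<Longrightarrow> 1 \<odot> x = x"
    and smult_assoc2: "x \<in> carrier A \<Longrightarrow> y \<in> carrier A \<Longrightarrow> (c \<odot> x) \<otimes> y = c \<odot> (x \<otimes> y)"

lemma (in calg) smult_eq: "x \<in> carrier A \<Longrightarrow> c \<odot> x = (c \<odot> \<one>) \<otimes> x"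
  by (simp add: smult_assoc2)

lemma (in calg) smult_assoc2': "x \<in> carrier A \<Longrightarrow> y \<in> carrier A \<Longrightarrow> x \<otimes> (c \<odot> y) = c \<odot> (x \<otimes> y)"
  by (metis m_comm smult_assoc2 smult_closed)

definition alg_hom where
  "alg_hom P Q f \<longleftrightarrow> f \<in> ring_hom P Q \<and> (\<forall>c. \<forall>x\<in>carrier P. f (c \<odot>\<^bsub>P\<^esub> x) = c \<odot>\<^bsub>Q\<^esub> f x)"

text \<open>Derivations along \<open>e\<close>: \<open>M\<close> is a module over the target of
  \<open>e\<close>, and \<open>P\<close> acts through \<open>e\<close>. The scalar clause has the
  shape of the relation in \<open>kaehler_rels\<close>, where a scalar \<open>c\<close> acts as
  \<open>c 1\<close>.\<close>

definition derivation where
  "derivation P M e D \<longleftrightarrow>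
     (\<forall>p\<in>carrier P. D p \<in> carrier M) \<and>
     (\<forall>p\<in>carrier P. \<forall>q\<in>carrier P. D (p \<oplus>\<^bsub>P\<^esub> q) = D p \<oplus>\<^bsub>M\<^esub> D q) \<and>
     (\<forall>c. \<forall>p\<in>carrier P. D (c \<odot>\<^bsub>P\<^esub> p) = e (c \<odot>\<^bsub>P\<^esub> \<one>\<^bsub>P\<^esub>) \<odot>\<^bsub>M\<^esub> D p) \<and>
     (\<forall>p\<in>carrier P. \<forall>q\<in>carrier P. D (p \<otimes>\<^bsub>P\<^esub> q) = e p \<odot>\<^bsub>M\<^esub> D q \<oplus>\<^bsub>M\<^esub> e q \<odot>\<^bsub>M\<^esub> D p)"

lemma derivationD:
  assumes "derivation P M e D" "p \<in> carrier P" "q \<in> carrier P"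
  shows "D p \<in> carrier M"
    "D (p \<oplus>\<^bsub>P\<^esub> q) = D p \<oplus>\<^bsub>M\<^esub> D q"
    "D (c \<odot>\<^bsub>P\<^esub> p) = e (c \<odot>\<^bsub>P\<^esub> \<one>\<^bsub>P\<^esub>) \<odot>\<^bsub>M\<^esub> D p"
    "D (p \<otimes>\<^bsub>P\<^esub> q) = e p \<odot>\<^bsub>M\<^esub> D q \<oplus>\<^bsub>M\<^esub> e q \<odot>\<^bsub>M\<^esub> D p"
  using assms by (auto simp: derivation_def)

lemma alg_homD:
  assumes "alg_hom P Q f"
  shows "f \<in> ring_hom P Q" "x \<in> carrier P \<Longrightarrow> f (c \<odot>\<^bsub>P\<^esub> x) = c \<odot>\<^bsub>Q\<^esub> f x"
    "x \<in> carrier P \<Longrightarrow> f x \<in> carrier Q"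
    "x \<in> carrier P \<Longrightarrow> y \<in> carrier P \<Longrightarrow> f (x \<oplus>\<^bsub>P\<^esub> y) = f x \<oplus>\<^bsub>Q\<^esub> f y"
    "x \<in> carrier P \<Longrightarrow> y \<in> carrier P \<Longrightarrow> f (x \<otimes>\<^bsub>P\<^esub> y) = f x \<otimes>\<^bsub>Q\<^esub> f y"
    "f \<one>\<^bsub>P\<^esub> = \<one>\<^bsub>Q\<^esub>"
  using assms by (auto simp: alg_hom_def ring_hom_def)

lemma derivation_comp_semilinear:
  assumes "derivation P M e D" "semilinear R \<phi> M N f" "e \<in> carrier P \<rightarrow> carrier R" "calg P" "module R M"
  shows "derivation P N (\<lambda>p. \<phi> (e p)) (\<lambda>p. f (D p))"
proof -
  interpret P: calg P by fact
  interpret M: module R M by fact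
  have "e p \<in> carrier R" if "p \<in> carrier P" for p using assms(3) that by auto
  then show ?thesis
    using assms(1) unfolding derivation_def
    by (auto simp: semilinearD[OF assms(2)])
qed

lemma derivation_comp_alg_hom:
  assumes "derivation Q M e D" "alg_hom P Q f" "calg P"
  shows "derivation P M (\<lambda>p. e (f p)) (\<lambda>p. D (f p))"
proof -
  interpret P: calg P by fact
  show ?thesis
    using assms(1) unfolding derivation_def
    by (auto simp: alg_homD[OF assms(2)])
qed

context calg
begin

abbreviation (input) "FK \<equiv> free_module A (carrier A)"

lemma kaehler_rels_carrier: "kaehler_rels A \<subseteq> carrier FK"
proof -
  interpret F: module A FK by (rule free_module_module[OF cring_axioms])
  show ?thesis
    unfolding kaehler_rels_def Let_def
    by (auto simp del: free_module_simps intro!: F.minus_closed F.smult_closed unit_vec_closed[OF cring_axioms] F.add.m_closed)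
qed

lemmas kaehler_module = presented_module_module[OF cring_axioms kaehler_rels_carrier, folded kaehler_def]
lemmas kaehler_d_closed = presented_gen_closed[OF cring_axioms kaehler_rels_carrier, folded kaehler_def kaehler_d_def]
lemmas kaehler_ext = presented_ext[OF cring_axioms kaehler_rels_carrier, folded kaehler_def kaehler_d_def]

lemma kaehler_derivation: "derivation A (kaehler A) (\<lambda>p. p) (kaehler_d A)"
proof -
  interpret F: module A FK by (rule free_module_module[OF cring_axioms])
  have u: "unit_vec A p \<in> carrier FK" if "p \<in> carrier A" for p using unit_vec_closed[OF cring_axioms that] .
  note rel = presented_rel[OF cring_axioms kaehler_rels_carrier]
  note add = presented_add[OF cring_axioms kaehler_rels_carrier, folded kaehler_def, symmetric]
  note smult = presented_smult[OF cring_axioms kaehler_rels_carrier, folded kaehler_def, symmetric]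
  have "kaehler_d A (p \<oplus> q) = kaehler_d A p \<oplus>\<^bsub>kaehler A\<^esub> kaehler_d A q"
    if "p \<in> carrier A" "q \<in> carrier A" for p q
  proof -
    have "unit_vec A (p \<oplus> q) \<ominus>\<^bsub>FK\<^esub> (unit_vec A p \<oplus>\<^bsub>FK\<^esub> unit_vec A q) \<in> kaehler_rels A"
      unfolding kaehler_rels_def Let_def using that by blast
    from rel[OF this] show ?thesis
      unfolding kaehler_d_def presented_gen_def
      using that u by (simp add: add F.add.m_closed del: free_module_simps)
  qed
  moreover have "kaehler_d A (c \<odot> p) = (c \<odot> \<one>) \<odot>\<^bsub>kaehler A\<^esub> kaehler_d A p"
    if "p \<in> carrier A" for p c
  proof -
    have "unit_vec A (c \<odot> p) \<ominus>\<^bsub>FK\<^esub> ((c \<odot> \<one>) \<odot>\<^bsub>FK\<^esub> unit_vec A p) \<in> kaehler_rels A"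
      unfolding kaehler_rels_def Let_def using that by blast
    from rel[OF this] show ?thesis
      unfolding kaehler_d_def presented_gen_def
      using that u by (simp add: smult F.smult_closed del: free_module_simps)
  qed
  moreover have "kaehler_d A (p \<otimes> q) = p \<odot>\<^bsub>kaehler A\<^esub> kaehler_d A q \<oplus>\<^bsub>kaehler A\<^esub> q \<odot>\<^bsub>kaehler A\<^esub> kaehler_d A p"
    if "p \<in> carrier A" "q \<in> carrier A" for p q
  proof -
    have "unit_vec A (p \<otimes> q) \<ominus>\<^bsub>FK\<^esub> (p \<odot>\<^bsub>FK\<^esub> unit_vec A q \<oplus>\<^bsub>FK\<^esub> q \<odot>\<^bsub>FK\<^esub> unit_vec A p) \<in> kaehler_rels A"
      unfolding kaehler_rels_def Let_def using that by blast
    from rel[OF this] show ?thesis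
      unfolding kaehler_d_def presented_gen_def
      using that u by (simp add: add smult F.smult_closed F.add.m_closed del: free_module_simps)
  qed
  ultimately show ?thesis
    unfolding derivation_def using kaehler_d_closed by auto
qed

text \<open>Universal property of \<open>\<Omega>\<close>: the three families of relations go to
  zero by the three rules for \<open>D\<close>. Working along \<phi> covers both uses, maps into a
  module over the target of an augmentation and the map induced by an algebra homomorphism.\<close>

lemma kaehler_lift:
  assumes "module T M" and \<phi>: "\<phi> \<in> ring_hom A T" and D: "derivation A M \<phi> D"
  shows "semilinear A \<phi> (kaehler A) M (presented_lift A M \<phi> D)"
    and "p \<in> carrier A \<Longrightarrow> presented_lift A M \<phi> D (kaehler_d A p) = D p"
proof -
  interpret F: module A FK by (rule free_module_module[OF cring_axioms])
  interpret M: module T M by fact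
  have u: "unit_vec A p \<in> carrier FK" if "p \<in> carrier A" for p using unit_vec_closed[OF cring_axioms that] .
  have closed: "D s \<in> carrier M" if "s \<in> carrier A" for s using D that by (auto simp: derivation_def)
  interpret L: free_module_lift A T M "carrier A" \<phi> D
    by (intro free_module_lift.intro free_module_lift_axioms.intro) (use closed assms cring_axioms in auto)
  have lin: "semilinear A \<phi> FK M L.L"
    by (rule semilinearI) (use L.closed L.add L.smult in \<open>auto\<close>)
  note mns = semilinear_minus[OF lin F.abelian_group_axioms M.abelian_group_axioms]
  have rel: "L.L x = \<zero>\<^bsub>M\<^esub>" if "x \<in> kaehler_rels A" for x
    using that unfolding kaehler_rels_def Let_def
  proof (elim UnE CollectE exE conjE)
    fix p q assume "p \<in> carrier A" "q \<in> carrier A"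
      "x = unit_vec A (p \<oplus> q) \<ominus>\<^bsub>FK\<^esub> (unit_vec A p \<oplus>\<^bsub>FK\<^esub> unit_vec A q)"
    then show ?thesis
      using u closed by (simp add: mns L.add L.unit_vec F.add.m_closed derivationD(2)[OF D] M.minus_eq M.r_neg del: free_module_simps)
  next
    fix c p assume "p \<in> carrier A"
      "x = unit_vec A (c \<odot> p) \<ominus>\<^bsub>FK\<^esub> (c \<odot> \<one>) \<odot>\<^bsub>FK\<^esub> unit_vec A p"
    then show ?thesis
      using u closed by (simp add: mns L.smult L.unit_vec L.\<phi>_closed F.smult_closed derivationD(3)[OF D] M.minus_eq M.r_neg del: free_module_simps)
  next
    fix p q assume "p \<in> carrier A" "q \<in> carrier A"
      "x = unit_vec A (p \<otimes> q) \<ominus>\<^bsub>FK\<^esub> (p \<odot>\<^bsub>FK\<^esub> unit_vec A q \<oplus>\<^bsub>FK\<^esub> q \<odot>\<^bsub>FK\<^esub> unit_vec A p)"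
    then show ?thesis
      using u closed by (simp add: mns L.add L.smult L.unit_vec L.\<phi>_closed F.add.m_closed F.smult_closed derivationD(4)[OF D] M.minus_eq M.r_neg del: free_module_simps)
  qed
  note * = presented_lift[OF cring_axioms kaehler_rels_carrier assms(1) \<phi> closed rel]
  show "semilinear A \<phi> (kaehler A) M (presented_lift A M \<phi> D)"
    using *(1) unfolding kaehler_def .
  show "p \<in> carrier A \<Longrightarrow> presented_lift A M \<phi> D (kaehler_d A p) = D p"
    using *(2) unfolding kaehler_d_def .
qed

end

section \<open>Extension of scalars and its universal property\<close>

context
  fixes P :: "('p, 'x) ring_scheme" and A :: "('a, 'y) ring_scheme" and e and M :: "('p, 'm, 'z) module_scheme"
  assumes P: "cring P" and A: "cring A" and e: "e \<in> ring_hom P A" and M: "module P M"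
begin

interpretation M: module P M by fact
interpretation A: cring A by fact
interpretation F: module A "free_module A (carrier M)" by (rule free_module_module[OF A])

lemma base_change_rels_carrier: "base_change_rels P A e M \<subseteq> carrier (free_module A (carrier M))"
  unfolding base_change_rels_def Let_def
  using ring_hom_closed[OF e]
  by (auto simp del: free_module_simps intro!: F.minus_closed F.smult_closed unit_vec_closed[OF A] F.add.m_closed)

lemmas base_change_module = presented_module_module[OF A base_change_rels_carrier, folded base_change_def]
lemmas base_change_gen_closed = presented_gen_closed[OF A base_change_rels_carrier, folded base_change_def base_change_gen_def]
lemmas base_change_ext = presented_ext[OF A base_change_rels_carrier, folded base_change_def base_change_gen_def]

lemma base_change_gen_semilinear: "semilinear P e M (base_change P A e M) (base_change_gen P A e M)"
proof (rule semilinearI)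
  have u: "unit_vec A p \<in> carrier (free_module A (carrier M))" if "p \<in> carrier M" for p using unit_vec_closed[OF A that] .
  note rel = presented_rel[OF A base_change_rels_carrier]
  note add = presented_add[OF A base_change_rels_carrier, folded base_change_def, symmetric]
  note smult = presented_smult[OF A base_change_rels_carrier, folded base_change_def, symmetric]
  let ?F = "free_module A (carrier M)"
  show "base_change_gen P A e M x \<in> carrier (base_change P A e M)" if "x \<in> carrier M" for x
    using base_change_gen_closed[OF that] .
  show "base_change_gen P A e M (m \<oplus>\<^bsub>M\<^esub> m') = base_change_gen P A e M m \<oplus>\<^bsub>base_change P A e M\<^esub> base_change_gen P A e M m'"
    if "m \<in> carrier M" "m' \<in> carrier M" for m m'
  proof -
    have "unit_vec A (m \<oplus>\<^bsub>M\<^esub> m') \<ominus>\<^bsub>?F\<^esub> (unit_vec A m \<oplus>\<^bsub>?F\<^esub> unit_vec A m') \<in> base_change_rels P A e M"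
      unfolding base_change_rels_def Let_def using that by blast
    from rel[OF this] show ?thesis
      unfolding base_change_gen_def presented_gen_def
      using that u by (simp add: add F.add.m_closed del: free_module_simps)
  qed
  show "base_change_gen P A e M (p \<odot>\<^bsub>M\<^esub> m) = e p \<odot>\<^bsub>base_change P A e M\<^esub> base_change_gen P A e M m"
    if "p \<in> carrier P" "m \<in> carrier M" for p m
  proof -
    have "unit_vec A (p \<odot>\<^bsub>M\<^esub> m) \<ominus>\<^bsub>?F\<^esub> (e p \<odot>\<^bsub>?F\<^esub> unit_vec A m) \<in> base_change_rels P A e M"
      unfolding base_change_rels_def Let_def using that by blast
    from rel[OF this] show ?thesis
      unfolding base_change_gen_def presented_gen_def
      using that u ring_hom_closed[OF e] by (simp add: smult F.smult_closed del: free_module_simps)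
  qed
qed

lemma base_change_lift:
  assumes "module A N" and f: "semilinear P e M N f"
  shows "semilinear A (\<lambda>a. a) (base_change P A e M) N (presented_lift A N (\<lambda>a. a) f)"
    and "m \<in> carrier M \<Longrightarrow> presented_lift A N (\<lambda>a. a) f (base_change_gen P A e M m) = f m"
proof -
  interpret N: module A N by fact
  have u: "unit_vec A p \<in> carrier (free_module A (carrier M))" if "p \<in> carrier M" for p using unit_vec_closed[OF A that] .
  let ?F = "free_module A (carrier M)"
  have id: "(\<lambda>a. a) \<in> ring_hom A A" by (auto simp: ring_hom_def)
  have closed: "f s \<in> carrier N" if "s \<in> carrier M" for s using semilinearD(1)[OF f that] .
  interpret L: free_module_lift A A N "carrier M" "\<lambda>a. a" f
    by (intro free_module_lift.intro free_module_lift_axioms.intro) (use closed assms id A in auto)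
  have lin: "semilinear A (\<lambda>a. a) ?F N L.L"
    by (rule semilinearI) (use L.closed L.add L.smult in \<open>auto\<close>)
  note mns = semilinear_minus[OF lin F.abelian_group_axioms N.abelian_group_axioms]
  have rel: "L.L x = \<zero>\<^bsub>N\<^esub>" if "x \<in> base_change_rels P A e M" for x
    using that unfolding base_change_rels_def Let_def
  proof (elim UnE CollectE exE conjE)
    fix p q assume "p \<in> carrier M" "q \<in> carrier M"
      "x = unit_vec A (p \<oplus>\<^bsub>M\<^esub> q) \<ominus>\<^bsub>?F\<^esub> (unit_vec A p \<oplus>\<^bsub>?F\<^esub> unit_vec A q)"
    then show ?thesis
      using u closed by (simp add: mns L.add L.unit_vec F.add.m_closed semilinearD(2)[OF f] N.minus_eq N.r_neg del: free_module_simps)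
  next
    fix c p assume "c \<in> carrier P" "p \<in> carrier M"
      "x = unit_vec A (c \<odot>\<^bsub>M\<^esub> p) \<ominus>\<^bsub>?F\<^esub> e c \<odot>\<^bsub>?F\<^esub> unit_vec A p"
    then show ?thesis
      using u closed ring_hom_closed[OF e] by (simp add: mns L.smult L.unit_vec F.smult_closed semilinearD(3)[OF f] N.minus_eq N.r_neg del: free_module_simps)
  qed
  note * = presented_lift[OF A base_change_rels_carrier assms(1) id closed rel]
  show "semilinear A (\<lambda>a. a) (base_change P A e M) N (presented_lift A N (\<lambda>a. a) f)"
    using *(1) unfolding base_change_def .
  show "m \<in> carrier M \<Longrightarrow> presented_lift A N (\<lambda>a. a) f (base_change_gen P A e M m) = f m"
    using *(2) unfolding base_change_gen_def .
qed

end

section \<open>Polynomial algebras and their derivations\<close>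

text \<open>The element \<open>dp \<otimes> 1\<close>.\<close>

definition diff_gen where
  "diff_gen A P e p = base_change_gen P A e (kaehler P) (kaehler_d P p)"

locale augmented = P: calg P + A: calg A
  for P :: "(complex, 'p, 'x) module_scheme" and A :: "(complex, 'a, 'y) module_scheme" +
  fixes e assumes e: "alg_hom P A e"
begin

lemmas e_ring = alg_homD(1)[OF e]

lemmas differentials_module =
  base_change_module[OF P.cring_axioms A.cring_axioms e_ring P.kaehler_module, folded differentials_over_def]

lemma diff_gen_derivation: "derivation P (differentials_over A P e) e (diff_gen A P e)"
  unfolding differentials_over_def diff_gen_def
  using derivation_comp_semilinear[OF P.kaehler_derivation
      base_change_gen_semilinear[OF P.cring_axioms A.cring_axioms e_ring P.kaehler_module] _ P.calg_axioms P.kaehler_module]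
  by simp

text \<open>Existence half of the bijection between \<open>A\<close>-linear maps out of
  \<open>\<Omega>\<^sub>P \<otimes> A\<close> and derivations of \<open>P\<close> along
  \<open>e\<close>; \<open>differentials_ext\<close> is the uniqueness half. It allows cochains to
  be handled as derivations.\<close>

lemma differentials_lift:
  assumes N: "module A N" and D: "derivation P N e D"
  shows "\<exists>\<Phi>. semilinear A (\<lambda>a. a) (differentials_over A P e) N \<Phi> \<and> (\<forall>p\<in>carrier P. \<Phi> (diff_gen A P e p) = D p)"
proof -
  note l = P.kaehler_lift[OF N e_ring D]
  note b = base_change_lift[OF P.cring_axioms A.cring_axioms e_ring P.kaehler_module N l(1)]
  show ?thesis
    using b l(2) P.kaehler_d_closed unfolding differentials_over_def diff_gen_def by auto
qed

lemma differentials_ext: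
  assumes f: "semilinear A (\<lambda>a. a) (differentials_over A P e) N f"
    and g: "semilinear A (\<lambda>a. a) (differentials_over A P e) N g" and N: "abelian_group N"
    and eq: "\<And>p. p \<in> carrier P \<Longrightarrow> f (diff_gen A P e p) = g (diff_gen A P e p)"
    and X: "X \<in> carrier (differentials_over A P e)"
  shows "f X = g X"
proof -
  note b = base_change_gen_semilinear[OF P.cring_axioms A.cring_axioms e_ring P.kaehler_module, folded differentials_over_def]
  have e': "e \<in> carrier P \<rightarrow> carrier A" using e_ring by (auto simp: ring_hom_def)
  have "f (base_change_gen P A e (kaehler P) \<omega>) = g (base_change_gen P A e (kaehler P) \<omega>)"
    if "\<omega> \<in> carrier (kaehler P)" for \<omega>
    by (rule P.kaehler_ext[OF semilinear_comp[OF b f e'] semilinear_comp[OF b g e'] N _ that])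
       (use eq in \<open>simp add: diff_gen_def\<close>)
  then show ?thesis
    using base_change_ext[OF P.cring_axioms A.cring_axioms e_ring P.kaehler_module] f g N X
    unfolding differentials_over_def by blast
qed

end

lemma kaehler_map:
  assumes P: "calg P" and Q: "calg Q" and f: "alg_hom P Q f"
  shows "semilinear P f (kaehler P) (kaehler Q) (kaehler_map P Q f)"
    and "p \<in> carrier P \<Longrightarrow> kaehler_map P Q f (kaehler_d P p) = kaehler_d Q (f p)"
proof -
  interpret P: calg P by fact
  interpret Q: calg Q by fact
  have D: "derivation P (kaehler Q) f (\<lambda>p. kaehler_d Q (f p))"
    by (rule derivation_comp_alg_hom[OF Q.kaehler_derivation f P])
  note * = P.kaehler_lift[OF Q.kaehler_module alg_homD(1)[OF f] D]
  show "semilinear P f (kaehler P) (kaehler Q) (kaehler_map P Q f)"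
    using *(1) unfolding kaehler_map_def .
  show "p \<in> carrier P \<Longrightarrow> kaehler_map P Q f (kaehler_d P p) = kaehler_d Q (f p)"
    using *(2) unfolding kaehler_map_def .
qed

lemma differentials_over_map:
  assumes "augmented P A e'" "augmented Q A e" and f: "alg_hom P Q f"
    and comm: "\<And>p. p \<in> carrier P \<Longrightarrow> e' p = e (f p)"
  shows "semilinear A (\<lambda>a. a) (differentials_over A P e') (differentials_over A Q e) (differentials_over_map A P Q e f)"
    and "p \<in> carrier P \<Longrightarrow> differentials_over_map A P Q e f (diff_gen A P e' p) = diff_gen A Q e (f p)"
proof -
  interpret P: augmented P A e' by fact
  interpret Q: augmented Q A e by fact
  note k = kaehler_map[OF P.P.calg_axioms Q.P.calg_axioms f]
  have fc: "f \<in> carrier P \<rightarrow> carrier Q" using alg_homD(3)[OF f] by auto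
  note b = base_change_gen_semilinear[OF Q.P.cring_axioms P.A.cring_axioms Q.e_ring Q.P.kaehler_module, folded differentials_over_def]
  have "semilinear P e' (kaehler P) (differentials_over A Q e) (\<lambda>\<omega>. base_change_gen Q A e (kaehler Q) (kaehler_map P Q f \<omega>))"
    using semilinear_comp[OF k(1) b fc] comm unfolding semilinear_def by auto
  note l = base_change_lift[OF P.P.cring_axioms P.A.cring_axioms P.e_ring P.P.kaehler_module Q.differentials_module this]
  show "semilinear A (\<lambda>a. a) (differentials_over A P e') (differentials_over A Q e) (differentials_over_map A P Q e f)"
    using l(1) unfolding differentials_over_map_def differentials_over_def .
  show "p \<in> carrier P \<Longrightarrow> differentials_over_map A P Q e f (diff_gen A P e' p) = diff_gen A Q e (f p)"
    using l(2)[OF P.P.kaehler_d_closed] k(2) unfolding differentials_over_map_def diff_gen_def by simp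
qed


section \<open>Polynomial algebras: induction, evaluation, derivations\<close>

lemma poly_algebra_simps [simp]:
  "mult (poly_algebra V) = (*)" "one (poly_algebra V) = 1" "zero (poly_algebra V) = 0"
  "add (poly_algebra V) = (+)" "smult (poly_algebra V) = (\<lambda>c p. Poly_Mapping.single 0 c * p)"
  by (simp_all add: poly_algebra_def)

lemma poly_algebra_carrier:
  "p \<in> carrier (poly_algebra V) \<longleftrightarrow> (\<forall>m\<in>Poly_Mapping.keys p. Poly_Mapping.keys m \<subseteq> V)"
  by (simp add: poly_algebra_def)

lemma keys_add_nat: "Poly_Mapping.keys (a + b :: 'v \<Rightarrow>\<^sub>0 nat) = Poly_Mapping.keys a \<union> Poly_Mapping.keys b"
  by (auto simp: in_keys_iff lookup_add)

lemma poly_algebra_add: "p \<in> carrier (poly_algebra V) \<Longrightarrow> q \<in> carrier (poly_algebra V) \<Longrightarrow> p + q \<in> carrier (poly_algebra V)"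
  unfolding poly_algebra_carrier by (meson Poly_Mapping.keys_add UnE subsetD)

lemma poly_algebra_mult: "p \<in> carrier (poly_algebra V) \<Longrightarrow> q \<in> carrier (poly_algebra V) \<Longrightarrow> p * q \<in> carrier (poly_algebra V)"
  unfolding poly_algebra_carrier
proof
  fix m assume *: "\<forall>m\<in>Poly_Mapping.keys p. Poly_Mapping.keys m \<subseteq> V" "\<forall>m\<in>Poly_Mapping.keys q. Poly_Mapping.keys m \<subseteq> V"
    "m \<in> Poly_Mapping.keys (p * q)"
  then obtain a b where "a \<in> Poly_Mapping.keys p" "b \<in> Poly_Mapping.keys q" "m = a + b"
    using keys_mult[of p q] by blast
  then show "Poly_Mapping.keys m \<subseteq> V" using * by (simp add: keys_add_nat)
qed

lemma poly_algebra_single: "Poly_Mapping.keys m \<subseteq> V \<Longrightarrow> Poly_Mapping.single m c \<in> carrier (poly_algebra V)"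
  by (simp add: poly_algebra_carrier)

lemma poly_algebra_uminus: "p \<in> carrier (poly_algebra V) \<Longrightarrow> - p \<in> carrier (poly_algebra V)"
  by (simp add: poly_algebra_carrier)

lemma poly_var_closed: "v \<in> V \<Longrightarrow> poly_var v \<in> carrier (poly_algebra V)"
  unfolding poly_var_def by (rule poly_algebra_single) simp

lemma poly_algebra_calg: "calg (poly_algebra V)"
proof -
  have "cring (poly_algebra V)"
  proof (rule cringI)
    show "abelian_group (poly_algebra V)"
    proof (rule abelian_groupI)
      fix x assume "x \<in> carrier (poly_algebra V)"
      then show "\<exists>y\<in>carrier (poly_algebra V). y \<oplus>\<^bsub>poly_algebra V\<^esub> x = \<zero>\<^bsub>poly_algebra V\<^esub>"
        by (intro bexI[of _ "- x"]) (auto simp: poly_algebra_uminus)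
    qed (auto simp: poly_algebra_add ac_simps, simp add: poly_algebra_carrier)
    show "comm_monoid (poly_algebra V)"
      by (rule comm_monoidI) (auto simp: poly_algebra_mult ac_simps, simp add: poly_algebra_carrier)
  qed (simp add: algebra_simps)
  moreover have smult: "Poly_Mapping.single 0 (c * d) * (p :: 'a cpoly) = Poly_Mapping.single 0 c * (Poly_Mapping.single 0 d * p)" for c d p
    by (simp add: mult_single mult.assoc[symmetric])
  ultimately show ?thesis
    unfolding calg_def calg_axioms_def
    by (auto simp: distrib_left distrib_right single_add smult mult.assoc intro!: poly_algebra_mult poly_algebra_single)
qed

lemma poly_induct_single [consumes 1, case_names zero step]:
  assumes "p \<in> carrier (poly_algebra V)" and "P 0"
    and "\<And>m c q. Poly_Mapping.keys m \<subseteq> V \<Longrightarrow> q \<in> carrier (poly_algebra V) \<Longrightarrow> P q \<Longrightarrow> P (Poly_Mapping.single m c + q)"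
  shows "P p"
  using assms(1)
proof (induction p rule: Poly_Mapping.update_induct)
  case const
  then show ?case using assms(2) by simp
next
  case (update p m c)
  have eq: "Poly_Mapping.update m c p = Poly_Mapping.single m c + p"
    using update(1) by (intro poly_mapping_eqI) (auto simp: lookup_update lookup_add lookup_single when_def in_keys_iff)
  have "Poly_Mapping.keys (Poly_Mapping.update m c p) = insert m (Poly_Mapping.keys p)"
    using update(1,2) by (simp add: keys_update)
  then show ?case using update assms(3) unfolding eq poly_algebra_carrier by auto
qed

text \<open>The cases are the rules by which algebra homomorphisms and derivations are computed, so
  two maps of either kind that agree on variables agree. The zero polynomial is reached as the
  multiple of 1 by the scalar 0.\<close>

lemma poly_induct [consumes 1, case_names one var add smult]:
  assumes "p \<in> carrier (poly_algebra V)" and "P 1"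
    and var: "\<And>v q. v \<in> V \<Longrightarrow> q \<in> carrier (poly_algebra V) \<Longrightarrow> P q \<Longrightarrow> P (poly_var v * q)"
    and add: "\<And>p q. p \<in> carrier (poly_algebra V) \<Longrightarrow> q \<in> carrier (poly_algebra V) \<Longrightarrow> P p \<Longrightarrow> P q \<Longrightarrow> P (p + q)"
    and smult: "\<And>c q. q \<in> carrier (poly_algebra V) \<Longrightarrow> P q \<Longrightarrow> P (Poly_Mapping.single 0 c * q)"
  shows "P p"
proof -
  have 1: "1 \<in> carrier (poly_algebra V)" by (simp add: poly_algebra_carrier)
  have mon: "P (Poly_Mapping.single m 1)" if "Poly_Mapping.keys m \<subseteq> V" for m
    using that
  proof (induction m rule: Poly_Mapping.update_induct)
    case const
    then show ?case using assms(2) by simp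
  next
    case (update m v k)
    have eq: "Poly_Mapping.update v k m = Poly_Mapping.single v k + m"
      using update(1) by (intro poly_mapping_eqI) (auto simp: lookup_update lookup_add lookup_single when_def in_keys_iff)
    have v: "v \<in> V" and m: "Poly_Mapping.keys m \<subseteq> V" using update unfolding eq keys_add_nat by auto
    \<comment> \<open>\<open>update\<close> sets the whole exponent of \<open>v\<close> at once, so
      the power is built up one factor at a time.\<close>
    have "P (Poly_Mapping.single (Poly_Mapping.single v j + m) 1)" for j
    proof (induction j)
      case 0
      then show ?case using update m by simp
    next
      case (Suc j)
      have "Poly_Mapping.single (Poly_Mapping.single v (Suc j) + m) (1::complex) =
        poly_var v * Poly_Mapping.single (Poly_Mapping.single v j + m) 1"
        unfolding poly_var_def mult_single by (simp add: add.assoc[symmetric] single_add[symmetric])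
      moreover have "Poly_Mapping.single (Poly_Mapping.single v j + m) 1 \<in> carrier (poly_algebra V)"
        using v m by (intro poly_algebra_single) (auto simp: keys_add_nat)
      ultimately show ?case using var[OF v _ Suc] by simp
    qed
    then show ?case unfolding eq by simp
  qed
  show ?thesis using assms(1)
  proof (induction rule: poly_induct_single)
    case zero
    then show ?case using smult[OF 1 assms(2), of 0] by simp
  next
    case (step m c q)
    have "Poly_Mapping.single m c = Poly_Mapping.single 0 c * Poly_Mapping.single m 1" by (simp add: mult_single)
    then have "P (Poly_Mapping.single m c)" using smult[OF poly_algebra_single mon] step(1) by metis
    then show ?case using add poly_algebra_single step by blast
  qed
qed

context calg
begin

context
  fixes V :: "'v set" and g assumes g: "\<And>v. v \<in> V \<Longrightarrow> g v \<in> carrier A"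
begin

abbreviation (input) "mon_eval (m :: 'v \<Rightarrow>\<^sub>0 nat) \<equiv> (\<Otimes>v\<in>Poly_Mapping.keys m. g v [^] Poly_Mapping.lookup m v)"

lemma mon_eval_superset:
  assumes "finite K" "Poly_Mapping.keys m \<subseteq> K" "K \<subseteq> V"
  shows "mon_eval m = (\<Otimes>v\<in>K. g v [^] Poly_Mapping.lookup m v)"
  by (rule finprod_mono_neutral_cong_left) (use assms g in \<open>auto simp: in_keys_iff\<close>)

lemma mon_eval_closed: "Poly_Mapping.keys m \<subseteq> V \<Longrightarrow> mon_eval m \<in> carrier A"
  by (rule finprod_closed) (use g in auto)

lemma mon_eval_add:
  assumes "Poly_Mapping.keys m \<subseteq> V" "Poly_Mapping.keys m' \<subseteq> V"
  shows "mon_eval (m + m') = mon_eval m \<otimes> mon_eval m'"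
proof -
  let ?K = "Poly_Mapping.keys m \<union> Poly_Mapping.keys m'"
  have K: "finite ?K" "?K \<subseteq> V" using assms by auto
  have "mon_eval (m + m') = (\<Otimes>v\<in>?K. g v [^] Poly_Mapping.lookup (m + m') v)"
    by (rule mon_eval_superset) (use K in \<open>auto simp: keys_add_nat\<close>)
  also have "\<dots> = (\<Otimes>v\<in>?K. g v [^] Poly_Mapping.lookup m v \<otimes> g v [^] Poly_Mapping.lookup m' v)"
    by (rule finprod_cong') (use K g in \<open>auto simp: lookup_add nat_pow_mult\<close>)
  also have "\<dots> = (\<Otimes>v\<in>?K. g v [^] Poly_Mapping.lookup m v) \<otimes> (\<Otimes>v\<in>?K. g v [^] Poly_Mapping.lookup m' v)"
    by (rule finprod_multf) (use K g in auto)
  also have "\<dots> = mon_eval m \<otimes> mon_eval m'"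
    using mon_eval_superset[OF K(1) _ K(2)] by simp
  finally show ?thesis .
qed

lemma poly_eval_superset:
  assumes "finite K" "Poly_Mapping.keys p \<subseteq> K" "\<And>m. m \<in> K \<Longrightarrow> Poly_Mapping.keys m \<subseteq> V"
  shows "poly_eval A g p = (\<Oplus>m\<in>K. Poly_Mapping.lookup p m \<odot> mon_eval m)"
proof -
  have z: "0 \<odot> x = \<zero>" if "x \<in> carrier A" for x
    using smult_l_distr[OF that, of 0 0] smult_closed[OF that, of 0] by (simp add: add.l_cancel_one')
  show ?thesis unfolding poly_eval_def
    by (rule add.finprod_mono_neutral_cong_left) (use assms mon_eval_closed z in \<open>auto simp: in_keys_iff\<close>)
qed

lemma poly_eval_closed: "p \<in> carrier (poly_algebra V) \<Longrightarrow> poly_eval A g p \<in> carrier A"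
  unfolding poly_eval_def poly_algebra_carrier
  by (rule add.finprod_closed) (use mon_eval_closed in auto)

lemma poly_eval_add:
  assumes "p \<in> carrier (poly_algebra V)" "q \<in> carrier (poly_algebra V)"
  shows "poly_eval A g (p + q) = poly_eval A g p \<oplus> poly_eval A g q"
proof -
  let ?K = "Poly_Mapping.keys p \<union> Poly_Mapping.keys q"
  have K: "finite ?K" "\<And>m. m \<in> ?K \<Longrightarrow> Poly_Mapping.keys m \<subseteq> V"
    using assms by (auto simp: poly_algebra_carrier)
  have "poly_eval A g (p + q) = (\<Oplus>m\<in>?K. Poly_Mapping.lookup (p + q) m \<odot> mon_eval m)"
    by (rule poly_eval_superset) (use K Poly_Mapping.keys_add[of p q] in auto)
  also have "\<dots> = (\<Oplus>m\<in>?K. Poly_Mapping.lookup p m \<odot> mon_eval m \<oplus> Poly_Mapping.lookup q m \<odot> mon_eval m)"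
    by (rule add.finprod_cong') (use K mon_eval_closed in \<open>auto simp: lookup_add smult_l_distr\<close>)
  also have "\<dots> = (\<Oplus>m\<in>?K. Poly_Mapping.lookup p m \<odot> mon_eval m) \<oplus> (\<Oplus>m\<in>?K. Poly_Mapping.lookup q m \<odot> mon_eval m)"
    by (rule add.finprod_multf) (use K mon_eval_closed in auto)
  also have "\<dots> = poly_eval A g p \<oplus> poly_eval A g q"
    using poly_eval_superset[OF K(1) _ K(2)] by simp
  finally show ?thesis .
qed

lemma poly_eval_single:
  assumes "Poly_Mapping.keys m \<subseteq> V"
  shows "poly_eval A g (Poly_Mapping.single m c) = c \<odot> mon_eval m"
proof -
  have "poly_eval A g (Poly_Mapping.single m c) = (\<Oplus>m\<in>{m}. Poly_Mapping.lookup (Poly_Mapping.single m c) m \<odot> mon_eval m)"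
    by (subst poly_eval_superset[of "{m}"]) (use assms mon_eval_closed[OF assms] in \<open>auto split: if_splits\<close>)
  also have "\<dots> = c \<odot> mon_eval m"
    using mon_eval_closed[OF assms] by simp
  finally show ?thesis .
qed

lemma poly_eval_zero: "poly_eval A g 0 = \<zero>"
  by (simp add: poly_eval_def)

text \<open>Multiplicativity with a single term on the left, by induction on the right factor;
  \<open>poly_eval_mult\<close> adds such terms up.\<close>

lemma poly_eval_single_mult:
  assumes m: "Poly_Mapping.keys m \<subseteq> V" and q: "q \<in> carrier (poly_algebra V)"
  shows "poly_eval A g (Poly_Mapping.single m c * q) = (c \<odot> mon_eval m) \<otimes> poly_eval A g q"
  using q
proof (induction rule: poly_induct_single)
  case zero
  then show ?case using mon_eval_closed[OF m] by (simp add: poly_eval_zero)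
next
  case (step m' c' q)
  have mm: "Poly_Mapping.keys (m + m') \<subseteq> V" using m step(1) by (simp add: keys_add_nat)
  note c = mon_eval_closed[OF m] mon_eval_closed[OF step(1)] poly_eval_closed[OF step(2)]
  have "poly_eval A g (Poly_Mapping.single m c * (Poly_Mapping.single m' c' + q))
    = poly_eval A g (Poly_Mapping.single (m + m') (c * c') + Poly_Mapping.single m c * q)"
    by (simp add: algebra_simps mult_single)
  also have "\<dots> = (c * c') \<odot> mon_eval (m + m') \<oplus> (c \<odot> mon_eval m) \<otimes> poly_eval A g q"
    using poly_eval_add[OF poly_algebra_single[OF mm] poly_algebra_mult[OF poly_algebra_single[OF m] step(2)]]
      step(3) poly_eval_single[OF mm] by simp
  also have "(c * c') \<odot> mon_eval (m + m') = (c \<odot> mon_eval m) \<otimes> (c' \<odot> mon_eval m')"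
    using c by (simp add: mon_eval_add[OF m step(1)] smult_assoc1[symmetric] smult_assoc2 smult_assoc2' mult.commute)
  finally show ?case
    using c step by (simp add: poly_eval_add poly_algebra_single poly_eval_single r_distr)
qed

lemma poly_eval_mult:
  assumes "p \<in> carrier (poly_algebra V)" "q \<in> carrier (poly_algebra V)"
  shows "poly_eval A g (p * q) = poly_eval A g p \<otimes> poly_eval A g q"
  using assms(1)
proof (induction rule: poly_induct_single)
  case zero
  then show ?case using poly_eval_closed[OF assms(2)] by (simp add: poly_eval_zero)
next
  case (step m c p)
  note c = mon_eval_closed[OF step(1)] poly_eval_closed[OF step(2)] poly_eval_closed[OF assms(2)]
  show ?case
    using step assms(2) c
    by (simp add: distrib_right poly_eval_add poly_eval_single_mult poly_algebra_single poly_algebra_mult poly_eval_single l_distr)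
qed

lemma poly_eval_one: "poly_eval A g 1 = \<one>"
  using poly_eval_single[of 0 1] by (simp add: smult_one)

lemma poly_eval_alg_hom: "alg_hom (poly_algebra V) A (poly_eval A g)"
proof -
  have "poly_eval A g (Poly_Mapping.single 0 c * p) = c \<odot> poly_eval A g p" if "p \<in> carrier (poly_algebra V)" for p c
    using poly_eval_single_mult[OF _ that, of 0 c] poly_eval_closed[OF that] by (simp add: smult_assoc2)
  then show ?thesis
    unfolding alg_hom_def ring_hom_def
    by (auto simp: poly_eval_closed poly_eval_mult poly_eval_add poly_eval_one)
qed

lemma poly_eval_var: "v \<in> V \<Longrightarrow> poly_eval A g (poly_var v) = g v"
  unfolding poly_var_def using g by (subst poly_eval_single) (auto simp: smult_one)

end

end

lemma alg_hom_poly_ext: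
  assumes "alg_hom (poly_algebra V) A f" "alg_hom (poly_algebra V) A g"
    and "\<And>v. v \<in> V \<Longrightarrow> f (poly_var v) = g (poly_var v)" and "p \<in> carrier (poly_algebra V)"
  shows "f p = g p"
  using assms(4)
proof (induction rule: poly_induct)
  case one
  then show ?case using alg_homD(6)[OF assms(1)] alg_homD(6)[OF assms(2)] by simp
next
  case (var v q)
  then show ?case using alg_homD(5)[OF assms(1) poly_var_closed] alg_homD(5)[OF assms(2) poly_var_closed] assms(3) by simp
next
  case (add p q)
  then show ?case using alg_homD(4)[OF assms(1)] alg_homD(4)[OF assms(2)] by simp
next
  case (smult c q)
  then show ?case using alg_homD(2)[OF assms(1)] alg_homD(2)[OF assms(2)] by simp
qed

lemma derivation_poly_ext:
  assumes "derivation (poly_algebra V) M e f" "derivation (poly_algebra V) M e g"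
    and "\<And>v. v \<in> V \<Longrightarrow> f (poly_var v) = g (poly_var v)" and "p \<in> carrier (poly_algebra V)"
    and M: "module A M" and e: "alg_hom (poly_algebra V) A e"
  shows "f p = g p"
  using assms(4)
proof (induction rule: poly_induct)
  case one
  interpret M: module A M by fact
  have 1: "1 \<in> carrier (poly_algebra V)" by (simp add: poly_algebra_carrier)
  \<comment> \<open>A derivation kills 1, since \<open>D 1 = D (1 * 1) = D 1 + D 1\<close>.\<close>
  have "D 1 = \<zero>\<^bsub>M\<^esub>" if D: "derivation (poly_algebra V) M e D" for D
  proof -
    have c: "D 1 \<in> carrier M" using derivationD(1)[OF D 1 1] .
    have "D 1 = D 1 \<oplus>\<^bsub>M\<^esub> D 1"
      using derivationD(4)[OF D 1 1] alg_homD(6)[OF e] c by simp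
    then show ?thesis using c by (metis M.add.l_cancel_one)
  qed
  from this[OF assms(1)] this[OF assms(2)] show ?case by simp
next
  case (var v q)
  then show ?case using derivationD(4)[OF assms(1) poly_var_closed] derivationD(4)[OF assms(2) poly_var_closed] assms(3) by simp
next
  case (add p q)
  then show ?case using derivationD(2)[OF assms(1)] derivationD(2)[OF assms(2)] by simp
next
  case (smult c q)
  then show ?case using derivationD(3)[OF assms(1) smult(1) smult(1)] derivationD(3)[OF assms(2) smult(1) smult(1)] by simp
qed

text \<open>The dual numbers over \<open>A\<close>: algebra homomorphisms into them are pairs of a homomorphism to \<open>A\<close> and a
  derivation along it, so derivations on a polynomial algebra with prescribed values on the variables
  exist without mentioning partial derivatives.\<close>

definition dual :: "(complex, 'a, 'z) module_scheme \<Rightarrow> (complex, 'a \<times> 'a) module" where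
  "dual A = \<lparr>carrier = carrier A \<times> carrier A,
     mult = (\<lambda>(a, b) (c, d). (a \<otimes>\<^bsub>A\<^esub> c, a \<otimes>\<^bsub>A\<^esub> d \<oplus>\<^bsub>A\<^esub> c \<otimes>\<^bsub>A\<^esub> b)), one = (\<one>\<^bsub>A\<^esub>, \<zero>\<^bsub>A\<^esub>), zero = (\<zero>\<^bsub>A\<^esub>, \<zero>\<^bsub>A\<^esub>),
     add = (\<lambda>(a, b) (c, d). (a \<oplus>\<^bsub>A\<^esub> c, b \<oplus>\<^bsub>A\<^esub> d)), smult = (\<lambda>k (a, b). (k \<odot>\<^bsub>A\<^esub> a, k \<odot>\<^bsub>A\<^esub> b))\<rparr>"

lemma dual_simps:
  "carrier (dual A) = carrier A \<times> carrier A" "\<one>\<^bsub>dual A\<^esub> = (\<one>\<^bsub>A\<^esub>, \<zero>\<^bsub>A\<^esub>)" "\<zero>\<^bsub>dual A\<^esub> = (\<zero>\<^bsub>A\<^esub>, \<zero>\<^bsub>A\<^esub>)"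
  "x \<otimes>\<^bsub>dual A\<^esub> y = (fst x \<otimes>\<^bsub>A\<^esub> fst y, fst x \<otimes>\<^bsub>A\<^esub> snd y \<oplus>\<^bsub>A\<^esub> fst y \<otimes>\<^bsub>A\<^esub> snd x)"
  "x \<oplus>\<^bsub>dual A\<^esub> y = (fst x \<oplus>\<^bsub>A\<^esub> fst y, snd x \<oplus>\<^bsub>A\<^esub> snd y)"
  "c \<odot>\<^bsub>dual A\<^esub> x = (c \<odot>\<^bsub>A\<^esub> fst x, c \<odot>\<^bsub>A\<^esub> snd x)"
  by (simp_all add: dual_def case_prod_beta)

lemma dual_calg:
  assumes "calg A"
  shows "calg (dual A)"
proof -
  interpret calg A by fact
  have "abelian_group (dual A)"
  proof (rule abelian_groupI)
    fix x assume "x \<in> carrier (dual A)"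
    then show "\<exists>y\<in>carrier (dual A). y \<oplus>\<^bsub>dual A\<^esub> x = \<zero>\<^bsub>dual A\<^esub>"
      by (intro bexI[of _ "(\<ominus>\<^bsub>A\<^esub> fst x, \<ominus>\<^bsub>A\<^esub> snd x)"]) (auto simp: dual_simps l_neg)
  qed (auto simp: dual_simps a_ac)
  moreover have "comm_monoid (dual A)"
    by (rule comm_monoidI) (auto simp: dual_simps l_distr r_distr m_ac a_ac)
  ultimately have "cring (dual A)"
    by (rule cringI) (auto simp: dual_simps l_distr r_distr m_ac a_ac)
  then show ?thesis
    unfolding calg_def calg_axioms_def
    by (auto simp: dual_simps smult_l_distr smult_r_distr smult_assoc1 smult_one smult_assoc2 smult_assoc2')
qed

definition der_ext where
  "der_ext A e f p = snd (poly_eval (dual A) (\<lambda>s. (e (poly_var s), f s)) p)"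

text \<open>The first component of the evaluation is an algebra homomorphism that agrees with
  \<open>e\<close> on variables, hence is \<open>e\<close>. The product rule of the dual numbers in
  the second component is then the Leibniz rule along \<open>e\<close>.\<close>

lemma der_ext:
  assumes A: "calg A" and e: "alg_hom (poly_algebra V) A e" and f: "\<And>v. v \<in> V \<Longrightarrow> f v \<in> carrier A"
  shows "derivation (poly_algebra V) (regular_module A) e (der_ext A e f)"
    and "v \<in> V \<Longrightarrow> der_ext A e f (poly_var v) = f v"
proof -
  interpret A: calg A by fact
  interpret D: calg "dual A" by (rule dual_calg[OF A])
  let ?h = "poly_eval (dual A) (\<lambda>s. (e (poly_var s), f s))"
  have cl: "\<And>v. v \<in> V \<Longrightarrow> (e (poly_var v), f v) \<in> carrier (dual A)"
    using f alg_homD(3)[OF e poly_var_closed] by (auto simp: dual_simps)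
  note h = D.poly_eval_alg_hom[of V "\<lambda>s. (e (poly_var s), f s)", OF cl]
  note hv = D.poly_eval_var[of V "\<lambda>s. (e (poly_var s), f s)", OF cl]
  have fst_hom: "alg_hom (poly_algebra V) A (\<lambda>p. fst (?h p))"
    using h unfolding alg_hom_def ring_hom_def by (auto simp: dual_simps Pi_def mem_Times_iff)
  have fst: "fst (?h p) = e p" if "p \<in> carrier (poly_algebra V)" for p
    by (rule alg_hom_poly_ext[OF fst_hom e _ that]) (simp add: hv)
  have 1: "1 \<in> carrier (poly_algebra V)" by (simp add: poly_algebra_carrier)
  have cl': "snd (?h p) \<in> carrier A" if "p \<in> carrier (poly_algebra V)" for p
    using alg_homD(3)[OF h that] by (auto simp: dual_simps mem_Times_iff)
  show "derivation (poly_algebra V) (regular_module A) e (der_ext A e f)"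
    unfolding derivation_def der_ext_def regular_module_simps
  proof (intro conjI ballI allI)
    fix p q c assume p: "p \<in> carrier (poly_algebra V)" and q: "q \<in> carrier (poly_algebra V)"
    show "snd (?h p) \<in> carrier A" using cl' p .
    show "snd (?h (p \<oplus>\<^bsub>poly_algebra V\<^esub> q)) = snd (?h p) \<oplus>\<^bsub>A\<^esub> snd (?h q)"
      using alg_homD(4)[OF h p q] by (simp add: dual_simps)
    show "snd (?h (p \<otimes>\<^bsub>poly_algebra V\<^esub> q)) = e p \<otimes>\<^bsub>A\<^esub> snd (?h q) \<oplus>\<^bsub>A\<^esub> e q \<otimes>\<^bsub>A\<^esub> snd (?h p)"
      using alg_homD(5)[OF h p q] fst[OF p] fst[OF q] by (simp add: dual_simps)
    have "e (c \<odot>\<^bsub>poly_algebra V\<^esub> \<one>\<^bsub>poly_algebra V\<^esub>) = c \<odot>\<^bsub>A\<^esub> \<one>\<^bsub>A\<^esub>"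
      using alg_homD(2)[OF e, of "\<one>\<^bsub>poly_algebra V\<^esub>"] alg_homD(6)[OF e] 1 by simp
    then show "snd (?h (c \<odot>\<^bsub>poly_algebra V\<^esub> p)) = e (c \<odot>\<^bsub>poly_algebra V\<^esub> \<one>\<^bsub>poly_algebra V\<^esub>) \<otimes>\<^bsub>A\<^esub> snd (?h p)"
      using alg_homD(2)[OF h p, of c] A.smult_eq[OF cl'[OF p], of c] by (simp add: dual_simps)
  qed
  show "v \<in> V \<Longrightarrow> der_ext A e f (poly_var v) = f v"
    by (simp add: der_ext_def hv)
qed

section \<open>Cochains of the standard resolution\<close>

lemma hom_module_carrier:
  "f \<in> carrier (hom_module R M N) \<longleftrightarrow> f \<in> extensional (carrier M) \<and> semilinear R (\<lambda>r. r) M N f"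
  by (auto simp: hom_module_def semilinear_def PiE_def)

lemma hom_module_simps:
  "add (hom_module R M N) = (\<lambda>f g. \<lambda>x\<in>carrier M. f x \<oplus>\<^bsub>N\<^esub> g x)"
  "zero (hom_module R M N) = (\<lambda>x\<in>carrier M. \<zero>\<^bsub>N\<^esub>)"
  by (simp_all add: hom_module_def)

lemma semilinear_restrict:
  assumes "abelian_monoid M" "\<And>r x. r \<in> carrier R \<Longrightarrow> x \<in> carrier M \<Longrightarrow> r \<odot>\<^bsub>M\<^esub> x \<in> carrier M"
  shows "semilinear R \<phi> M N (restrict f (carrier M)) \<longleftrightarrow> semilinear R \<phi> M N f"
  using assms abelian_monoid.a_closed[OF assms(1)] by (auto simp: semilinear_def)

lemma semilinear_id_add:
  assumes "module R N" "semilinear R (\<lambda>r. r) M N f" "semilinear R (\<lambda>r. r) M N g"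
  shows "semilinear R (\<lambda>r. r) M N (\<lambda>x. f x \<oplus>\<^bsub>N\<^esub> g x)"
proof -
  interpret N: module R N by fact
  show ?thesis
    using assms(2,3) unfolding semilinear_def by (auto simp: N.M.a_ac N.smult_r_distr)
qed

lemma semilinear_id_minus:
  assumes "module R N" "semilinear R (\<lambda>r. r) M N f" "semilinear R (\<lambda>r. r) M N g"
  shows "semilinear R (\<lambda>r. r) M N (\<lambda>x. f x \<ominus>\<^bsub>N\<^esub> g x)"
proof -
  interpret N: module R N by fact
  show ?thesis
    using assms(2,3) unfolding semilinear_def
    by (auto simp: N.M.a_ac N.smult_r_distr N.smult_r_minus N.M.minus_eq N.M.minus_add)
qed

lemma semilinear_id_zero:
  assumes "module R N"
  shows "semilinear R (\<lambda>r. r) M N (\<lambda>x. \<zero>\<^bsub>N\<^esub>)"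
proof -
  interpret N: module R N by fact
  show ?thesis unfolding semilinear_def by auto
qed

lemma alternating_sum_semilinear:
  assumes "module R N" "\<And>f. f \<in> set fs \<Longrightarrow> semilinear R (\<lambda>r. r) M N f"
  shows "semilinear R (\<lambda>r. r) M N (alternating_sum N fs)"
  using assms(2)
proof (induction fs)
  case Nil
  then show ?case using semilinear_id_zero[OF assms(1)] by simp
next
  case (Cons f fs)
  then show ?case using semilinear_id_minus[OF assms(1), of M f "alternating_sum N fs"] by simp
qed

text \<open>Every coset of a cocycle is the image itself. Differences are expressed through
  \<open>add\<close> alone, which avoids computing inverses in the record of a hom module.\<close>

lemma cohomology_trivialI:
  assumes add: "\<And>a b. a \<in> f ` carrier X \<Longrightarrow> b \<in> f ` carrier X \<Longrightarrow> a \<oplus>\<^bsub>Y\<^esub> b \<in> f ` carrier X"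
    and minus: "\<And>a b. a \<in> f ` carrier X \<Longrightarrow> b \<in> f ` carrier X \<Longrightarrow> \<exists>c\<in>f ` carrier X. a = c \<oplus>\<^bsub>Y\<^esub> b"
    and zero: "z \<in> carrier Y" "g z = \<zero>\<^bsub>Z\<^esub>"
    and ker: "\<And>y. y \<in> carrier Y \<Longrightarrow> g y = \<zero>\<^bsub>Z\<^esub> \<Longrightarrow> y \<in> f ` carrier X"
  shows "carrier (cohomology X Y Z f g) = {\<zero>\<^bsub>cohomology X Y Z f g\<^esub>}"
proof -
  have coset: "f ` carrier X +>\<^bsub>Y\<lparr>carrier := K\<rparr>\<^esub> y = f ` carrier X" if y: "y \<in> f ` carrier X" for y K
  proof (intro equalityI subsetI)
    fix a assume "a \<in> f ` carrier X +>\<^bsub>Y\<lparr>carrier := K\<rparr>\<^esub> y"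
    then obtain h where "h \<in> f ` carrier X" "a = h \<oplus>\<^bsub>Y\<^esub> y" unfolding a_r_coset_def' by auto
    then show "a \<in> f ` carrier X" using add y by blast
  next
    fix a assume "a \<in> f ` carrier X"
    then obtain c where "c \<in> f ` carrier X" "a = c \<oplus>\<^bsub>Y\<^esub> y" using minus y by blast
    then show "a \<in> f ` carrier X +>\<^bsub>Y\<lparr>carrier := K\<rparr>\<^esub> y" unfolding a_r_coset_def' by auto
  qed
  let ?K = "{y \<in> carrier Y. g y = \<zero>\<^bsub>Z\<^esub>}"
  have "(\<lambda>y. f ` carrier X +>\<^bsub>Y\<lparr>carrier := ?K\<rparr>\<^esub> y) ` ?K = {f ` carrier X}"
  proof -
    have "f ` carrier X +>\<^bsub>Y\<lparr>carrier := ?K\<rparr>\<^esub> y = f ` carrier X" if "y \<in> ?K" for y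
      using coset[OF ker] that by blast
    moreover have "z \<in> ?K" using zero by blast
    ultimately show ?thesis by blast
  qed
  then show ?thesis
    unfolding cohomology_def quot_module_simps by simp
qed

lemma free_alg_map:
  assumes "calg C" "\<And>b. b \<in> S \<Longrightarrow> f b \<in> carrier C"
  shows "alg_hom (poly_algebra S) (free_alg C) (free_alg_map C f)"
    and "b \<in> S \<Longrightarrow> free_alg_map C f (poly_var b) = poly_var (f b)"
proof -
  interpret F: calg "free_alg C" by (rule poly_algebra_calg)
  have c: "\<And>b. b \<in> S \<Longrightarrow> poly_var (f b) \<in> carrier (free_alg C)" by (rule poly_var_closed[OF assms(2)])
  show "alg_hom (poly_algebra S) (free_alg C) (free_alg_map C f)"
    unfolding free_alg_map_def by (rule F.poly_eval_alg_hom) (rule c)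
  show "b \<in> S \<Longrightarrow> free_alg_map C f (poly_var b) = poly_var (f b)"
    unfolding free_alg_map_def by (rule F.poly_eval_var) (rule c)
qed

lemma counit:
  assumes "calg B"
  shows "alg_hom (free_alg B) B (counit B)"
    and "b \<in> carrier B \<Longrightarrow> counit B (poly_var b) = b"
proof -
  interpret calg B by fact
  show "alg_hom (free_alg B) B (counit B)"
    unfolding counit_def by (rule poly_eval_alg_hom)
  show "b \<in> carrier B \<Longrightarrow> counit B (poly_var b) = b"
    unfolding counit_def by (rule poly_eval_var)
qed

lemma alg_hom_comp:
  assumes "alg_hom P Q f" "alg_hom Q T g"
  shows "alg_hom P T (\<lambda>x. g (f x))"
proof -
  note f = alg_homD[OF assms(1)] and g = alg_homD[OF assms(2)]
  have "(\<lambda>x. g (f x)) \<in> ring_hom P T"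
    by (rule ring_hom_memI) (simp_all add: f g)
  then show ?thesis by (simp add: alg_hom_def f g)
qed

text \<open>Both sides are algebra homomorphisms with value \<open>f b\<close> on the variable
  \<open>b\<close>. This naturality, together with functoriality of \<open>free_alg_map\<close>,
  supplies the simplicial identities used below.\<close>

lemma counit_natural:
  assumes "calg B" "calg C" "alg_hom B C f" "p \<in> carrier (free_alg B)"
  shows "counit C (free_alg_map C f p) = f (counit B p)"
proof (rule alg_hom_poly_ext[OF _ _ _ assms(4)])
  have fc: "\<And>b. b \<in> carrier B \<Longrightarrow> f b \<in> carrier C" using alg_homD(3)[OF assms(3)] .
  note m = free_alg_map[where S="carrier B" and f=f, OF assms(2) fc]
  show "alg_hom (free_alg B) C (\<lambda>p. counit C (free_alg_map C f p))"
    by (rule alg_hom_comp[OF m(1) counit(1)[OF assms(2)]])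
  show "alg_hom (free_alg B) C (\<lambda>p. f (counit B p))"
    by (rule alg_hom_comp[OF counit(1)[OF assms(1)] assms(3)])
  show "counit C (free_alg_map C f (poly_var v)) = f (counit B (poly_var v))" if "v \<in> carrier B" for v
    by (simp only: m(2)[OF _ that] counit(2)[OF assms(2) fc[OF that]] counit(2)[OF assms(1) that])
qed

section \<open>The standard resolution and its cochains as functions on variables\<close>

locale resolution = calg A for A :: "(complex, 'a, 'z) module_scheme" (structure)
begin

lemma res_calg: "calg (res0 A)" "calg (res1 A)" "calg (res2 A)" "calg (res3 A)"
  unfolding res0_def res1_def res2_def res3_def by (rule poly_algebra_calg)+

lemma aug0: "alg_hom (res0 A) A (aug0 A)"
  unfolding res0_def aug0_def by (rule counit(1)) (rule calg_axioms)

lemma counit_res: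
  "alg_hom (res1 A) (res0 A) (counit (res0 A))" "alg_hom (res2 A) (res1 A) (counit (res1 A))"
  "alg_hom (res3 A) (res2 A) (counit (res2 A))"
  unfolding res1_def[of A] res2_def[of A] res3_def[of A] by (rule counit(1) poly_algebra_calg res_calg)+

lemma aug1: "alg_hom (res1 A) A (aug1 A)"
  unfolding aug1_def comp_def by (rule alg_hom_comp[OF counit_res(1) aug0])

lemma aug2: "alg_hom (res2 A) A (aug2 A)"
  unfolding aug2_def comp_def by (rule alg_hom_comp[OF counit_res(2) aug1])

lemma aug3: "alg_hom (res3 A) A (aug3 A)"
  unfolding aug3_def comp_def by (rule alg_hom_comp[OF counit_res(3) aug2])

lemma c1: "augmented (res1 A) A (aug1 A)"
  by (intro augmented.intro augmented_axioms.intro calg_axioms res_calg aug1)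
lemma c2: "augmented (res2 A) A (aug2 A)"
  by (intro augmented.intro augmented_axioms.intro calg_axioms res_calg aug2)
lemma c3: "augmented (res3 A) A (aug3 A)"
  by (intro augmented.intro augmented_axioms.intro calg_axioms res_calg aug3)

text \<open>Faces are homomorphisms over \<open>A\<close>. For the face that is not a counit this is
  naturality of the counit with respect to the augmentation; the same argument, one level up each
  time, serves \<open>faces2\<close> and \<open>faces3\<close>.\<close>

lemma faces1:
  assumes "d \<in> set (faces1 A)"
  shows "alg_hom (res1 A) (res0 A) d" "\<And>q. q \<in> carrier (res1 A) \<Longrightarrow> aug1 A q = aug0 A (d q)"
proof -
  have m: "alg_hom (res1 A) (res0 A) (free_alg_map A (aug0 A))"
    unfolding res1_def res0_def[of A] by (rule free_alg_map(1)[OF calg_axioms]) (rule alg_homD(3)[OF aug0, unfolded res0_def])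
  show "alg_hom (res1 A) (res0 A) d" using assms m counit_res(1) by (auto simp: faces1_def)
  show "aug1 A q = aug0 A (d q)" if q: "q \<in> carrier (res1 A)" for q
    using assms counit_natural[OF res_calg(1) calg_axioms aug0, of q] q
    by (auto simp: faces1_def aug1_def aug0_def res1_def)
qed

lemma faces2:
  assumes "d \<in> set (faces2 A)"
  shows "alg_hom (res2 A) (res1 A) d" "\<And>q. q \<in> carrier (res2 A) \<Longrightarrow> aug2 A q = aug1 A (d q)"
proof -
  have m: "alg_hom (res2 A) (res1 A) (free_alg_map (res0 A) f)" if f: "f \<in> set (faces1 A)" for f
    unfolding res2_def res1_def[of A] by (rule free_alg_map(1)[OF res_calg(1)]) (rule alg_homD(3)[OF faces1(1)[OF f], unfolded res1_def])
  show "alg_hom (res2 A) (res1 A) d" using assms m counit_res(2) by (auto simp: faces2_def)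
  show "aug2 A q = aug1 A (d q)" if q: "q \<in> carrier (res2 A)" for q
  proof -
    have "aug1 A (free_alg_map (res0 A) f q) = aug2 A q" if f: "f \<in> set (faces1 A)" for f
      using counit_natural[OF res_calg(2) res_calg(1) faces1(1)[OF f], of q] q faces1(2)[OF f]
        alg_homD(3)[OF counit_res(2) q]
      by (simp add: aug1_def aug2_def res2_def)
    then show ?thesis using assms by (auto simp: faces2_def aug2_def)
  qed
qed

lemma faces3:
  assumes "d \<in> set (faces3 A)"
  shows "alg_hom (res3 A) (res2 A) d" "\<And>q. q \<in> carrier (res3 A) \<Longrightarrow> aug3 A q = aug2 A (d q)"
proof -
  have m: "alg_hom (res3 A) (res2 A) (free_alg_map (res1 A) f)" if f: "f \<in> set (faces2 A)" for f
    unfolding res3_def res2_def[of A] by (rule free_alg_map(1)[OF res_calg(2)]) (rule alg_homD(3)[OF faces2(1)[OF f], unfolded res2_def])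
  show "alg_hom (res3 A) (res2 A) d" using assms m counit_res(3) by (auto simp: faces3_def)
  show "aug3 A q = aug2 A (d q)" if q: "q \<in> carrier (res3 A)" for q
  proof -
    have "aug2 A (free_alg_map (res1 A) f q) = aug3 A q" if f: "f \<in> set (faces2 A)" for f
      using counit_natural[OF res_calg(3) res_calg(2) faces2(1)[OF f], of q] q faces2(2)[OF f]
        alg_homD(3)[OF counit_res(3) q]
      by (simp add: aug2_def aug3_def res3_def)
    then show ?thesis using assms by (auto simp: faces3_def aug3_def)
  qed
qed

lemma d2_semilinear: "semilinear A (\<lambda>a. a) (cotangent2 A) (cotangent1 A) (cotangent_d2 A)"
proof -
  have "semilinear A (\<lambda>a. a) (cotangent2 A) (cotangent1 A) (differentials_over_map A (res2 A) (res1 A) (aug1 A) d)"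
    if "d \<in> set (faces2 A)" for d
    unfolding cotangent1_def cotangent2_def
    by (rule differentials_over_map(1)[OF c2 c1 faces2[OF that]])
  then have "semilinear A (\<lambda>a. a) (cotangent2 A) (cotangent1 A) h"
    if "h \<in> set (map (differentials_over_map A (res2 A) (res1 A) (aug1 A)) (faces2 A))" for h
    using that by auto
  then show ?thesis
    unfolding cotangent_d2_def
    by (intro alternating_sum_semilinear[OF augmented.differentials_module[OF c1, folded cotangent1_def]])
qed

lemma d3_semilinear: "semilinear A (\<lambda>a. a) (cotangent3 A) (cotangent2 A) (cotangent_d3 A)"
proof -
  have "semilinear A (\<lambda>a. a) (cotangent3 A) (cotangent2 A) (differentials_over_map A (res3 A) (res2 A) (aug2 A) d)"
    if "d \<in> set (faces3 A)" for d
    unfolding cotangent2_def cotangent3_def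
    by (rule differentials_over_map(1)[OF c3 c2 faces3[OF that]])
  then have "semilinear A (\<lambda>a. a) (cotangent3 A) (cotangent2 A) h"
    if "h \<in> set (map (differentials_over_map A (res3 A) (res2 A) (aug2 A)) (faces3 A))" for h
    using that by auto
  then show ?thesis
    unfolding cotangent_d3_def
    by (intro alternating_sum_semilinear[OF augmented.differentials_module[OF c2, folded cotangent2_def]])
qed

lemma semilinear_alternating_sum:
  assumes "module A M" "module A N" and h: "semilinear A (\<lambda>a. a) M N h" and "\<And>f. f \<in> set fs \<Longrightarrow> f x \<in> carrier M"
  shows "h (alternating_sum M fs x) = alternating_sum N (map (\<lambda>f y. h (f y)) fs) x"
    "alternating_sum M fs x \<in> carrier M"
proof -
  interpret M: module A M by fact
  interpret N: module A N by fact
  have "h (alternating_sum M fs x) = alternating_sum N (map (\<lambda>f y. h (f y)) fs) x \<and> alternating_sum M fs x \<in> carrier M"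
    using assms(4)
    by (induction fs)
       (auto simp: semilinear_zero[OF h M.abelian_group_axioms N.abelian_group_axioms]
         semilinear_minus[OF h M.abelian_group_axioms N.abelian_group_axioms])
  then show "h (alternating_sum M fs x) = alternating_sum N (map (\<lambda>f y. h (f y)) fs) x"
    "alternating_sum M fs x \<in> carrier M" by auto
qed

text \<open>Faces act on \<open>dp \<otimes> 1\<close> by acting on \<open>p\<close>, so the
  pull-back of a cochain along the differential is an alternating sum of a derivation evaluated at
  the faces of \<open>p\<close>.\<close>

lemma d2_diff_gen:
  assumes h: "semilinear A (\<lambda>a. a) (cotangent1 A) N h" and N: "module A N" and p: "p \<in> carrier (res2 A)"
  shows "h (cotangent_d2 A (diff_gen A (res2 A) (aug2 A) p)) =
    alternating_sum N (map (\<lambda>d p. h (diff_gen A (res1 A) (aug1 A) (d p))) (faces2 A)) p"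
proof -
  have c: "differentials_over_map A (res2 A) (res1 A) (aug1 A) d (diff_gen A (res2 A) (aug2 A) p) = diff_gen A (res1 A) (aug1 A) (d p)"
    if "d \<in> set (faces2 A)" for d
    by (rule differentials_over_map(2)[OF c2 c1 faces2[OF that] p])
  have cl: "diff_gen A (res1 A) (aug1 A) (d p) \<in> carrier (cotangent1 A)" if "d \<in> set (faces2 A)" for d
    unfolding cotangent1_def using derivationD(1)[OF augmented.diff_gen_derivation[OF c1]] alg_homD(3)[OF faces2(1)[OF that] p] by blast
  have cong: "alternating_sum N (map (\<lambda>d. F d) fs) x = alternating_sum N (map (\<lambda>d. G d) fs) y"
    if "\<And>d. d \<in> set fs \<Longrightarrow> F d x = G d y" for F G fs x y
    using that by (induction fs) auto
  show ?thesis
    unfolding cotangent_d2_def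
    by (subst semilinear_alternating_sum(1)[OF _ N h])
       (use augmented.differentials_module[OF c1] c cl in \<open>auto simp: cotangent1_def comp_def intro!: cong\<close>)
qed

lemma d3_diff_gen:
  assumes h: "semilinear A (\<lambda>a. a) (cotangent2 A) N h" and N: "module A N" and p: "p \<in> carrier (res3 A)"
  shows "h (cotangent_d3 A (diff_gen A (res3 A) (aug3 A) p)) =
    alternating_sum N (map (\<lambda>d p. h (diff_gen A (res2 A) (aug2 A) (d p))) (faces3 A)) p"
proof -
  have c: "differentials_over_map A (res3 A) (res2 A) (aug2 A) d (diff_gen A (res3 A) (aug3 A) p) = diff_gen A (res2 A) (aug2 A) (d p)"
    if "d \<in> set (faces3 A)" for d
    by (rule differentials_over_map(2)[OF c3 c2 faces3[OF that] p])
  have cl: "diff_gen A (res2 A) (aug2 A) (d p) \<in> carrier (cotangent2 A)" if "d \<in> set (faces3 A)" for d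
    unfolding cotangent2_def using derivationD(1)[OF augmented.diff_gen_derivation[OF c2]] alg_homD(3)[OF faces3(1)[OF that] p] by blast
  have cong: "alternating_sum N (map (\<lambda>d. F d) fs) x = alternating_sum N (map (\<lambda>d. G d) fs) y"
    if "\<And>d. d \<in> set fs \<Longrightarrow> F d x = G d y" for F G fs x y
    using that by (induction fs) auto
  show ?thesis
    unfolding cotangent_d3_def
    by (subst semilinear_alternating_sum(1)[OF _ N h])
       (use augmented.differentials_module[OF c2] c cl in \<open>auto simp: cotangent2_def comp_def intro!: cong\<close>)
qed

abbreviation (input) "AA \<equiv> regular_module A"

lemma AA_module: "module A AA" by (rule regular_module_module[OF cring_axioms])

text \<open>Value of the coboundary of \<open>g\<close> at the variable named by \<open>r\<close>.
  The first face is the counit, which turns this variable into the polynomial \<open>r\<close>, so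
  the derivation extending \<open>g\<close> has to be evaluated; the other faces turn it into a
  variable, where the derivation is \<open>g\<close>. The nesting of the differences follows
  \<open>alternating_sum\<close>.\<close>

abbreviation (input) "cobnd2 g r \<equiv> der_ext A (aug2 A) g r \<ominus> (g (counit (res1 A) r) \<ominus>
  (g (free_alg_map (res0 A) (counit (res0 A)) r) \<ominus> g (free_alg_map (res0 A) (free_alg_map A (aug0 A)) r)))"

abbreviation (input) "cobnd1 f q \<equiv> der_ext A (aug1 A) f q \<ominus> (f (counit (res0 A) q) \<ominus> f (free_alg_map A (aug0 A) q))"

lemma minus_regular: "x \<ominus>\<^bsub>AA\<^esub> y = x \<ominus> y"
  by (simp add: a_minus_def a_inv_def m_inv_def)

text \<open>A linear map on \<open>cotangent2 A\<close> is a derivation of \<open>res2 A\<close>,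
  and this is given by an arbitrary function on the variables, the elements of
  \<open>res1 A\<close>. Vanishing of the cohomology thereby becomes a statement about
  functions.\<close>

lemma T2_trivialI:
  assumes H: "\<And>g. (\<And>q. q \<in> carrier (res1 A) \<Longrightarrow> g q \<in> carrier A) \<Longrightarrow>
    (\<And>r. r \<in> carrier (res2 A) \<Longrightarrow> cobnd2 g r = \<zero>) \<Longrightarrow>
    \<exists>f. (\<forall>p\<in>carrier (res0 A). f p \<in> carrier A) \<and> (\<forall>q\<in>carrier (res1 A). g q = cobnd1 f q)"
  shows "carrier (T2 A) = {\<zero>\<^bsub>T2 A\<^esub>}"
  unfolding T2_module_def
proof (rule cohomology_trivialI)
  let ?X = "hom_module A (cotangent1 A) AA"
  let ?Y = "hom_module A (cotangent2 A) AA"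
  let ?Z = "hom_module A (cotangent3 A) AA"
  let ?f = "hom_precomp (cotangent2 A) (cotangent_d2 A)"
  let ?g = "hom_precomp (cotangent3 A) (cotangent_d3 A)"
  interpret R: module A AA by (rule AA_module)
  interpret C1: module A "cotangent1 A" unfolding cotangent1_def by (rule augmented.differentials_module[OF c1])
  interpret C2: module A "cotangent2 A" unfolding cotangent2_def by (rule augmented.differentials_module[OF c2])
  interpret C3: module A "cotangent3 A" unfolding cotangent3_def by (rule augmented.differentials_module[OF c3])
  note d2c = semilinearD(1)[OF d2_semilinear] and d3c = semilinearD(1)[OF d3_semilinear]
  have restr: "restrict f (carrier (cotangent1 A)) \<in> carrier ?X" if "semilinear A (\<lambda>a. a) (cotangent1 A) AA f" for f
    using that semilinear_restrict[OF C1.abelian_monoid_axioms C1.smult_closed] by (auto simp: hom_module_carrier)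
  show "a \<oplus>\<^bsub>?Y\<^esub> b \<in> ?f ` carrier ?X" if "a \<in> ?f ` carrier ?X" "b \<in> ?f ` carrier ?X" for a b
  proof -
    obtain h k where h: "a = ?f h" "h \<in> carrier ?X" and k: "b = ?f k" "k \<in> carrier ?X" using \<open>a \<in> _\<close> \<open>b \<in> _\<close> by blast
    have "restrict (\<lambda>x. h x \<oplus>\<^bsub>AA\<^esub> k x) (carrier (cotangent1 A)) \<in> carrier ?X"
      by (rule restr, rule semilinear_id_add[OF AA_module]) (use h k in \<open>auto simp: hom_module_carrier\<close>)
    moreover have "a \<oplus>\<^bsub>?Y\<^esub> b = ?f (restrict (\<lambda>x. h x \<oplus>\<^bsub>AA\<^esub> k x) (carrier (cotangent1 A)))"
      using d2c by (auto simp: h k hom_module_simps hom_precomp_def restrict_def)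
    ultimately show ?thesis by blast
  qed
  show "\<exists>c\<in>?f ` carrier ?X. a = c \<oplus>\<^bsub>?Y\<^esub> b" if "a \<in> ?f ` carrier ?X" "b \<in> ?f ` carrier ?X" for a b
  proof -
    obtain h k where h: "a = ?f h" "h \<in> carrier ?X" and k: "b = ?f k" "k \<in> carrier ?X" using \<open>a \<in> _\<close> \<open>b \<in> _\<close> by blast
    have "restrict (\<lambda>x. h x \<ominus>\<^bsub>AA\<^esub> k x) (carrier (cotangent1 A)) \<in> carrier ?X"
      by (rule restr, rule semilinear_id_minus[OF AA_module]) (use h k in \<open>auto simp: hom_module_carrier\<close>)
    moreover have "a = ?f (restrict (\<lambda>x. h x \<ominus>\<^bsub>AA\<^esub> k x) (carrier (cotangent1 A))) \<oplus>\<^bsub>?Y\<^esub> b"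
    proof (rule ext)
      fix x
      have cl: "h y \<in> carrier A" "k y \<in> carrier A" if "y \<in> carrier (cotangent1 A)" for y
        using h(2) k(2) that unfolding hom_module_carrier semilinear_def by auto
      show "a x = (?f (restrict (\<lambda>x. h x \<ominus>\<^bsub>AA\<^esub> k x) (carrier (cotangent1 A))) \<oplus>\<^bsub>?Y\<^esub> b) x"
        using d2c[of x] cl[of "cotangent_d2 A x"]
        by (auto simp: h k hom_module_simps hom_precomp_def restrict_def minus_regular minus_eq a_assoc l_neg)
    qed
    ultimately show ?thesis by blast
  qed
  have z: "semilinear A (\<lambda>a. a) (cotangent2 A) AA (\<lambda>x. \<zero>\<^bsub>AA\<^esub>)" by (rule semilinear_id_zero[OF AA_module])
  show "(\<lambda>x\<in>carrier (cotangent2 A). \<zero>) \<in> carrier ?Y"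
    using z semilinear_restrict[OF C2.abelian_monoid_axioms C2.smult_closed] by (auto simp: hom_module_carrier)
  show "?g (\<lambda>x\<in>carrier (cotangent2 A). \<zero>) = \<zero>\<^bsub>?Z\<^esub>"
    using d3c by (auto simp: hom_module_simps hom_precomp_def restrict_def)
  fix \<Phi> assume \<Phi>: "\<Phi> \<in> carrier ?Y" and ker: "?g \<Phi> = \<zero>\<^bsub>?Z\<^esub>"
  have lin: "semilinear A (\<lambda>a. a) (cotangent2 A) AA \<Phi>" and ext: "\<Phi> \<in> extensional (carrier (cotangent2 A))"
    using \<Phi> by (auto simp: hom_module_carrier)
  define D where "D p = \<Phi> (diff_gen A (res2 A) (aug2 A) p)" for p
  have aug_fun: "aug2 A \<in> carrier (res2 A) \<rightarrow> carrier A" "aug1 A \<in> carrier (res1 A) \<rightarrow> carrier A"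
    using alg_homD(3)[OF aug2] alg_homD(3)[OF aug1] by auto
  have D: "derivation (res2 A) AA (aug2 A) D"
    unfolding D_def
    by (rule derivation_comp_semilinear[OF augmented.diff_gen_derivation[OF c2] lin[unfolded cotangent2_def] aug_fun(1) res_calg(3) augmented.differentials_module[OF c2]])
  define g where "g q = D (poly_var q)" for q
  have v2: "poly_var q \<in> carrier (res2 A)" if "q \<in> carrier (res1 A)" for q
    using poly_var_closed[OF that] by (simp add: res2_def)
  have v3: "poly_var q \<in> carrier (res3 A)" if "q \<in> carrier (res2 A)" for q
    using poly_var_closed[OF that] by (simp add: res3_def)
  have gc: "g q \<in> carrier A" if "q \<in> carrier (res1 A)" for q
    using derivationD(1)[OF D v2[OF that]] v2[OF that] by (simp add: g_def)
  note dg = der_ext[where f=g, OF calg_axioms aug2[unfolded res2_def] gc]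
  have D_eq: "D r = der_ext A (aug2 A) g r" if "r \<in> carrier (res2 A)" for r
    using derivation_poly_ext[OF D[unfolded res2_def] dg(1) _ _ AA_module aug2[unfolded res2_def], of r] that dg(2)
    by (auto simp: g_def res2_def)
  have f2: "free_alg_map (res0 A) d (poly_var q) = poly_var (d q)" if "q \<in> carrier (res1 A)" "d \<in> set (faces1 A)" for d q
    by (rule free_alg_map(2)[OF res_calg(1) alg_homD(3)[OF faces1(1)[OF that(2)]] that(1)])
  have f3: "free_alg_map (res1 A) d (poly_var r) = poly_var (d r)" if "r \<in> carrier (res2 A)" "d \<in> set (faces2 A)" for d r
    by (rule free_alg_map(2)[OF res_calg(2) alg_homD(3)[OF faces2(1)[OF that(2)]] that(1)])
  have "cobnd2 g r = \<zero>" if r: "r \<in> carrier (res2 A)" for r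
  proof -
    have c3: "diff_gen A (res3 A) (aug3 A) (poly_var r) \<in> carrier (cotangent3 A)"
      unfolding cotangent3_def using derivationD(1)[OF augmented.diff_gen_derivation[OF c3] v3[OF r] v3[OF r]] .
    \<comment> \<open>The cocycle condition is read off at \<open>dv \<otimes> 1\<close>, where
      \<open>v\<close> is the variable of \<open>res3 A\<close> named by \<open>r\<close>.\<close>
    have "\<Phi> (cotangent_d3 A (diff_gen A (res3 A) (aug3 A) (poly_var r))) = \<zero>"
      using fun_cong[OF ker, of "diff_gen A (res3 A) (aug3 A) (poly_var r)"] c3
      by (simp add: hom_module_simps hom_precomp_def)
    then have "alternating_sum AA (map (\<lambda>d p. D (d p)) (faces3 A)) (poly_var r) = \<zero>"
      using d3_diff_gen[OF lin AA_module v3[OF r]] by (simp add: D_def)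
    moreover have "g (d r) \<in> carrier A" if "d \<in> set (faces2 A)" for d
      using gc alg_homD(3)[OF faces2(1)[OF that] r] by blast
    ultimately show ?thesis
      using counit(2)[OF res_calg(3) r] f3[OF r] D_eq[OF r]
      by (simp add: faces3_def faces2_def faces1_def g_def[symmetric] minus_regular)
         (simp add: minus_eq)
  qed
  from H[of g, OF gc this] obtain f where fc: "\<And>p. p \<in> carrier (res0 A) \<Longrightarrow> f p \<in> carrier A"
    and gf: "\<And>q. q \<in> carrier (res1 A) \<Longrightarrow> g q = cobnd1 f q" by blast
  note df = der_ext[where f=f, OF calg_axioms aug1[unfolded res1_def] fc]
  obtain \<Psi> where \<Psi>: "semilinear A (\<lambda>a. a) (cotangent1 A) AA \<Psi>"
    and \<Psi>d: "\<And>p. p \<in> carrier (res1 A) \<Longrightarrow> \<Psi> (diff_gen A (res1 A) (aug1 A) p) = der_ext A (aug1 A) f p"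
    using augmented.differentials_lift[OF c1 AA_module, of "der_ext A (aug1 A) f"] df(1)
    unfolding cotangent1_def res1_def by blast
  have comp: "semilinear A (\<lambda>a. a) (cotangent2 A) AA (\<lambda>x. \<Psi> (cotangent_d2 A x))"
    using semilinear_comp[OF d2_semilinear \<Psi>] by auto
  have Dc: "derivation (res2 A) AA (aug2 A) (\<lambda>p. \<Psi> (cotangent_d2 A (diff_gen A (res2 A) (aug2 A) p)))"
    by (rule derivation_comp_semilinear[OF augmented.diff_gen_derivation[OF c2] comp[unfolded cotangent2_def] aug_fun(1) res_calg(3) augmented.differentials_module[OF c2]])
  \<comment> \<open>Both sides are derivations of \<open>res2 A\<close> along \<open>aug2 A\<close>,
    so a comparison on variables suffices, and there the claim is the equation between
    \<open>g\<close> and \<open>cobnd1 f\<close>.\<close>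
  have on_var: "D (poly_var q) = \<Psi> (cotangent_d2 A (diff_gen A (res2 A) (aug2 A) (poly_var q)))" if q: "q \<in> carrier (res1 A)" for q
  proof -
    have d0: "d q \<in> carrier (res0 A)" if "d \<in> set (faces1 A)" for d
      using alg_homD(3)[OF faces1(1)[OF that] q] .
    then have "f (d q) \<in> carrier A" "poly_var (d q) \<in> carrier (res1 A)" "der_ext A (aug1 A) f (poly_var (d q)) = f (d q)"
       if "d \<in> set (faces1 A)" for d
      using that fc df(2) poly_var_closed[of "d q" "carrier (res0 A)"] by (auto simp: res1_def)
    then show ?thesis
      using d2_diff_gen[OF \<Psi> AA_module v2[OF q]] gf[OF q] counit(2)[OF res_calg(2) q] f2[OF q] q \<Psi>d
      by (simp add: g_def[symmetric] faces2_def faces1_def minus_regular)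
         (simp add: minus_eq)
  qed
  have "\<Phi> x = \<Psi> (cotangent_d2 A x)" if x: "x \<in> carrier (cotangent2 A)" for x
  proof (rule augmented.differentials_ext[OF c2 lin[unfolded cotangent2_def] comp[unfolded cotangent2_def] R.abelian_group_axioms _ x[unfolded cotangent2_def]])
    fix p assume "p \<in> carrier (res2 A)"
    then show "\<Phi> (diff_gen A (res2 A) (aug2 A) p) = \<Psi> (cotangent_d2 A (diff_gen A (res2 A) (aug2 A) p))"
      using derivation_poly_ext[OF D[unfolded res2_def] Dc[unfolded res2_def] _ _ AA_module aug2[unfolded res2_def], of p]
        on_var by (simp add: res2_def D_def)
  qed
  then have "\<Phi> = ?f (restrict \<Psi> (carrier (cotangent1 A)))"
    using ext d2c by (auto simp: hom_precomp_def fun_eq_iff extensional_def restrict_def)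
  then show "\<Phi> \<in> ?f ` carrier ?X" using restr[OF \<Psi>] by blast
qed

end

section \<open>Pulling cocycles back to a polynomial presentation\<close>

lemma free_alg_map_comp:
  assumes "calg C" "calg B" "\<And>x. x \<in> S \<Longrightarrow> f x \<in> carrier B" "\<And>x. x \<in> carrier B \<Longrightarrow> g x \<in> carrier C"
    and "\<And>x. x \<in> S \<Longrightarrow> g (f x) = k x" and p: "p \<in> carrier (poly_algebra S)"
  shows "free_alg_map C g (free_alg_map B f p) = free_alg_map C k p"
proof (rule alg_hom_poly_ext[OF _ _ _ p])
  have kc: "\<And>x. x \<in> S \<Longrightarrow> k x \<in> carrier C" using assms(3,4,5) by metis
  show "alg_hom (poly_algebra S) (free_alg C) (\<lambda>p. free_alg_map C g (free_alg_map B f p))"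
    by (rule alg_hom_comp[OF free_alg_map(1)[OF assms(2,3)] free_alg_map(1)[OF assms(1,4)]])
  show "alg_hom (poly_algebra S) (free_alg C) (free_alg_map C k)" by (rule free_alg_map(1)[OF assms(1) kc])
  show "free_alg_map C g (free_alg_map B f (poly_var v)) = free_alg_map C k (poly_var v)" if "v \<in> S" for v
    using free_alg_map(2)[OF assms(2,3) that] free_alg_map(2)[OF assms(1,4) assms(3)[OF that]]
      free_alg_map(2)[OF assms(1) kc that] assms(5)[OF that] by simp
qed

lemma alg_hom_poly:
  assumes "alg_hom (poly_algebra V) (poly_algebra W) f" "p \<in> carrier (poly_algebra V)" "q \<in> carrier (poly_algebra V)"
  shows "f (p + q) = f p + f q" "f (p * q) = f p * f q" "f (Poly_Mapping.single 0 c * p) = Poly_Mapping.single 0 c * f p"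
    "f p \<in> carrier (poly_algebra W)"
  using alg_homD[OF assms(1)] assms(2,3) by auto

lemma derivation_cong:
  assumes "derivation P M e D" "calg P" "\<And>p. p \<in> carrier P \<Longrightarrow> e p = e' p" "\<And>p. p \<in> carrier P \<Longrightarrow> D p = D' p"
  shows "derivation P M e' D'"
proof -
  interpret calg P by fact
  have e: "e' p = e p" and D: "D' p = D p" if "p \<in> carrier P" for p
    using assms(3)[OF that] assms(4)[OF that] by simp_all
  show ?thesis unfolding derivation_def
    using derivationD[OF assms(1)] by (intro conjI ballI allI) (simp_all add: e D)
qed

lemma poly_smult_closed:
  "p \<in> carrier (poly_algebra V) \<Longrightarrow> Poly_Mapping.single 0 c * p \<in> carrier (poly_algebra V)"
  by (intro poly_algebra_mult poly_algebra_single) auto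

lemma poly_one_closed: "1 \<in> carrier (poly_algebra V)"
  by (simp add: poly_algebra_carrier)

lemma poly_zero_closed: "0 \<in> carrier (poly_algebra V)"
  by (simp add: poly_algebra_carrier)

lemma poly_minus_closed: "p \<in> carrier (poly_algebra V) \<Longrightarrow> q \<in> carrier (poly_algebra V) \<Longrightarrow> p - q \<in> carrier (poly_algebra V)"
  using poly_algebra_add[OF _ poly_algebra_uminus, of p V q] by simp

lemma poly_sum_closed: "(\<And>x. x \<in> X \<Longrightarrow> F x \<in> carrier (poly_algebra V)) \<Longrightarrow> sum F X \<in> carrier (poly_algebra V)"
  by (induction X rule: infinite_finite_induct) (auto intro: poly_algebra_add poly_zero_closed)

lemmas poly_closed = poly_algebra_add poly_algebra_mult poly_smult_closed poly_one_closed poly_var_closed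
  poly_minus_closed poly_zero_closed

lemma (in calg) der_ext_simps:
  assumes e: "alg_hom (poly_algebra V) A e" and f: "\<And>v. v \<in> V \<Longrightarrow> f v \<in> carrier A"
    and p: "p \<in> carrier (poly_algebra V)" and q: "q \<in> carrier (poly_algebra V)"
  shows "der_ext A e f p \<in> carrier A"
    "der_ext A e f (p + q) = der_ext A e f p \<oplus> der_ext A e f q"
    "der_ext A e f (p * q) = e p \<otimes> der_ext A e f q \<oplus> e q \<otimes> der_ext A e f p"
    "der_ext A e f (Poly_Mapping.single 0 c * p) = c \<odot> der_ext A e f p"
proof -
  note d = derivationD[OF der_ext(1)[where f=f, OF calg_axioms e f] p q, simplified]
  show c: "der_ext A e f p \<in> carrier A"
    "der_ext A e f (p + q) = der_ext A e f p \<oplus> der_ext A e f q"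
    "der_ext A e f (p * q) = e p \<otimes> der_ext A e f q \<oplus> e q \<otimes> der_ext A e f p"
    using d by auto
  have "e (Poly_Mapping.single 0 c) = c \<odot> \<one>"
    using alg_homD(2)[OF e, of 1 c] alg_homD(6)[OF e] by (simp add: poly_one_closed)
  then show "der_ext A e f (Poly_Mapping.single 0 c * p) = c \<odot> der_ext A e f p"
    using d(3)[where c=c] smult_eq[OF c(1), of c] by simp
qed

lemma (in calg) der_ext_eqI:
  assumes e: "alg_hom (poly_algebra V) A e" and f: "\<And>v. v \<in> V \<Longrightarrow> f v \<in> carrier A"
    and D: "derivation (poly_algebra V) (regular_module A) e D" and "\<And>v. v \<in> V \<Longrightarrow> D (poly_var v) = f v"
    and p: "p \<in> carrier (poly_algebra V)"
  shows "D p = der_ext A e f p"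
  by (rule derivation_poly_ext[OF D der_ext(1)[OF calg_axioms e f] _ p regular_module_module[OF cring_axioms] e])
     (use der_ext(2)[OF calg_axioms e f] assms(4) in auto)

text \<open>\<open>s\<close> selects normal forms, which are linear combinations of standard monomials.\<close>

locale poly_presentation = resolution A for A :: "(complex, 'a, 'z) module_scheme" (structure) +
  fixes V :: "'v set" and \<pi> :: "'v cpoly \<Rightarrow> 'a" and s :: "'a \<Rightarrow> 'v cpoly"
  assumes \<pi>: "alg_hom (poly_algebra V) A \<pi>"
    and s_closed: "a \<in> carrier A \<Longrightarrow> s a \<in> carrier (poly_algebra V)"
    and \<pi>_s: "a \<in> carrier A \<Longrightarrow> \<pi> (s a) = a"
    and s_add: "a \<in> carrier A \<Longrightarrow> b \<in> carrier A \<Longrightarrow> s (a \<oplus> b) = s a + s b"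
    and s_smult: "a \<in> carrier A \<Longrightarrow> s (c \<odot> a) = Poly_Mapping.single 0 c * s a"
    and s_std: "a \<in> carrier A \<Longrightarrow> m \<in> Poly_Mapping.keys (s a) \<Longrightarrow>
      s (\<pi> (Poly_Mapping.single m 1)) = Poly_Mapping.single m 1"
begin

abbreviation "R \<equiv> poly_algebra V"
abbreviation "GR \<equiv> free_alg R"
abbreviation "GGR \<equiv> free_alg GR"

lemma calgs: "calg R" "calg GR" "calg GGR"
  by (rule poly_algebra_calg)+

lemma \<pi>_closed: "x \<in> carrier R \<Longrightarrow> \<pi> x \<in> carrier A"
  by (rule alg_homD(3)[OF \<pi>])

text \<open>A lift of \<pi> through \<open>\<complex>[A] \<rightarrow> A\<close>. It exists because
  \<open>R\<close> is free, and it plays the role of an extra degeneracy: composing a cochain with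
  the maps induced by \<tau> lowers its degree by one.\<close>

definition "\<tau> = poly_eval (res0 A) (\<lambda>v. poly_var (\<pi> (poly_var v)))"

lemma \<tau>: "alg_hom R (res0 A) \<tau>" "v \<in> V \<Longrightarrow> \<tau> (poly_var v) = poly_var (\<pi> (poly_var v))"
proof -
  interpret F: calg "res0 A" by (rule res_calg)
  have c: "poly_var (\<pi> (poly_var v)) \<in> carrier (res0 A)" if "v \<in> V" for v
    unfolding res0_def by (rule poly_var_closed[OF \<pi>_closed[OF poly_var_closed[OF that]]])
  show "alg_hom R (res0 A) \<tau>" unfolding \<tau>_def by (rule F.poly_eval_alg_hom[OF c])
  show "v \<in> V \<Longrightarrow> \<tau> (poly_var v) = poly_var (\<pi> (poly_var v))"
    unfolding \<tau>_def by (rule F.poly_eval_var[OF c])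
qed

lemma aug0_\<tau>: "x \<in> carrier R \<Longrightarrow> aug0 A (\<tau> x) = \<pi> x"
proof (rule alg_hom_poly_ext[OF alg_hom_comp[OF \<tau>(1) aug0] \<pi>])
  show "aug0 A (\<tau> (poly_var v)) = \<pi> (poly_var v)" if "v \<in> V" for v
    unfolding aug0_def \<tau>(2)[OF that] by (rule counit(2)[OF calg_axioms \<pi>_closed[OF poly_var_closed[OF that]]])
qed

text \<open>A prefix \<open>G\<close> stands for the functor sending a map of sets to the induced map of polynomial algebras.
  \<open>ps\<close> replaces each variable, an element of \<open>R\<close>, by its normal form; the pull-back along \<open>G\<pi>\<close>
  identifies functions on \<open>\<complex>[A]\<close> with the \<open>ps\<close>-invariant functions on \<open>\<complex>[R]\<close>.\<close>

abbreviation "d \<equiv> counit R"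
definition "G\<tau> = free_alg_map (res0 A) \<tau>"
definition "G\<pi> = free_alg_map A \<pi>"
definition "GG\<pi> = free_alg_map (res0 A) G\<pi>"
definition "GG\<tau> = free_alg_map (res1 A) G\<tau>"
definition "Gs = free_alg_map R s"
definition "GGs = free_alg_map GR Gs"
definition "Gd = free_alg_map R d"
definition "ps p = Gs (G\<pi> p)"

lemma d: "alg_hom GR R d" "x \<in> carrier R \<Longrightarrow> d (poly_var x) = x"
  by (rule counit[OF calgs(1)])+

lemma G\<tau>: "alg_hom GR (res1 A) G\<tau>" "x \<in> carrier R \<Longrightarrow> G\<tau> (poly_var x) = poly_var (\<tau> x)"
  unfolding G\<tau>_def res1_def by (rule free_alg_map[OF res_calg(1)] alg_homD(3)[OF \<tau>(1)] | assumption)+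

lemma G\<pi>: "alg_hom GR (res0 A) G\<pi>" "x \<in> carrier R \<Longrightarrow> G\<pi> (poly_var x) = poly_var (\<pi> x)"
  unfolding G\<pi>_def res0_def by (rule free_alg_map[OF calg_axioms] alg_homD(3)[OF \<pi>(1)] | assumption)+

lemma GG\<pi>: "alg_hom GGR (res1 A) GG\<pi>" "x \<in> carrier GR \<Longrightarrow> GG\<pi> (poly_var x) = poly_var (G\<pi> x)"
  unfolding GG\<pi>_def res1_def by (rule free_alg_map[OF res_calg(1)] alg_homD(3)[OF G\<pi>(1)] | assumption)+

lemma GG\<tau>: "alg_hom GGR (res2 A) GG\<tau>" "x \<in> carrier GR \<Longrightarrow> GG\<tau> (poly_var x) = poly_var (G\<tau> x)"
  unfolding GG\<tau>_def res2_def by (rule free_alg_map[OF res_calg(2)] alg_homD(3)[OF G\<tau>(1)] | assumption)+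

lemma Gs: "alg_hom (res0 A) GR Gs" "a \<in> carrier A \<Longrightarrow> Gs (poly_var a) = poly_var (s a)"
  unfolding Gs_def res0_def by (rule free_alg_map[OF calgs(1)] s_closed | assumption)+

lemma GGs: "alg_hom (res1 A) GGR GGs" "a \<in> carrier (res0 A) \<Longrightarrow> GGs (poly_var a) = poly_var (Gs a)"
  unfolding GGs_def res1_def by (rule free_alg_map[OF calgs(2)] alg_homD(3)[OF Gs(1)] | assumption)+

lemma Gd: "alg_hom GGR GR Gd" "x \<in> carrier GR \<Longrightarrow> Gd (poly_var x) = poly_var (d x)"
  unfolding Gd_def by (rule free_alg_map[OF calgs(1)] alg_homD(3)[OF d(1)] | assumption)+

lemma ps: "alg_hom GR GR ps" "x \<in> carrier R \<Longrightarrow> ps (poly_var x) = poly_var (s (\<pi> x))"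
  unfolding ps_def using alg_hom_comp[OF G\<pi>(1) Gs(1)] G\<pi>(2) Gs(2)[OF \<pi>_closed] by auto

lemma G\<pi>_ps: "p \<in> carrier GR \<Longrightarrow> G\<pi> (ps p) = G\<pi> p"
proof (rule alg_hom_poly_ext[OF alg_hom_comp[OF ps(1) G\<pi>(1)] G\<pi>(1)])
  show "G\<pi> (ps (poly_var x)) = G\<pi> (poly_var x)" if "x \<in> carrier R" for x
    using ps(2)[OF that] G\<pi>(2)[OF that] G\<pi>(2)[OF s_closed[OF \<pi>_closed[OF that]]] \<pi>_s[OF \<pi>_closed[OF that]] by simp
qed

lemma \<pi>_d: "p \<in> carrier GR \<Longrightarrow> aug0 A (G\<pi> p) = \<pi> (d p)"
  unfolding aug0_def G\<pi>_def by (rule counit_natural[OF calgs(1) calg_axioms \<pi>])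

definition "e1 p = \<pi> (d p)"
definition "e2 r = \<pi> (d (counit GR r))"

lemma e1: "alg_hom GR A e1"
  unfolding e1_def by (rule alg_hom_comp[OF d(1) \<pi>])

lemma cGR: "alg_hom GGR GR (counit GR)" "p \<in> carrier GR \<Longrightarrow> counit GR (poly_var p) = p"
  by (rule counit[OF calgs(2)])+

lemma e2: "alg_hom GGR A e2"
  unfolding e2_def using alg_hom_comp[OF cGR(1) e1] by (simp add: e1_def)

lemma dd: "r \<in> carrier GGR \<Longrightarrow> d (Gd r) = d (counit GR r)"
  unfolding Gd_def by (rule counit_natural[OF calgs(2) calgs(1) d(1)])

lemma e2': "r \<in> carrier GGR \<Longrightarrow> e2 r = \<pi> (d (Gd r))"
  by (simp add: e2_def dd)

text \<open>Every element of \<open>res1 A\<close> is hit by \<open>GG\<pi>\<close>, with an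
  explicit preimage, so identities over \<open>R\<close> can be read as identities over
  \<open>A\<close>.\<close>

lemma GG\<pi>_GGs: "q \<in> carrier (res1 A) \<Longrightarrow> GG\<pi> (GGs q) = q"
proof (rule alg_hom_poly_ext[where V="carrier (res0 A)"])
  have 1: "G\<pi> (Gs p) = p" if "p \<in> carrier (res0 A)" for p
  proof (rule alg_hom_poly_ext[where V="carrier A"])
    show "alg_hom (free_alg A) (res0 A) (\<lambda>p. G\<pi> (Gs p))"
      using alg_hom_comp[OF Gs(1) G\<pi>(1)] by (simp add: res0_def)
    show "alg_hom (free_alg A) (res0 A) (\<lambda>p. p)" by (simp add: alg_hom_def ring_hom_def res0_def)
    show "G\<pi> (Gs (poly_var a)) = poly_var a" if "a \<in> carrier A" for a
      using Gs(2)[OF that] G\<pi>(2)[OF s_closed[OF that]] \<pi>_s[OF that] by simp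
    show "p \<in> carrier (free_alg A)" using that by (simp add: res0_def)
  qed
  show "alg_hom (free_alg (res0 A)) (res1 A) (\<lambda>p. GG\<pi> (GGs p))"
    using alg_hom_comp[OF GGs(1) GG\<pi>(1)] by (simp add: res1_def)
  show "alg_hom (free_alg (res0 A)) (res1 A) (\<lambda>p. p)" by (simp add: alg_hom_def ring_hom_def res1_def)
  show "GG\<pi> (GGs (poly_var a)) = poly_var a" if "a \<in> carrier (res0 A)" for a
    using GGs(2)[OF that] GG\<pi>(2)[OF alg_homD(3)[OF Gs(1) that]] 1[OF that] by simp
  show "q \<in> carrier (res1 A) \<Longrightarrow> q \<in> carrier (free_alg (res0 A))" by (simp add: res1_def)
qed

text \<open>Coboundary of a 1-cochain in the standard resolution of \<open>R\<close>, with values in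
  \<open>A\<close> through \<pi>; such a cochain is a function on \<open>carrier GR\<close>.\<close>

abbreviation "cob k r \<equiv> der_ext A e2 k r \<ominus> k (counit GR r) \<oplus> k (Gd r)"

section \<open>Primitives over R: construction, descent, modification\<close>

context
  fixes g assumes g: "\<And>q. q \<in> carrier (res1 A) \<Longrightarrow> g q \<in> carrier A"
begin

text \<open>The cochains on \<open>R\<close> whose coboundary is the pull-back of \<open>g\<close>.\<close>

definition "lifts H \<longleftrightarrow> (\<forall>p\<in>carrier GR. H p \<in> carrier A) \<and> (\<forall>r\<in>carrier GGR. cob H r = g (GG\<pi> r))"

text \<open>The cocycle identity of \<open>g\<close> is evaluated at \<open>GG\<tau> r\<close>. By
  naturality its four terms are the derivation of the new cochain at \<open>r\<close>, the values of
  this cochain at \<open>counit GR r\<close> and \<open>Gd r\<close>, and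
  \<open>g (GG\<pi> r)\<close>.\<close>

lemma lifts_start:
  assumes "\<And>r. r \<in> carrier (res2 A) \<Longrightarrow> cobnd2 g r = \<zero>"
  shows "lifts (\<lambda>p. g (G\<tau> p))"
  unfolding lifts_def
proof (intro conjI ballI)
  have gt: "g (G\<tau> p) \<in> carrier A" if "p \<in> carrier GR" for p using g alg_homD(3)[OF G\<tau>(1) that] by blast
  then show "g (G\<tau> p) \<in> carrier A" if "p \<in> carrier GR" for p using that .
  fix r assume r: "r \<in> carrier GGR"
  let ?r = "GG\<tau> r"
  have r2: "?r \<in> carrier (res2 A)" by (rule alg_homD(3)[OF GG\<tau>(1) r])
  have nat1: "counit (res1 A) ?r = G\<tau> (counit GR r)"
    unfolding GG\<tau>_def by (rule counit_natural[OF calgs(2) res_calg(2) G\<tau>(1) r])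
  have nat0: "counit (res0 A) (G\<tau> p) = \<tau> (d p)" if "p \<in> carrier GR" for p
    unfolding G\<tau>_def by (rule counit_natural[OF calgs(1) res_calg(1) \<tau>(1) that])
  \<comment> \<open>Here \<open>aug0 A (\<tau> x) = \<pi> x\<close> enters: the face that applies
    the augmentation undoes \<tau> and leaves the pull-back along \<pi>.\<close>
  have aug: "free_alg_map A (aug0 A) (G\<tau> p) = G\<pi> p" if p: "p \<in> carrier GR" for p
    unfolding G\<tau>_def G\<pi>_def
    by (rule free_alg_map_comp[OF calg_axioms res_calg(1) _ _ _ p])
       (use alg_homD(3)[OF \<tau>(1)] alg_homD(3)[OF aug0] aug0_\<tau> in auto)
  have f1: "free_alg_map (res0 A) (counit (res0 A)) ?r = free_alg_map (res0 A) (\<lambda>p. \<tau> (d p)) r"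
    unfolding GG\<tau>_def
    by (rule free_alg_map_comp[OF res_calg(1) res_calg(2) _ _ _ r])
       (use alg_homD(3)[OF G\<tau>(1)] alg_homD(3)[OF counit_res(1)] nat0 in auto)
  have f1': "G\<tau> (Gd r) = free_alg_map (res0 A) (\<lambda>p. \<tau> (d p)) r"
    unfolding G\<tau>_def Gd_def
    by (rule free_alg_map_comp[OF res_calg(1) calgs(1) _ _ _ r])
       (use alg_homD(3)[OF d(1)] alg_homD(3)[OF \<tau>(1)] in auto)
  have f2: "free_alg_map (res0 A) (free_alg_map A (aug0 A)) ?r = GG\<pi> r"
    unfolding GG\<tau>_def GG\<pi>_def
    by (rule free_alg_map_comp[OF res_calg(1) res_calg(2) _ _ _ r])
       (use alg_homD(3)[OF G\<tau>(1)] alg_homD(3)[OF faces1(1)] aug in \<open>auto simp: faces1_def\<close>)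
  have e2t: "aug2 A (GG\<tau> p) = e2 p" if p: "p \<in> carrier GGR" for p
  proof -
    have "counit GR p \<in> carrier GR" "d (counit GR p) \<in> carrier R"
      using alg_homD(3)[OF cGR(1) p] alg_homD(3)[OF d(1)] by auto
    moreover have "counit (res1 A) (GG\<tau> p) = G\<tau> (counit GR p)"
      unfolding GG\<tau>_def by (rule counit_natural[OF calgs(2) res_calg(2) G\<tau>(1) p])
    ultimately show ?thesis
      by (simp add: aug2_def aug1_def e2_def nat0 aug0_\<tau>)
  qed
  have D: "derivation (res2 A) AA (aug2 A) (der_ext A (aug2 A) g)"
    using der_ext(1)[OF calg_axioms aug2[unfolded res2_def] g] unfolding res2_def .
  have D2: "derivation GGR AA e2 (\<lambda>p. der_ext A (aug2 A) g (GG\<tau> p))"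
    by (rule derivation_cong[OF derivation_comp_alg_hom[OF D GG\<tau>(1) calgs(3)] calgs(3) e2t refl])
  have "der_ext A (aug2 A) g ?r = der_ext A e2 (\<lambda>p. g (G\<tau> p)) r"
  proof (rule der_ext_eqI[OF e2 gt D2 _ r])
    fix p assume p: "p \<in> carrier GR"
    show "der_ext A (aug2 A) g (GG\<tau> (poly_var p)) = g (G\<tau> p)"
      unfolding GG\<tau>(2)[OF p]
      by (rule der_ext(2)[OF calg_axioms aug2[unfolded res2_def] g alg_homD(3)[OF G\<tau>(1) p]])
  qed
  with assms[OF r2] have eq: "der_ext A e2 (\<lambda>p. g (G\<tau> p)) r \<ominus> (g (G\<tau> (counit GR r)) \<ominus> (g (G\<tau> (Gd r)) \<ominus> g (GG\<pi> r))) = \<zero>"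
    by (simp add: nat1 f1 f1' f2)
  have c: "der_ext A e2 (\<lambda>p. g (G\<tau> p)) r \<in> carrier A" "g (G\<tau> (counit GR r)) \<in> carrier A"
    "g (G\<tau> (Gd r)) \<in> carrier A" "g (GG\<pi> r) \<in> carrier A"
    using der_ext_simps(1)[OF e2 gt r r] gt alg_homD(3)[OF cGR(1) r] alg_homD(3)[OF Gd(1) r] g alg_homD(3)[OF GG\<pi>(1) r]
    by auto
  have alg: "x \<ominus> y \<oplus> z = w" if "x \<ominus> (y \<ominus> (z \<ominus> w)) = \<zero>" "x \<in> carrier A" "y \<in> carrier A" "z \<in> carrier A" "w \<in> carrier A" for x y z w
  proof -
    have "x \<ominus> y \<oplus> z = (x \<ominus> (y \<ominus> (z \<ominus> w))) \<oplus> w" using that(2-) by algebra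
    then show ?thesis using that by simp
  qed
  show "cob (\<lambda>p. g (G\<tau> p)) r = g (GG\<pi> r)"
    by (rule alg[OF eq c])
qed

text \<open>Invariance under \<open>ps\<close> says that \<open>H\<close> factors through
  \<open>G\<pi>\<close>, the factor being its composition with \<open>Gs\<close>. Since
  \<open>q\<close> is the image of \<open>GGs q\<close>, the identity defining \<open>lifts\<close>
  at \<open>GGs q\<close> becomes the claim.\<close>

lemma lifts_descend:
  assumes H: "lifts H" and inv: "\<And>p. p \<in> carrier GR \<Longrightarrow> H (ps p) = H p" and q: "q \<in> carrier (res1 A)"
  shows "g q = cobnd1 (\<lambda>p. H (Gs p)) q"
proof -
  define f where "f = (\<lambda>p. H (Gs p))"
  have Hc: "H p \<in> carrier A" if "p \<in> carrier GR" for p using H that by (auto simp: lifts_def)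
  have fc: "f p \<in> carrier A" if "p \<in> carrier (res0 A)" for p
    unfolding f_def by (rule Hc[OF alg_homD(3)[OF Gs(1) that]])
  have fp: "f (G\<pi> p) = H p" if "p \<in> carrier GR" for p
    using inv[OF that] by (simp add: f_def ps_def)
  define r where "r = GGs q"
  have r: "r \<in> carrier GGR" unfolding r_def by (rule alg_homD(3)[OF GGs(1) q])
  have qr: "GG\<pi> r = q" unfolding r_def by (rule GG\<pi>_GGs[OF q])
  have cr: "counit GR r \<in> carrier GR" "Gd r \<in> carrier GR"
    using alg_homD(3)[OF cGR(1) r] alg_homD(3)[OF Gd(1) r] by auto
  have natc: "counit (res0 A) (GG\<pi> p) = G\<pi> (counit GR p)" if "p \<in> carrier GGR" for p
    unfolding GG\<pi>_def by (rule counit_natural[OF calgs(2) res_calg(1) G\<pi>(1) that])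
  have nata: "free_alg_map A (aug0 A) (GG\<pi> r) = free_alg_map A (\<lambda>p. \<pi> (d p)) r"
    unfolding GG\<pi>_def
    by (rule free_alg_map_comp[OF calg_axioms res_calg(1) _ _ _ r])
       (use alg_homD(3)[OF G\<pi>(1)] alg_homD(3)[OF aug0] \<pi>_d in auto)
  have nata': "G\<pi> (Gd r) = free_alg_map A (\<lambda>p. \<pi> (d p)) r"
    unfolding G\<pi>_def Gd_def
    by (rule free_alg_map_comp[OF calg_axioms calgs(1) _ _ _ r])
       (use alg_homD(3)[OF d(1)] \<pi>_closed in auto)
  have e: "aug1 A (GG\<pi> p) = e2 p" if p: "p \<in> carrier GGR" for p
    using natc[OF p] \<pi>_d[OF alg_homD(3)[OF cGR(1) p]] by (simp add: aug1_def e2_def)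
  have D: "derivation (res1 A) AA (aug1 A) (der_ext A (aug1 A) f)"
    using der_ext(1)[OF calg_axioms aug1[unfolded res1_def] fc] unfolding res1_def .
  have D2: "derivation GGR AA e2 (\<lambda>p. der_ext A (aug1 A) f (GG\<pi> p))"
    by (rule derivation_cong[OF derivation_comp_alg_hom[OF D GG\<pi>(1) calgs(3)] calgs(3) e refl])
  have "der_ext A (aug1 A) f (GG\<pi> r) = der_ext A e2 H r"
  proof (rule der_ext_eqI[OF e2 Hc D2 _ r])
    fix p assume p: "p \<in> carrier GR"
    have "der_ext A (aug1 A) f (poly_var (G\<pi> p)) = f (G\<pi> p)"
      by (rule der_ext(2)[OF calg_axioms aug1[unfolded res1_def] fc alg_homD(3)[OF G\<pi>(1) p]])
    then show "der_ext A (aug1 A) f (GG\<pi> (poly_var p)) = H p"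
      using GG\<pi>(2)[OF p] fp[OF p] by simp
  qed
  moreover have "g q = cob H r" using H r qr by (simp add: lifts_def)
  moreover have "H (counit GR r) = f (counit (res0 A) q)" using fp[OF cr(1)] natc[OF r] qr by simp
  moreover have "H (Gd r) = f (free_alg_map A (aug0 A) q)" using fp[OF cr(2)] nata nata' qr by simp
  ultimately have "g q = der_ext A (aug1 A) f q \<ominus> f (counit (res0 A) q) \<oplus> f (free_alg_map A (aug0 A) q)"
    using qr by simp
  also have "\<dots> = cobnd1 f q"
  proof -
    have "x \<ominus> y \<oplus> z = x \<ominus> (y \<ominus> z)" if "x \<in> carrier A" "y \<in> carrier A" "z \<in> carrier A" for x y z
      using that by algebra
    moreover have "der_ext A (aug1 A) f q \<in> carrier A"
      using der_ext_simps(1)[where f=f and p=q and q=q, OF aug1[unfolded res1_def] fc] q by (simp add: res1_def)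
    moreover have "f (counit (res0 A) q) \<in> carrier A" "f (free_alg_map A (aug0 A) q) \<in> carrier A"
      using fc alg_homD(3)[OF faces1(1) q] by (auto simp: faces1_def)
    ultimately show ?thesis by blast
  qed
  finally show ?thesis unfolding f_def .
qed

text \<open>Coboundary of the 0-cochain \<open>f\<close> over \<open>R\<close>, which is a function
  on the variables of \<open>GR\<close>, the elements of \<open>R\<close>.\<close>

abbreviation "der_cobnd f p \<equiv> der_ext A e1 f p \<ominus> f (d p)"

text \<open>The square of the coboundary is zero. The derivation extending
  \<open>der_cobnd f\<close> is the difference of the pull-backs of \<open>der_ext A e1 f\<close>
  along the faces \<open>counit GR\<close> and \<open>Gd\<close>, and the remaining values of
  \<open>f\<close> cancel by \<open>dd\<close>.\<close>

lemma lifts_modify: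
  assumes H: "lifts H" and f: "\<And>x. x \<in> carrier R \<Longrightarrow> f x \<in> carrier A"
  shows "lifts (\<lambda>p. H p \<ominus> der_cobnd f p)"
proof -
  have Hc: "H p \<in> carrier A" if "p \<in> carrier GR" for p using H that by (auto simp: lifts_def)
  note E = der_ext_simps[where f=f, OF e1]
  have gc: "der_cobnd f p \<in> carrier A" if "p \<in> carrier GR" for p
    using E(1)[OF f that that] f alg_homD(3)[OF d(1) that] by auto
  have Kc: "H p \<ominus> der_cobnd f p \<in> carrier A" if "p \<in> carrier GR" for p using Hc gc that by auto
  have D1: "derivation GR AA e1 (der_ext A e1 f)" by (rule der_ext(1)[OF calg_axioms e1 f])
  have Da: "derivation GGR AA e2 (\<lambda>r. der_ext A e1 f (counit GR r))"
    by (rule derivation_cong[OF derivation_comp_alg_hom[OF D1 cGR(1) calgs(3)] calgs(3)]) (auto simp: e1_def e2_def)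
  have Db: "derivation GGR AA e2 (\<lambda>r. der_ext A e1 f (Gd r))"
    by (rule derivation_cong[OF derivation_comp_alg_hom[OF D1 Gd(1) calgs(3)] calgs(3)]) (auto simp: e1_def e2')
  have DH: "derivation GGR AA e2 (der_ext A e2 H)" by (rule der_ext(1)[OF calg_axioms e2 Hc])
  have comb: "derivation GGR AA e2 (\<lambda>r. D r \<ominus> (D' r \<ominus> D'' r))"
    if D: "derivation GGR AA e2 D" "derivation GGR AA e2 D'" "derivation GGR AA e2 D''" for D D' D''
    unfolding derivation_def regular_module_simps
  proof (intro conjI ballI allI)
    fix p q c assume p: "p \<in> carrier GGR" and q: "q \<in> carrier GGR"
    note dp = derivationD[OF D(1) p q, simplified] derivationD[OF D(2) p q, simplified] derivationD[OF D(3) p q, simplified]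
    have qc: "D q \<in> carrier A" "D' q \<in> carrier A" "D'' q \<in> carrier A"
      using derivationD(1)[OF D(1) q q] derivationD(1)[OF D(2) q q] derivationD(1)[OF D(3) q q] by auto
    note ec = alg_homD(3)[OF e2 p] alg_homD(3)[OF e2 q]
    have e0: "e2 (c \<odot>\<^bsub>GGR\<^esub> \<one>\<^bsub>GGR\<^esub>) \<in> carrier A"
      by (rule alg_homD(3)[OF e2]) (simp add: poly_algebra_single)
    show "D p \<ominus> (D' p \<ominus> D'' p) \<in> carrier A" using dp by auto
    show "D (p \<oplus>\<^bsub>GGR\<^esub> q) \<ominus> (D' (p \<oplus>\<^bsub>GGR\<^esub> q) \<ominus> D'' (p \<oplus>\<^bsub>GGR\<^esub> q)) = D p \<ominus> (D' p \<ominus> D'' p) \<oplus> (D q \<ominus> (D' q \<ominus> D'' q))"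
    proof -
      have "x \<oplus> x' \<ominus> (y \<oplus> y' \<ominus> (z \<oplus> z')) = x \<ominus> (y \<ominus> z) \<oplus> (x' \<ominus> (y' \<ominus> z'))"
        if "x \<in> carrier A" "y \<in> carrier A" "z \<in> carrier A" "x' \<in> carrier A" "y' \<in> carrier A" "z' \<in> carrier A" for x y z x' y' z'
        using that by algebra
      then show ?thesis using dp qc by simp
    qed
    show "D (c \<odot>\<^bsub>GGR\<^esub> p) \<ominus> (D' (c \<odot>\<^bsub>GGR\<^esub> p) \<ominus> D'' (c \<odot>\<^bsub>GGR\<^esub> p)) = e2 (c \<odot>\<^bsub>GGR\<^esub> \<one>\<^bsub>GGR\<^esub>) \<otimes> (D p \<ominus> (D' p \<ominus> D'' p))"
    proof -
      have "k \<otimes> x \<ominus> (k \<otimes> y \<ominus> k \<otimes> z) = k \<otimes> (x \<ominus> (y \<ominus> z))"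
        if "x \<in> carrier A" "y \<in> carrier A" "z \<in> carrier A" "k \<in> carrier A" for x y z k
        using that by algebra
      then show ?thesis using dp e0 by simp
    qed
    show "D (p \<otimes>\<^bsub>GGR\<^esub> q) \<ominus> (D' (p \<otimes>\<^bsub>GGR\<^esub> q) \<ominus> D'' (p \<otimes>\<^bsub>GGR\<^esub> q)) =
        e2 p \<otimes> (D q \<ominus> (D' q \<ominus> D'' q)) \<oplus> e2 q \<otimes> (D p \<ominus> (D' p \<ominus> D'' p))"
    proof -
      have "k \<otimes> x' \<oplus> l \<otimes> x \<ominus> (k \<otimes> y' \<oplus> l \<otimes> y \<ominus> (k \<otimes> z' \<oplus> l \<otimes> z)) = k \<otimes> (x' \<ominus> (y' \<ominus> z')) \<oplus> l \<otimes> (x \<ominus> (y \<ominus> z))"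
        if "x \<in> carrier A" "y \<in> carrier A" "z \<in> carrier A" "x' \<in> carrier A" "y' \<in> carrier A" "z' \<in> carrier A" "k \<in> carrier A" "l \<in> carrier A" for x y z x' y' z' k l
        using that by algebra
      then show ?thesis using dp qc ec by simp
    qed
  qed
  show ?thesis unfolding lifts_def
  proof (intro conjI ballI)
    show "H p \<ominus> der_cobnd f p \<in> carrier A" if "p \<in> carrier GR" for p using Kc that .
    fix r assume r: "r \<in> carrier GGR"
    note cr = alg_homD(3)[OF cGR(1) r] alg_homD(3)[OF Gd(1) r]
    have "der_ext A e2 H r \<ominus> (der_ext A e1 f (counit GR r) \<ominus> der_ext A e1 f (Gd r)) = der_ext A e2 (\<lambda>p. H p \<ominus> der_cobnd f p) r"
    proof (rule der_ext_eqI[OF e2 Kc comb[OF DH Da Db] _ r])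
      fix p assume p: "p \<in> carrier GR"
      have "der_ext A e1 f (Gd (poly_var p)) = f (d p)"
        unfolding Gd(2)[OF p] by (rule der_ext(2)[OF calg_axioms e1 f alg_homD(3)[OF d(1) p]])
      then show "der_ext A e2 H (poly_var p) \<ominus> (der_ext A e1 f (counit GR (poly_var p)) \<ominus> der_ext A e1 f (Gd (poly_var p))) = H p \<ominus> der_cobnd f p"
        using der_ext(2)[OF calg_axioms e2 Hc p] cGR(2)[OF p] by simp
    qed
    note eq = this[symmetric]
    have "H (counit GR r) \<in> carrier A" "H (Gd r) \<in> carrier A" "der_ext A e2 H r \<in> carrier A"
      "der_ext A e1 f (counit GR r) \<in> carrier A" "der_ext A e1 f (Gd r) \<in> carrier A" "f (d (Gd r)) \<in> carrier A"
      using Hc cr der_ext_simps(1)[OF e2 Hc r r] E(1)[OF f cr(1) cr(1)] E(1)[OF f cr(2) cr(2)] f alg_homD(3)[OF d(1) cr(2)] by auto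
    moreover have "x \<ominus> (y \<ominus> z) \<ominus> (hc \<ominus> (y \<ominus> w)) \<oplus> (hg \<ominus> (z \<ominus> w)) = x \<ominus> hc \<oplus> hg"
      if "x \<in> carrier A" "y \<in> carrier A" "z \<in> carrier A" "w \<in> carrier A" "hc \<in> carrier A" "hg \<in> carrier A" for x y z w hc hg
      using that by algebra
    ultimately have "cob (\<lambda>p. H p \<ominus> der_cobnd f p) r = cob H r"
      using eq dd[OF r] by simp
    then show "cob (\<lambda>p. H p \<ominus> der_cobnd f p) r = g (GG\<pi> r)" using H r by (simp add: lifts_def)
  qed
qed

end

end

section \<open>The defect of a primitive and its quadratic part\<close>

abbreviation sc :: "complex \<Rightarrow> 'x cpoly \<Rightarrow> 'x cpoly" where
  "sc c p \<equiv> Poly_Mapping.single 0 c * p"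

lemma sc_simps:
  "sc 1 p = p" "sc 0 p = 0" "sc c (p + q) = sc c p + sc c q" "sc c (p - q) = sc c p - sc c q"
  "sc c (sc k p) = sc (c * k) p" "sc (c + k) p = sc c p + sc k p" "sc (- 1) p = - p"
proof -
  show "sc c (sc k p) = sc (c * k) p" by (simp add: mult_single mult.assoc[symmetric])
  show "sc (- 1) p = - p" by (simp add: single_uminus)
qed (simp_all add: algebra_simps single_add)

text \<open>Difference of two instances of the identity in \<open>lifts\<close> with the same
  right-hand side, one at an element and one at its normalization; \<open>w\<close> is a value at
  normal forms, inserted so that the differences on the right become defects.\<close>

lemma cancel_cob:
  fixes a :: "'x :: ab_group_add"
  assumes "a + b - x + y = z" "a' + b' - x' + y' = z"
  shows "x - x' = (a - a' + (b - b')) + (y - w) - (y' - w)"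
proof -
  have "a + b - x + y = a' + b' - x' + y'" using assms by simp
  then show ?thesis by (simp add: algebra_simps)
qed

lemma alg_hom_poly_sum:
  assumes f: "alg_hom (poly_algebra V) (poly_algebra W) f" and "\<And>x. x \<in> X \<Longrightarrow> F x \<in> carrier (poly_algebra V)"
  shows "f (sum F X) = (\<Sum>x\<in>X. f (F x))"
proof -
  have 0: "f 0 = 0" using alg_hom_poly(3)[OF f poly_one_closed poly_one_closed, of 0] by simp
  show ?thesis using assms(2)
    by (induction X rule: infinite_finite_induct)
       (auto simp: 0 alg_hom_poly(1)[OF f] poly_sum_closed)
qed

text \<open>A linear section of \<open>d\<close>: each monomial becomes a variable. In contrast,
  \<open>poly_var\<close> is a section that is not additive.\<close>

definition std_lift :: "'v cpoly \<Rightarrow> 'v cpoly cpoly" where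
  "std_lift x = (\<Sum>m\<in>Poly_Mapping.keys x. sc (Poly_Mapping.lookup x m) (poly_var (Poly_Mapping.single m 1)))"

lemma std_lift_superset:
  assumes "finite K" "Poly_Mapping.keys x \<subseteq> K"
  shows "std_lift x = (\<Sum>m\<in>K. sc (Poly_Mapping.lookup x m) (poly_var (Poly_Mapping.single m 1)))"
  unfolding std_lift_def by (rule sum.mono_neutral_left) (use assms in \<open>auto simp: in_keys_iff\<close>)

lemma lookup_sc: "Poly_Mapping.lookup (sc c p) m = c * Poly_Mapping.lookup p m"
  by (simp add: mult_map_scale_conv_mult[symmetric] Poly_Mapping.map.rep_eq when_def)

lemma std_lift_lin: "std_lift (sc a x + sc b y) = sc a (std_lift x) + sc b (std_lift y)"
proof -
  let ?K = "Poly_Mapping.keys x \<union> Poly_Mapping.keys y"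
  have "std_lift (sc a x + sc b y) = (\<Sum>m\<in>?K. sc (Poly_Mapping.lookup (sc a x + sc b y) m) (poly_var (Poly_Mapping.single m 1)))"
    by (rule std_lift_superset) (auto simp: in_keys_iff lookup_add lookup_sc)
  also have "\<dots> = (\<Sum>m\<in>?K. sc a (sc (Poly_Mapping.lookup x m) (poly_var (Poly_Mapping.single m 1))) +
      sc b (sc (Poly_Mapping.lookup y m) (poly_var (Poly_Mapping.single m 1))))"
    by (rule sum.cong) (auto simp: lookup_add lookup_sc sc_simps)
  also have "\<dots> = sc a (std_lift x) + sc b (std_lift y)"
    by (simp add: std_lift_superset[of ?K x] std_lift_superset[of ?K y] sum.distrib sum_distrib_left)
  finally show ?thesis .
qed

lemma poly_sum_monomials: "(\<Sum>m\<in>Poly_Mapping.keys x. sc (Poly_Mapping.lookup x m) (Poly_Mapping.single m 1)) = x"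
  by (rule poly_mapping_eqI) (auto simp: lookup_sum lookup_single mult_single when_def in_keys_iff if_distrib cong: if_cong)

context poly_presentation
begin

definition "nf x = s (\<pi> x)"

lemma s_minus: "a \<in> carrier A \<Longrightarrow> b \<in> carrier A \<Longrightarrow> s (a \<ominus> b) = s a - s b"
  using s_add[of "a \<ominus> b" b] by (simp add: minus_eq a_assoc l_neg)

lemma s_act: "x \<in> carrier R \<Longrightarrow> a \<in> carrier A \<Longrightarrow> s (\<pi> x \<otimes> a) = nf (x * s a)"
  using alg_homD(5)[OF \<pi>, of x "s a"] s_closed[of a] \<pi>_s[of a] by (simp add: nf_def)

lemma s_inject: "a \<in> carrier A \<Longrightarrow> b \<in> carrier A \<Longrightarrow> s a = s b \<Longrightarrow> a = b"
  using \<pi>_s by metis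

lemma nf_closed: "x \<in> carrier R \<Longrightarrow> nf x \<in> carrier R"
  by (simp add: nf_def s_closed \<pi>_closed)

lemma nf_add: "x \<in> carrier R \<Longrightarrow> y \<in> carrier R \<Longrightarrow> nf (x + y) = nf x + nf y"
  using alg_homD(4)[OF \<pi>] by (simp add: nf_def s_add \<pi>_closed)

lemma nf_sc: "x \<in> carrier R \<Longrightarrow> nf (sc c x) = sc c (nf x)"
  using alg_homD(2)[OF \<pi>] by (simp add: nf_def s_smult \<pi>_closed)

lemma nf_zero: "nf 0 = 0"
  using nf_sc[OF poly_zero_closed, of 0] by simp

lemma nf_minus: "x \<in> carrier R \<Longrightarrow> y \<in> carrier R \<Longrightarrow> nf (x - y) = nf x - nf y"
  using nf_add[OF poly_minus_closed, of x y y] by simp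

lemma nf_nf: "x \<in> carrier R \<Longrightarrow> nf (nf x) = nf x"
  by (simp add: nf_def \<pi>_s \<pi>_closed)

lemma \<pi>_nf: "x \<in> carrier R \<Longrightarrow> \<pi> (nf x) = \<pi> x"
  by (simp add: nf_def \<pi>_s \<pi>_closed)

lemma nf_s: "a \<in> carrier A \<Longrightarrow> nf (s a) = s a"
  by (simp add: nf_def \<pi>_s)

lemma nf_mult_nf: "x \<in> carrier R \<Longrightarrow> y \<in> carrier R \<Longrightarrow> nf (x * nf y) = nf (x * y)"
  using alg_homD(5)[OF \<pi>, of x y] alg_homD(5)[OF \<pi>, of x "nf y"] nf_closed[of y] \<pi>_nf[of y] by (simp add: nf_def)

lemma nf_mult_cong: "x \<in> carrier R \<Longrightarrow> x' \<in> carrier R \<Longrightarrow> y \<in> carrier R \<Longrightarrow> nf x = nf x' \<Longrightarrow> nf (x * y) = nf (x' * y)"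
  using nf_mult_nf[of y x] nf_mult_nf[of y x'] by (simp add: mult.commute)

lemma nf_sum: "(\<And>x. x \<in> X \<Longrightarrow> F x \<in> carrier R) \<Longrightarrow> nf (sum F X) = (\<Sum>x\<in>X. nf (F x))"
  by (induction X rule: infinite_finite_induct) (auto simp: nf_zero nf_add poly_sum_closed)

lemma nf_d_ps: "p \<in> carrier GR \<Longrightarrow> nf (d (ps p)) = nf (d p)"
  using \<pi>_d[of p] \<pi>_d[of "ps p"] G\<pi>_ps[of p] alg_homD(3)[OF ps(1), of p] by (simp add: nf_def)

lemmas d_poly = alg_hom_poly[OF d(1)]
lemmas ps_poly = alg_hom_poly[OF ps(1)]
lemma d_closed: "p \<in> carrier GR \<Longrightarrow> d p \<in> carrier R" by (rule d_poly(4))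
lemma ps_closed: "p \<in> carrier GR \<Longrightarrow> ps p \<in> carrier GR" by (rule ps_poly(4))
lemma d_sc: "p \<in> carrier GR \<Longrightarrow> d (sc c p) = sc c (d p)" by (rule d_poly(3))
lemma ps_sc: "p \<in> carrier GR \<Longrightarrow> ps (sc c p) = sc c (ps p)" by (rule ps_poly(3))
lemma d_sc_var: "x \<in> carrier R \<Longrightarrow> d (sc c (poly_var x)) = sc c x" by (simp add: d_sc poly_var_closed d(2))
lemma ps_sc_var: "x \<in> carrier R \<Longrightarrow> ps (sc c (poly_var x)) = sc c (poly_var (s (\<pi> x)))" by (simp add: ps_sc poly_var_closed ps(2))

lemma std_lift_closed: "x \<in> carrier R \<Longrightarrow> std_lift x \<in> carrier GR"
  unfolding std_lift_def
  by (intro poly_sum_closed poly_smult_closed poly_var_closed poly_algebra_single) (auto simp: poly_algebra_carrier)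

lemma single_closed: "x \<in> carrier R \<Longrightarrow> m \<in> Poly_Mapping.keys x \<Longrightarrow> Poly_Mapping.single m c \<in> carrier R"
  by (rule poly_algebra_single) (auto simp: poly_algebra_carrier)

lemma d_std_lift: "x \<in> carrier R \<Longrightarrow> d (std_lift x) = x"
proof -
  assume x: "x \<in> carrier R"
  have "d (std_lift x) = (\<Sum>m\<in>Poly_Mapping.keys x. d (sc (Poly_Mapping.lookup x m) (poly_var (Poly_Mapping.single m 1))))"
    unfolding std_lift_def
    by (rule alg_hom_poly_sum[OF d(1)]) (intro poly_smult_closed poly_var_closed single_closed[OF x])
  also have "\<dots> = (\<Sum>m\<in>Poly_Mapping.keys x. sc (Poly_Mapping.lookup x m) (Poly_Mapping.single m 1))"
    by (intro sum.cong refl) (rule d_sc_var[OF single_closed[OF x]])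
  finally show ?thesis using poly_sum_monomials[of x] by simp
qed

lemma ps_std_lift:
  assumes x: "x \<in> carrier R"
  shows "ps (std_lift x) = (\<Sum>m\<in>Poly_Mapping.keys x. sc (Poly_Mapping.lookup x m) (poly_var (nf (Poly_Mapping.single m 1))))"
proof -
  have "ps (std_lift x) = (\<Sum>m\<in>Poly_Mapping.keys x. ps (sc (Poly_Mapping.lookup x m) (poly_var (Poly_Mapping.single m 1))))"
    unfolding std_lift_def
    by (rule alg_hom_poly_sum[OF ps(1)]) (intro poly_smult_closed poly_var_closed single_closed[OF x])
  also have "\<dots> = (\<Sum>m\<in>Poly_Mapping.keys x. sc (Poly_Mapping.lookup x m) (poly_var (nf (Poly_Mapping.single m 1))))"
    by (intro sum.cong refl) (simp only: ps_sc_var[OF single_closed[OF x]] nf_def)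
  finally show ?thesis .
qed

text \<open>A normal form is a combination of monomials that are normal forms themselves, by
  \<open>s_std\<close>, so replacing each of them by its normal form changes nothing.\<close>

lemma ps_std_lift_nf:
  assumes x: "x \<in> carrier R"
  shows "ps (std_lift (nf x)) = std_lift (nf x)"
  unfolding ps_std_lift[OF nf_closed[OF x]] unfolding std_lift_def
  by (intro sum.cong refl) (simp add: nf_def[of "Poly_Mapping.single _ _"] s_std[OF \<pi>_closed[OF x]] nf_def[of x])

lemma d_ps_std_lift:
  assumes x: "x \<in> carrier R"
  shows "d (ps (std_lift x)) = nf x"
proof -
  have "d (ps (std_lift x)) = (\<Sum>m\<in>Poly_Mapping.keys x. d (sc (Poly_Mapping.lookup x m) (poly_var (nf (Poly_Mapping.single m 1)))))"
    unfolding ps_std_lift[OF x]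
    by (rule alg_hom_poly_sum[OF d(1)]) (intro poly_smult_closed poly_var_closed nf_closed single_closed[OF x])
  also have "\<dots> = (\<Sum>m\<in>Poly_Mapping.keys x. nf (sc (Poly_Mapping.lookup x m) (Poly_Mapping.single m 1)))"
    by (intro sum.cong refl)
       (simp only: d_sc_var[OF nf_closed[OF single_closed[OF x]]] nf_sc[OF single_closed[OF x]])
  also have "\<dots> = nf (\<Sum>m\<in>Poly_Mapping.keys x. sc (Poly_Mapping.lookup x m) (Poly_Mapping.single m 1))"
    by (rule nf_sum[symmetric]) (intro poly_smult_closed single_closed[OF x])
  finally show ?thesis using poly_sum_monomials[of x] by simp
qed

text \<open>\<open>H\<close> descends to \<open>A\<close> iff its defect vanishes.\<close>

definition "defect H p = s (H p) - s (H (ps p))"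

text \<open>Once the defect is linear, vanishing on products of two variables forces it to vanish
  altogether; this is the map from which the cocycle \<beta> arises.\<close>

definition "quad_part H x y = defect H (poly_var x * poly_var y)"

definition "sD f p = s (der_ext A e1 f p)"

context
  fixes f assumes f: "\<And>x. x \<in> carrier R \<Longrightarrow> f x \<in> carrier A"
begin

lemmas der_e1 = der_ext_simps[where f=f, OF e1 f]

lemma sD_simps:
  assumes "p \<in> carrier GR" "q \<in> carrier GR"
  shows "sD f (p + q) = sD f p + sD f q" "sD f (sc c p) = sc c (sD f p)"
    "sD f (p * q) = nf (d p * sD f q) + nf (d q * sD f p)"
    and "x \<in> carrier R \<Longrightarrow> sD f (poly_var x) = s (f x)"
proof -
  note c = der_e1(1)[OF _ assms(1) assms(1)] der_e1(1)[OF _ assms(2) assms(2)]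
  show "sD f (p + q) = sD f p + sD f q"
    using der_e1(2)[OF _ assms] c by (simp add: sD_def s_add)
  show "sD f (sc c p) = sc c (sD f p)"
    using der_e1(4)[OF _ assms, where c=c] c by (simp add: sD_def s_smult)
  show "sD f (p * q) = nf (d p * sD f q) + nf (d q * sD f p)"
    using der_e1(3)[OF _ assms] c d_poly(4)[OF assms(1) assms(1)] d_poly(4)[OF assms(2) assms(2)]
    by (simp add: sD_def s_add e1_def s_act \<pi>_closed)
  show "x \<in> carrier R \<Longrightarrow> sD f (poly_var x) = s (f x)"
    using der_ext(2)[where f=f, OF calg_axioms e1 f] by (simp add: sD_def)
qed

lemma sD_sc_var: "x \<in> carrier R \<Longrightarrow> sD f (sc c (poly_var x)) = sc c (s (f x))"
  using sD_simps(2)[OF poly_var_closed poly_var_closed] sD_simps(4)[OF poly_zero_closed poly_zero_closed] by simp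

lemma sD_sum:
  assumes "\<And>x. x \<in> X \<Longrightarrow> F x \<in> carrier GR"
  shows "sD f (sum F X) = (\<Sum>x\<in>X. sD f (F x))"
proof -
  have 0: "sD f 0 = 0" using sD_simps(2)[OF poly_zero_closed poly_zero_closed, of 0] by simp
  show ?thesis using assms
    by (induction X rule: infinite_finite_induct) (auto simp: 0 sD_simps(1) poly_sum_closed)
qed

lemma defect_modify:
  assumes "H p \<in> carrier A" "H (ps p) \<in> carrier A" and p: "p \<in> carrier GR"
  shows "defect (\<lambda>p. H p \<ominus> der_cobnd f p) p = defect H p - (sD f p - s (f (d p))) + (sD f (ps p) - s (f (d (ps p))))"
proof -
  note pp = ps_poly(4)[OF p p]
  show ?thesis
    using assms(1,2) der_e1(1)[OF _ p p] der_e1(1)[OF _ pp pp] f d_poly(4)[OF p p] d_poly(4)[OF pp pp]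
    by (simp add: defect_def sD_def s_minus)
qed

end

context
  fixes g H assumes g: "\<And>q. q \<in> carrier (res1 A) \<Longrightarrow> g q \<in> carrier A" and H: "lifts g H"
begin

lemma H_closed: "p \<in> carrier GR \<Longrightarrow> H p \<in> carrier A"
  using H by (simp add: lifts_def[OF g])

lemma defect_closed: "p \<in> carrier GR \<Longrightarrow> defect H p \<in> carrier R" "p \<in> carrier GR \<Longrightarrow> nf (defect H p) = defect H p"
  using H_closed ps_poly(4) by (auto simp: defect_def poly_minus_closed s_closed nf_minus nf_s)

lemma s_cob: "r \<in> carrier GGR \<Longrightarrow>
    s (der_ext A e2 H r) - s (H (counit GR r)) + s (H (Gd r)) = s (g (GG\<pi> r))"
proof -
  assume r: "r \<in> carrier GGR"
  have "der_ext A e2 H r \<in> carrier A" "H (counit GR r) \<in> carrier A" "H (Gd r) \<in> carrier A"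
    using der_ext_simps(1)[where f=H, OF e2 _ r r] H_closed alg_homD(3)[OF cGR(1) r] alg_homD(3)[OF Gd(1) r] by auto
  moreover have "cob H r = g (GG\<pi> r)" using H r by (simp add: lifts_def[OF g])
  ultimately show ?thesis
    using s_add[of "der_ext A e2 H r \<ominus> H (counit GR r)" "H (Gd r)"] by (simp add: s_minus)
qed

text \<open>The identity in \<open>lifts\<close> at \<open>a [q1] + b [q2]\<close>, brackets
  denoting variables, minus the one at \<open>a [ps q1] + b [ps q2]\<close>. Both arguments have the
  same image under \<open>GG\<pi>\<close>, so \<open>g\<close> drops out.\<close>

lemma defect_lin:
  assumes q: "q1 \<in> carrier GR" "q2 \<in> carrier GR"
  shows "defect H (sc a q1 + sc b q2) = sc a (defect H q1) + sc b (defect H q2)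
    + defect H (sc a (poly_var (d q1)) + sc b (poly_var (d q2)))
    - defect H (sc a (poly_var (d (ps q1))) + sc b (poly_var (d (ps q2))))"
proof -
  have eq: "sc a (s (H q1)) + sc b (s (H q2)) - s (H (sc a q1 + sc b q2))
      + s (H (sc a (poly_var (d q1)) + sc b (poly_var (d q2))))
    = s (g (sc a (poly_var (G\<pi> q1)) + sc b (poly_var (G\<pi> q2))))"
    if q: "q1 \<in> carrier GR" "q2 \<in> carrier GR" for q1 q2
  proof -
    let ?r = "sc a (poly_var q1) + sc b (poly_var q2)"
    have v: "poly_var q1 \<in> carrier GGR" "poly_var q2 \<in> carrier GGR" using q by (auto intro: poly_var_closed)
    have sv: "sc a (poly_var q1) \<in> carrier GGR" "sc b (poly_var q2) \<in> carrier GGR" using v by (auto intro: poly_smult_closed)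
    have r: "?r \<in> carrier GGR" using sv by (rule poly_algebra_add)
    note dE = der_ext_simps[where f=H, OF e2 H_closed]
    have D: "der_ext A e2 H ?r = a \<odot> H q1 \<oplus> b \<odot> H q2"
      using dE(2)[OF _ sv] dE(4)[OF _ v(1) v(1), where c=a] dE(4)[OF _ v(2) v(2), where c=b]
        der_ext(2)[where f=H, OF calg_axioms e2 H_closed] q by simp
    have m: "k ?r = sc a (k (poly_var q1)) + sc b (k (poly_var q2))" if "alg_hom GGR (poly_algebra W) k" for k and W :: "'w set"
      using alg_hom_poly[OF that] v sv by simp
    show ?thesis
      using s_cob[OF r] D q H_closed
      by (simp add: m[OF cGR(1)] m[OF Gd(1)] m[OF GG\<pi>(1)[unfolded res1_def]] cGR(2) Gd(2) GG\<pi>(2) s_add s_smult)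
  qed
  note pq = ps_poly(4)[OF q(1) q(1)] ps_poly(4)[OF q(2) q(2)]
  have dq: "d q1 \<in> carrier R" "d q2 \<in> carrier R" "d (ps q1) \<in> carrier R" "d (ps q2) \<in> carrier R"
    using d_poly(4) q pq by blast+
  have pl: "ps (sc a p + sc b p') = sc a (ps p) + sc b (ps p')" if "p \<in> carrier GR" "p' \<in> carrier GR" for p p'
    using ps_poly that by (simp add: poly_smult_closed)
  \<comment> \<open>This normalized value is common to both correction terms, as \<open>ps\<close>
    changes \<open>d q1\<close> and \<open>d q2\<close> only modulo the ideal.\<close>
  let ?W = "s (H (sc a (poly_var (nf (d q1))) + sc b (poly_var (nf (d q2)))))"
  have v: "poly_var (d q1) \<in> carrier GR" "poly_var (d q2) \<in> carrier GR"
    "poly_var (d (ps q1)) \<in> carrier GR" "poly_var (d (ps q2)) \<in> carrier GR"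
    using dq by (auto intro: poly_var_closed)
  have F1: "defect H (sc a (poly_var (d q1)) + sc b (poly_var (d q2))) = s (H (sc a (poly_var (d q1)) + sc b (poly_var (d q2)))) - ?W"
    by (simp only: defect_def pl[OF v(1,2)] ps(2)[OF dq(1)] ps(2)[OF dq(2)] nf_def)
  have F2: "defect H (sc a (poly_var (d (ps q1))) + sc b (poly_var (d (ps q2)))) =
      s (H (sc a (poly_var (d (ps q1))) + sc b (poly_var (d (ps q2))))) - ?W"
    by (simp only: defect_def pl[OF v(3,4)] ps(2)[OF dq(3)] ps(2)[OF dq(4)] nf_def[symmetric] nf_d_ps[OF q(1)] nf_d_ps[OF q(2)])
  have F3: "defect H (sc a q1 + sc b q2) = s (H (sc a q1 + sc b q2)) - s (H (sc a (ps q1) + sc b (ps q2)))"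
    by (simp only: defect_def pl[OF q])
  have F4: "sc a (defect H q1) + sc b (defect H q2) =
      sc a (s (H q1)) - sc a (s (H (ps q1))) + (sc b (s (H q2)) - sc b (s (H (ps q2))))"
    by (simp only: defect_def sc_simps)
  show ?thesis
    unfolding F1 F2 F3 F4
    by (rule cancel_cob[OF eq[OF q] eq[OF pq, unfolded G\<pi>_ps[OF q(1)] G\<pi>_ps[OF q(2)]]])
qed

text \<open>The same subtraction for \<open>[q1] [q2]\<close>. The derivation now contributes the
  Leibniz terms, in which \<open>d (ps q)\<close> may be replaced by \<open>d q\<close> because both
  act alike on \<open>A\<close>.\<close>

lemma defect_mult:
  assumes q: "q1 \<in> carrier GR" "q2 \<in> carrier GR"
  shows "defect H (q1 * q2) = nf (d q1 * defect H q2) + nf (d q2 * defect H q1)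
    + defect H (poly_var (d q1) * poly_var (d q2)) - defect H (poly_var (d (ps q1)) * poly_var (d (ps q2)))"
proof -
  have eq: "nf (d q1 * s (H q2)) + nf (d q2 * s (H q1)) - s (H (q1 * q2))
      + s (H (poly_var (d q1) * poly_var (d q2)))
    = s (g (poly_var (G\<pi> q1) * poly_var (G\<pi> q2)))"
    if q: "q1 \<in> carrier GR" "q2 \<in> carrier GR" for q1 q2
  proof -
    let ?r = "poly_var q1 * poly_var q2"
    have v: "poly_var q1 \<in> carrier GGR" "poly_var q2 \<in> carrier GGR" using q by (auto intro: poly_var_closed)
    have r: "?r \<in> carrier GGR" using v by (rule poly_algebra_mult)
    note dE = der_ext_simps[where f=H, OF e2 H_closed]
    have D: "der_ext A e2 H ?r = \<pi> (d q1) \<otimes> H q2 \<oplus> \<pi> (d q2) \<otimes> H q1"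
      using dE(3)[OF _ v] der_ext(2)[where f=H, OF calg_axioms e2 H_closed] q by (simp add: e2_def cGR(2))
    have m: "k ?r = k (poly_var q1) * k (poly_var q2)" if "alg_hom GGR (poly_algebra W) k" for k and W :: "'w set"
      using alg_hom_poly[OF that] v by simp
    show ?thesis
      using s_cob[OF r] D q H_closed d_poly(4)[OF q(1) q(1)] d_poly(4)[OF q(2) q(2)]
      by (simp add: m[OF cGR(1)] m[OF Gd(1)] m[OF GG\<pi>(1)[unfolded res1_def]] cGR(2) Gd(2) GG\<pi>(2) s_add s_act \<pi>_closed)
  qed
  note pq = ps_poly(4)[OF q(1) q(1)] ps_poly(4)[OF q(2) q(2)]
  have dq: "d q1 \<in> carrier R" "d q2 \<in> carrier R" "d (ps q1) \<in> carrier R" "d (ps q2) \<in> carrier R"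
    using d_poly(4) q pq by blast+
  have sH: "s (H p) \<in> carrier R" if "p \<in> carrier GR" for p using s_closed H_closed that by blast
  have c: "nf (d (ps q1) * s (H (ps q2))) = nf (d q1 * s (H (ps q2)))"
    "nf (d (ps q2) * s (H (ps q1))) = nf (d q2 * s (H (ps q1)))"
    by (rule nf_mult_cong; use dq sH pq nf_d_ps q in blast)+
  have n: "nf (d q1 * defect H q2) = nf (d q1 * s (H q2)) - nf (d q1 * s (H (ps q2)))"
    "nf (d q2 * defect H q1) = nf (d q2 * s (H q1)) - nf (d q2 * s (H (ps q1)))"
    unfolding defect_def right_diff_distrib using dq sH pq q by (simp_all add: nf_minus poly_algebra_mult)
  let ?W = "s (H (poly_var (nf (d q1)) * poly_var (nf (d q2))))"
  have v: "poly_var (d q1) \<in> carrier GR" "poly_var (d q2) \<in> carrier GR"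
    "poly_var (d (ps q1)) \<in> carrier GR" "poly_var (d (ps q2)) \<in> carrier GR"
    using dq by (auto intro: poly_var_closed)
  have F1: "defect H (poly_var (d q1) * poly_var (d q2)) = s (H (poly_var (d q1) * poly_var (d q2))) - ?W"
    by (simp only: defect_def ps_poly(2)[OF v(1,2)] ps(2)[OF dq(1)] ps(2)[OF dq(2)] nf_def)
  have F2: "defect H (poly_var (d (ps q1)) * poly_var (d (ps q2))) =
      s (H (poly_var (d (ps q1)) * poly_var (d (ps q2)))) - ?W"
    by (simp only: defect_def ps_poly(2)[OF v(3,4)] ps(2)[OF dq(3)] ps(2)[OF dq(4)] nf_def[symmetric] nf_d_ps[OF q(1)] nf_d_ps[OF q(2)])
  have F3: "defect H (q1 * q2) = s (H (q1 * q2)) - s (H (ps q1 * ps q2))"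
    by (simp only: defect_def ps_poly(2)[OF q])
  have F4: "nf (d q1 * defect H q2) + nf (d q2 * defect H q1) =
      nf (d q1 * s (H q2)) - nf (d q1 * s (H (ps q2))) + (nf (d q2 * s (H q1)) - nf (d q2 * s (H (ps q1))))"
    by (simp only: n)
  show ?thesis
    unfolding F1 F2 F3 F4
    by (rule cancel_cob[OF eq[OF q] eq[OF pq, unfolded G\<pi>_ps[OF q(1)] G\<pi>_ps[OF q(2)] c]])
qed

lemma defect_one: "defect H 1 = 0"
  using alg_homD(6)[OF ps(1)] by (simp add: defect_def)

lemma defect_var:
  assumes x: "x \<in> carrier R"
  shows "defect H (poly_var x) = 0"
proof -
  have v: "poly_var x \<in> carrier GR" using x by (rule poly_var_closed)
  \<comment> \<open>With coefficients 1 and 0 the rule has the same defect on both sides and leaves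
    the difference of the defects at the variables of \<open>x\<close> and of its normal
    form.\<close>
  have "defect H (poly_var x) = defect H (poly_var (nf x))"
    using defect_lin[OF v v, of 1 0] x by (simp add: sc_simps d(2) ps(2) nf_closed nf_def[symmetric])
  also have "\<dots> = 0"
    using x by (simp add: defect_def ps(2) nf_closed nf_def[symmetric] nf_nf)
  finally show ?thesis .
qed

text \<open>The correcting 0-cochain \<open>f\<close> is minus the defect at standard lifts. Its
  derivation contributes nothing there: \<open>f\<close> is zero at monomials by
  \<open>defect_var\<close>, and zero at normal forms because their standard lifts are fixed by
  \<open>ps\<close>. What remains is \<open>f x\<close> itself, which cancels the defect.\<close>

lemma lifts_std_linear: "\<exists>H'. lifts g H' \<and> (\<forall>x\<in>carrier R. defect H' (std_lift x) = 0)"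
proof -
  define f where "f x = H (ps (std_lift x)) \<ominus> H (std_lift x)" for x
  have fc: "f x \<in> carrier A" if "x \<in> carrier R" for x
    using H_closed ps_closed std_lift_closed that by (auto simp: f_def)
  have sf: "s (f x) = - defect H (std_lift x)" if "x \<in> carrier R" for x
    using H_closed ps_closed std_lift_closed that by (auto simp: f_def defect_def s_minus)
  have f_nf: "s (f (nf x)) = 0" if "x \<in> carrier R" for x
    using sf[OF nf_closed[OF that]] ps_std_lift_nf[OF that] by (simp add: defect_def)
  have f_mon: "s (f (Poly_Mapping.single m 1)) = 0" if "Poly_Mapping.single m 1 \<in> carrier R" for m
  proof -
    have "std_lift (Poly_Mapping.single m 1) = poly_var (Poly_Mapping.single m 1)"
      by (simp add: std_lift_def)
    then show ?thesis using sf[OF that] defect_var[OF that] by simp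
  qed
  let ?H = "\<lambda>p. H p \<ominus> der_cobnd f p"
  have L: "lifts g ?H" by (rule lifts_modify[OF g H fc])
  have zero: "defect ?H (std_lift x) = 0" if x: "x \<in> carrier R" for x
  proof -
    note l = std_lift_closed[OF x]
    have "sD f (std_lift x) = 0"
      unfolding std_lift_def
      by (subst sD_sum[where f=f, OF fc])
         (auto intro!: poly_smult_closed poly_var_closed single_closed[OF x] sum.neutral
            simp: sD_sc_var[where f=f, OF fc] single_closed[OF x] f_mon)
    moreover have "sD f (ps (std_lift x)) = 0"
      unfolding ps_std_lift[OF x]
      by (subst sD_sum[where f=f, OF fc])
         (auto intro!: poly_smult_closed poly_var_closed nf_closed single_closed[OF x] sum.neutral
            simp: sD_sc_var[where f=f, OF fc] nf_closed single_closed[OF x] f_nf)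
    ultimately show ?thesis
      using defect_modify[where f=f, OF fc H_closed[OF l] H_closed[OF ps_poly(4)[OF l l]] l] sf[OF x] f_nf[OF x]
      by (simp add: d_std_lift[OF x] d_ps_std_lift[OF x])
  qed
  show ?thesis
    using L zero by blast
qed

text \<open>\<open>defect_lin\<close> is applied to the standard lifts of \<open>x\<close> and
  \<open>y\<close>: by linearity of \<open>std_lift\<close> all other terms are defects at standard
  lifts or at normal forms, hence zero.\<close>

lemma defect_lin0:
  assumes z: "\<And>x. x \<in> carrier R \<Longrightarrow> defect H (std_lift x) = 0" and x: "x \<in> carrier R" and y: "y \<in> carrier R"
  shows "defect H (sc a (poly_var x) + sc b (poly_var y)) = 0"
proof -
  have "sc a x + sc b y \<in> carrier R" using x y by (intro poly_algebra_add poly_smult_closed)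
  moreover have "ps (sc a (poly_var (nf x)) + sc b (poly_var (nf y))) = sc a (poly_var (nf x)) + sc b (poly_var (nf y))"
    using x y nf_closed
    by (simp add: ps_poly(1) poly_smult_closed poly_var_closed ps_sc_var nf_def[symmetric] nf_nf)
  ultimately show ?thesis
    using defect_lin[OF std_lift_closed[OF x] std_lift_closed[OF y], of a b] z x y
    by (simp add: std_lift_lin[symmetric] d_std_lift d_ps_std_lift defect_def[of _ "sc a (poly_var (nf x)) + sc b (poly_var (nf y))"])
qed

context
  assumes lin0: "\<And>a b x y. x \<in> carrier R \<Longrightarrow> y \<in> carrier R \<Longrightarrow> defect H (sc a (poly_var x) + sc b (poly_var y)) = 0"
begin

lemma defect_linear:
  assumes "p \<in> carrier GR" "q \<in> carrier GR"
  shows "defect H (sc a p + sc b q) = sc a (defect H p) + sc b (defect H q)"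
  using defect_lin[OF assms, of a b] lin0 d_closed ps_closed assms by simp

lemma defect_add: "p \<in> carrier GR \<Longrightarrow> q \<in> carrier GR \<Longrightarrow> defect H (p + q) = defect H p + defect H q"
  using defect_linear[of p q 1 1] by (simp add: sc_simps)

lemma defect_sc: "p \<in> carrier GR \<Longrightarrow> defect H (sc a p) = sc a (defect H p)"
  using defect_linear[of p p a 0] by (simp add: sc_simps)

abbreviation (input) "B \<equiv> quad_part H"

lemma var_mult_closed: "x \<in> carrier R \<Longrightarrow> y \<in> carrier R \<Longrightarrow> poly_var x * poly_var y \<in> carrier GR"
  by (intro poly_algebra_mult poly_var_closed)

lemma B_closed: "x \<in> carrier R \<Longrightarrow> y \<in> carrier R \<Longrightarrow> B x y \<in> carrier R"
  "x \<in> carrier R \<Longrightarrow> y \<in> carrier R \<Longrightarrow> nf (B x y) = B x y"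
  using defect_closed var_mult_closed by (auto simp: quad_part_def)

lemma B_sym: "B x y = B y x"
  by (simp add: quad_part_def mult.commute)

lemma B_nf: "x \<in> carrier R \<Longrightarrow> y \<in> carrier R \<Longrightarrow> B (nf x) (nf y) = 0"
  by (simp add: quad_part_def defect_def ps_poly(2) poly_var_closed ps(2) nf_closed nf_def[symmetric] nf_nf)

lemma B_mult:
  assumes "p \<in> carrier GR" "q \<in> carrier GR"
  shows "defect H (p * q) = nf (d p * defect H q) + nf (d q * defect H p) + B (d p) (d q) - B (d (ps p)) (d (ps q))"
  using defect_mult[OF assms] by (simp add: quad_part_def)

text \<open>The defect of a product is computed by linearity and by the product rule; the correction
  term has two normal forms as arguments and is zero by \<open>B_nf\<close>. The proof of
  \<open>B_add\<close> follows the same pattern.\<close>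

lemma B_sc:
  assumes x: "x \<in> carrier R" and z: "z \<in> carrier R"
  shows "B (sc c x) z = sc c (B x z)"
proof -
  have v: "sc c (poly_var x) \<in> carrier GR" "poly_var z \<in> carrier GR"
    using x z by (auto intro: poly_smult_closed poly_var_closed)
  have "defect H (sc c (poly_var x) * poly_var z) = sc c (B x z)"
    using defect_sc[OF var_mult_closed[OF x z], of c] by (simp add: quad_part_def mult.assoc)
  moreover have "B (d (ps (sc c (poly_var x)))) (d (ps (poly_var z))) = 0"
    using x z B_nf[OF poly_smult_closed[OF x] z, of c]
    by (simp add: ps_sc_var ps(2) nf_def[symmetric] nf_closed d_sc_var d(2) nf_sc)
  ultimately show ?thesis
    using B_mult[OF v] x z by (simp add: defect_sc poly_var_closed defect_var nf_zero d_sc_var d(2))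
qed

lemma B_add:
  assumes x: "x \<in> carrier R" and y: "y \<in> carrier R" and z: "z \<in> carrier R"
  shows "B (x + y) z = B x z + B y z"
proof -
  have vs: "poly_var x \<in> carrier GR" "poly_var y \<in> carrier GR" "poly_var (nf x) \<in> carrier GR" "poly_var (nf y) \<in> carrier GR"
    using x y nf_closed by (auto intro: poly_var_closed)
  have v: "poly_var x + poly_var y \<in> carrier GR" "poly_var z \<in> carrier GR"
    using vs z by (auto intro: poly_algebra_add poly_var_closed)
  have "defect H ((poly_var x + poly_var y) * poly_var z) = B x z + B y z"
    using defect_add[OF var_mult_closed[OF x z] var_mult_closed[OF y z]] by (simp add: quad_part_def distrib_right)
  moreover have "B (d (ps (poly_var x + poly_var y))) (d (ps (poly_var z))) = 0"
    using x y z B_nf[OF poly_algebra_add[OF x y] z] vs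
    by (simp add: ps_poly(1) d_poly(1) ps(2) nf_def[symmetric] nf_closed d(2) nf_add)
  ultimately show ?thesis
    using B_mult[OF v] x y z vs by (simp add: defect_add poly_var_closed defect_var nf_zero d_poly(1) d(2))
qed

lemma B_zero: "x \<in> carrier R \<Longrightarrow> B x 0 = 0"
  using B_sc[OF poly_zero_closed, of x 0] by (simp add: B_sym)

text \<open>Associativity: the defect of a product of three variables is computed for both
  bracketings. As \<open>nf i = 0\<close>, the terms in which \<open>i\<close> acts on a value, and
  those at normalized arguments, vanish.\<close>

lemma B_cocycle:
  assumes x: "x \<in> carrier R" and y: "y \<in> carrier R" and i: "i \<in> carrier R" "nf i = 0"
  shows "B (x * y) i = nf (x * B y i) + B x (y * i)"
proof -
  have v: "poly_var x \<in> carrier GR" "poly_var y \<in> carrier GR" "poly_var i \<in> carrier GR"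
    "poly_var (nf x) \<in> carrier GR" "poly_var (nf y) \<in> carrier GR" "poly_var 0 \<in> carrier GR"
    using x y i nf_closed poly_zero_closed by (auto intro: poly_var_closed)
  note sim = ps(2) d(2) nf_def[symmetric] nf_closed ps_poly(2) d_poly(2) v var_mult_closed poly_zero_closed nf_zero defect_var
    B_zero poly_algebra_mult
  have "defect H (poly_var x * (poly_var y * poly_var i)) = nf (x * B y i) + B x (y * i)"
    using B_mult[OF v(1) var_mult_closed[OF y i(1)]] x y i by (simp add: sim) (simp add: quad_part_def)
  moreover have "defect H ((poly_var x * poly_var y) * poly_var i) = nf (i * B x y) + B (x * y) i"
    using B_mult[OF var_mult_closed[OF x y] v(3)] x y i by (simp add: sim) (simp add: quad_part_def)
  moreover have "nf (i * B x y) = 0"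
    using nf_mult_cong[OF i(1) poly_zero_closed B_closed(1)[OF x y]] i(2) by (simp add: nf_zero)
  ultimately show ?thesis by (simp add: mult.assoc)
qed

lemma defect_zero:
  assumes quad: "\<And>x y. x \<in> carrier R \<Longrightarrow> y \<in> carrier R \<Longrightarrow> B x y = 0" and p: "p \<in> carrier GR"
  shows "defect H p = 0"
  using p
proof (induction rule: poly_induct)
  case one
  then show ?case by (rule defect_one)
next
  case (var x q)
  then show ?case
    using B_mult[OF poly_var_closed[OF var(1)] var(2)] quad d_closed ps_closed
    by (simp add: defect_var nf_zero poly_var_closed)
next
  case (add p q)
  then show ?case by (simp add: defect_add)
next
  case (smult c q)
  then show ?case by (simp add: defect_sc)
qed

end

end

text \<open>Restricted to \<open>R \<times> I\<close> such a map is the cocycle of an extension of \<open>I\<close> by \<open>A\<close>; the values are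
  normal forms, so \<open>nf (x * b)\<close> is the action of \<open>x\<close> on \<open>b \<in> A\<close>.\<close>

definition "symmetric_cocycle \<beta> \<longleftrightarrow>
    (\<forall>x\<in>carrier R. \<forall>y\<in>carrier R. \<beta> x y \<in> carrier R \<and> nf (\<beta> x y) = \<beta> x y \<and> \<beta> x y = \<beta> y x) \<and>
    (\<forall>x\<in>carrier R. \<forall>y\<in>carrier R. \<forall>z\<in>carrier R. \<beta> (x + y) z = \<beta> x z + \<beta> y z) \<and>
    (\<forall>c. \<forall>x\<in>carrier R. \<forall>y\<in>carrier R. \<beta> (sc c x) y = sc c (\<beta> x y)) \<and>
    (\<forall>x\<in>carrier R. \<forall>y\<in>carrier R. \<forall>i\<in>carrier R. nf i = 0 \<longrightarrow> \<beta> (x * y) i = nf (x * \<beta> y i) + \<beta> x (y * i))"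

text \<open>On \<open>A \<times> I\<close> let \<open>x\<close> act by
  \<open>x (a, i) = (x a + \<beta> x i, x i)\<close>. The last clause says that
  \<open>i \<mapsto> (- \<Lambda> i, i)\<close> is an \<open>R\<close>-linear section of this
  extension.\<close>

definition "splitting \<beta> \<Lambda> \<longleftrightarrow>
    (\<forall>i\<in>carrier R. nf i = 0 \<longrightarrow> \<Lambda> i \<in> carrier R \<and> nf (\<Lambda> i) = \<Lambda> i) \<and>
    (\<forall>i\<in>carrier R. \<forall>j\<in>carrier R. nf i = 0 \<longrightarrow> nf j = 0 \<longrightarrow> \<Lambda> (i + j) = \<Lambda> i + \<Lambda> j) \<and>
    (\<forall>c. \<forall>i\<in>carrier R. nf i = 0 \<longrightarrow> \<Lambda> (sc c i) = sc c (\<Lambda> i)) \<and>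
    (\<forall>x\<in>carrier R. \<forall>i\<in>carrier R. nf i = 0 \<longrightarrow> \<beta> x i = nf (x * \<Lambda> i) - \<Lambda> (x * i))"

text \<open>A splitting of the quadratic part, extended by zero on normal forms, is a 0-cochain over
  \<open>R\<close>; subtracting its coboundary from the primitive removes the quadratic part and
  keeps the defect linear. The primitive is then invariant under \<open>ps\<close> and
  descends.\<close>

theorem T2_trivial:
  assumes split: "\<And>B. symmetric_cocycle B \<Longrightarrow> \<exists>\<Lambda>. splitting B \<Lambda>"
  shows "carrier (T2 A) = {\<zero>\<^bsub>T2 A\<^esub>}"
proof (rule T2_trivialI)
  fix g assume g: "\<And>q. q \<in> carrier (res1 A) \<Longrightarrow> g q \<in> carrier A"
    and cocycle: "\<And>r. r \<in> carrier (res2 A) \<Longrightarrow> cobnd2 g r = \<zero>"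
  obtain H where H: "lifts g H" and Hl: "\<And>x. x \<in> carrier R \<Longrightarrow> defect H (std_lift x) = 0"
    using lifts_std_linear[OF g lifts_start[OF g cocycle]] by blast
  have lin0: "defect H (sc a (poly_var x) + sc b (poly_var y)) = 0" if "x \<in> carrier R" "y \<in> carrier R" for a b x y
    by (rule defect_lin0[OF g H Hl that])
  let ?B = "quad_part H"
  have "symmetric_cocycle ?B"
    unfolding symmetric_cocycle_def
  proof (intro conjI ballI allI impI)
    fix x y z c assume x: "x \<in> carrier R" and y: "y \<in> carrier R"
    show "?B x y \<in> carrier R" by (rule B_closed(1)[OF g H lin0 x y])
    show "nf (?B x y) = ?B x y" by (rule B_closed(2)[OF g H lin0 x y])
    show "?B x y = ?B y x" by (rule B_sym[OF g H lin0])
    show "?B (sc c x) y = sc c (?B x y)" by (rule B_sc[OF g H lin0 x y])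
    assume z: "z \<in> carrier R"
    show "?B (x + y) z = ?B x z + ?B y z" by (rule B_add[OF g H lin0 x y z])
    assume z0: "nf z = 0"
    show "?B (x * y) z = nf (x * ?B y z) + ?B x (y * z)" by (rule B_cocycle[OF g H lin0 x y z z0])
  qed
  from split[OF this] obtain \<Lambda> where L: "splitting ?B \<Lambda>" by (elim exE)
  note L = L[unfolded splitting_def, THEN conjunct1, THEN bspec, THEN mp, THEN conjunct1]
    L[unfolded splitting_def, THEN conjunct1, THEN bspec, THEN mp, THEN conjunct2]
    L[unfolded splitting_def, THEN conjunct2, THEN conjunct1, THEN bspec, THEN bspec, THEN mp, THEN mp]
    L[unfolded splitting_def, THEN conjunct2, THEN conjunct2, THEN conjunct1, THEN spec, THEN bspec, THEN mp]
    L[unfolded splitting_def, THEN conjunct2, THEN conjunct2, THEN conjunct2, THEN bspec, THEN bspec, THEN mp]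
  define l where "l x = \<Lambda> (x - nf x)" for x
  have I: "x - nf x \<in> carrier R" "nf (x - nf x) = 0" if "x \<in> carrier R" for x
    using that by (auto simp: nf_closed poly_minus_closed nf_minus nf_nf)
  have lc: "l x \<in> carrier R" "nf (l x) = l x" if "x \<in> carrier R" for x using L(1,2)[OF I[OF that]] by (auto simp: l_def)
  have l_add: "l (x + y) = l x + l y" if "x \<in> carrier R" "y \<in> carrier R" for x y
    using L(3)[OF I(1)[OF that(1)] I(1)[OF that(2)] I(2)[OF that(1)] I(2)[OF that(2)]] that
    by (simp add: l_def nf_add algebra_simps)
  have l_sc: "l (sc c x) = sc c (l x)" if "x \<in> carrier R" for c x
    using L(4)[OF I[OF that]] that by (simp add: l_def nf_sc right_diff_distrib)
  have l_I: "l i = \<Lambda> i" if "nf i = 0" for i using that by (simp add: l_def)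
  have L0: "\<Lambda> 0 = 0" using L(3)[OF poly_zero_closed poly_zero_closed nf_zero nf_zero] by simp
  have l_nf: "l (nf x) = 0" if "x \<in> carrier R" for x using that by (simp add: l_def nf_nf L0)
  define f where "f x = \<pi> (l x)" for x
  have fc: "f x \<in> carrier A" if "x \<in> carrier R" for x using lc that by (simp add: f_def \<pi>_closed)
  have sf: "s (f x) = l x" if "x \<in> carrier R" for x using lc(2)[OF that] by (simp add: f_def nf_def)
  let ?H = "\<lambda>p. H p \<ominus> der_cobnd f p"
  have H2: "lifts g ?H" by (rule lifts_modify[OF g H fc])
  have Del2: "defect ?H p = defect H p - (sD f p - l (d p)) + (sD f (ps p) - l (d (ps p)))" if "p \<in> carrier GR" for p
    using defect_modify[where f=f, OF fc H_closed[OF g H that] H_closed[OF g H ps_closed[OF that]] that] sf d_closed ps_closed that by simp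
  have lin2: "defect ?H (sc a (poly_var x) + sc b (poly_var y)) = 0" if x: "x \<in> carrier R" and y: "y \<in> carrier R" for a b x y
  proof -
    have v: "sc a (poly_var x) \<in> carrier GR" "sc b (poly_var y) \<in> carrier GR"
      "sc a (poly_var (nf x)) \<in> carrier GR" "sc b (poly_var (nf y)) \<in> carrier GR"
      using x y by (auto intro: poly_smult_closed poly_var_closed nf_closed)
    have c: "sc a x \<in> carrier R" "sc b y \<in> carrier R" "sc a (nf x) \<in> carrier R" "sc b (nf y) \<in> carrier R"
      using x y by (auto intro: poly_smult_closed nf_closed)
    show ?thesis
      using Del2[OF poly_algebra_add[OF v(1,2)]] lin0[OF x y] x y
      by (simp add: sD_simps(1)[where f=f, OF fc] v c sD_sc_var[where f=f, OF fc] sf d_poly(1) d_sc_var l_add l_sc ps_poly(1) ps_sc_var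
        nf_def[symmetric] nf_closed)
  qed
  \<comment> \<open>With \<open>i = x - nf x\<close> and \<open>j = y - nf y\<close>, the map
    \<open>?B\<close> vanishes on the pair of normal forms, so \<open>?B x y\<close> is the sum of
    its values at \<open>(nf x, j)\<close> and \<open>(y, i)\<close>. Both have an argument in the
    ideal, where the splitting gives the value.\<close>
  have quad: "quad_part ?H x y = 0" if x: "x \<in> carrier R" and y: "y \<in> carrier R" for x y
  proof -
    let ?i = "x - nf x" and ?j = "y - nf y"
    note xi = I[OF x] and yj = I[OF y]
    note nx = nf_closed[OF x] and ny = nf_closed[OF y]
    have v: "poly_var x \<in> carrier GR" "poly_var y \<in> carrier GR" "poly_var (nf x) \<in> carrier GR" "poly_var (nf y) \<in> carrier GR"
      using x y nx ny by (auto intro: poly_var_closed)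
    have "quad_part ?H x y = ?B x y - (nf (x * l y) + nf (y * l x) - l (x * y)) - l (nf x * nf y)"
      unfolding quad_part_def
      using Del2[OF poly_algebra_mult[OF v(1,2)]] x y nx ny
      by (simp add: sD_simps(3)[where f=f, OF fc] sD_simps(4)[where f=f, OF fc poly_zero_closed poly_zero_closed] v d_poly(2) d(2) sf ps_poly(2) ps(2)
         nf_def[symmetric] l_nf nf_zero)
    moreover have "?B x y = nf (x * l y) - \<Lambda> (nf x * ?j) + (nf (y * l x) - \<Lambda> (y * ?i))"
    proof -
      have "?B x y = ?B (nf x) y + ?B ?i y" using B_add[OF g H lin0 nx xi(1) y] by simp
      also have "?B ?i y = ?B y ?i" by (rule B_sym[OF g H lin0])
      also have "?B (nf x) y = ?B y (nf x)" by (rule B_sym[OF g H lin0])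
      also have "\<dots> = ?B (nf y) (nf x) + ?B ?j (nf x)" using B_add[OF g H lin0 ny yj(1) nx] by simp
      also have "?B (nf y) (nf x) = 0" by (rule B_nf[OF g H lin0 y x])
      also have "?B ?j (nf x) = ?B (nf x) ?j" by (rule B_sym[OF g H lin0])
      also have "?B (nf x) ?j = nf (nf x * l y) - \<Lambda> (nf x * ?j)" using L(5)[OF nx yj] by (simp add: l_def)
      also have "?B y ?i = nf (y * l x) - \<Lambda> (y * ?i)" using L(5)[OF y xi] by (simp add: l_def)
      also have "nf (nf x * l y) = nf (x * l y)" by (rule nf_mult_cong[OF nx x lc(1)[OF y] nf_nf[OF x]])
      finally show ?thesis by simp
    qed
    moreover have "l (x * y) = l (nf x * nf y) + (\<Lambda> (nf x * ?j) + \<Lambda> (y * ?i))"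
    proof -
      have e: "x * y = nf x * nf y + (nf x * ?j + y * ?i)" by (simp add: algebra_simps)
      have c: "nf x * nf y \<in> carrier R" "nf x * ?j \<in> carrier R" "y * ?i \<in> carrier R"
        using x y nx ny xi(1) yj(1) by (auto intro: poly_algebra_mult)
      have z: "nf (nf x * ?j) = 0" "nf (y * ?i) = 0"
        using nf_mult_nf[OF nx yj(1)] nf_mult_nf[OF y xi(1)] xi(2) yj(2) by (simp_all add: nf_zero)
      show ?thesis
        unfolding e using l_add[OF c(1) poly_algebra_add[OF c(2,3)]] l_add[OF c(2,3)] l_I[OF z(1)] l_I[OF z(2)] by simp
    qed
    ultimately show ?thesis by simp
  qed
  have inv: "?H (ps p) = ?H p" if p: "p \<in> carrier GR" for p
  proof -
    have "defect ?H p = 0" by (rule defect_zero[OF g H2 lin2 quad p])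
    then have "s (?H p) = s (?H (ps p))" by (simp add: defect_def)
    then show ?thesis using s_inject H_closed[OF g H2 p] H_closed[OF g H2 ps_closed[OF p]] by metis
  qed
  have "?H (Gs p) \<in> carrier A" if "p \<in> carrier (res0 A)" for p
    using H_closed[OF g H2] alg_homD(3)[OF Gs(1) that] by blast
  then show "\<exists>f. (\<forall>p\<in>carrier (res0 A). f p \<in> carrier A) \<and> (\<forall>q\<in>carrier (res1 A). g q = cobnd1 f q)"
    using lifts_descend[OF g H2 inv] by (intro exI[of _ "\<lambda>p. ?H (Gs p)"]) blast
qed

end

section \<open>Stanley--Reisner rings\<close>

locale complex_on =
  fixes V :: "'v set" and K :: "'v set set"
  assumes K_sub: "F \<in> K \<Longrightarrow> F \<subseteq> V" and K_down: "F \<in> K \<Longrightarrow> G \<subseteq> F \<Longrightarrow> G \<in> K"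
begin

abbreviation "PV \<equiv> poly_algebra V"
abbreviation "I \<equiv> stanley_reisner_ideal V K"
abbreviation "SR \<equiv> stanley_reisner_ring V K"

lemma prod_poly_var: "(\<Prod>v\<in>F. poly_var v) = Poly_Mapping.single (\<Sum>v\<in>F. Poly_Mapping.single v (Suc 0)) 1"
  by (induction F rule: infinite_finite_induct) (auto simp: poly_var_def mult_single)

lemma keys_sum_single: "finite F \<Longrightarrow> Poly_Mapping.keys (\<Sum>v\<in>F. Poly_Mapping.single v (Suc 0)) = F"
  by (induction F rule: finite_induct) (auto simp: keys_add_nat)

text \<open>A monomial with support in \<open>V\<close> but not in \<open>K\<close> is a multiple of
  the square-free monomial of its support, one of the generators; conversely the span of these
  monomials is an ideal since \<open>K\<close> is closed under subsets.\<close>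

lemma ideal_eq: "I = {p \<in> carrier PV. \<forall>m\<in>Poly_Mapping.keys p. Poly_Mapping.keys m \<notin> K}" (is "_ = ?J")
  and ideal_I: "ideal I PV"
proof -
  interpret R: calg PV by (rule poly_algebra_calg)
  let ?S = "{\<Prod>v\<in>F. poly_var v |F. finite F \<and> F \<subseteq> V \<and> F \<notin> K}"
  have S: "?S \<subseteq> carrier PV"
    by (auto simp: prod_poly_var poly_algebra_carrier keys_sum_single)
  show ideal: "ideal I PV"
    unfolding stanley_reisner_ideal_def by (rule R.genideal_ideal[OF S])
  interpret I: ideal I PV by (rule ideal)
  have mult: "x * p \<in> ?J" if "x \<in> carrier PV" "p \<in> ?J" for x p
  proof -
    have "Poly_Mapping.keys m \<notin> K" if mk: "m \<in> Poly_Mapping.keys (x * p)" for m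
    proof -
      obtain a b where ab: "m = a + b" "b \<in> Poly_Mapping.keys p" using keys_mult[of x p] mk by blast
      then show ?thesis using \<open>p \<in> ?J\<close> K_down[of "Poly_Mapping.keys m" "Poly_Mapping.keys b"] by (auto simp: keys_add_nat)
    qed
    then show ?thesis using that poly_algebra_mult by blast
  qed
  have J: "ideal ?J PV"
  proof (rule idealI)
    show "ring PV" by (rule R.ring_axioms)
    show "subgroup ?J (add_monoid PV)"
    proof (rule subgroup.intro)
      fix x y assume x: "x \<in> ?J" and y: "y \<in> ?J"
      then show "x \<otimes>\<^bsub>add_monoid PV\<^esub> y \<in> ?J"
        using Poly_Mapping.keys_add[of x y] by (auto simp: poly_algebra_add)
      have neg: "- x \<in> ?J" using x by (auto simp: poly_algebra_uminus)
      have "inv\<^bsub>add_monoid PV\<^esub> x = - x"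
        by (rule R.add.inv_equality[unfolded a_inv_def]) (use x neg in auto)
      then show "inv\<^bsub>add_monoid PV\<^esub> x \<in> ?J" using neg by simp
    qed (auto simp: poly_zero_closed)
    show "x \<otimes>\<^bsub>PV\<^esub> a \<in> ?J" if "a \<in> ?J" "x \<in> carrier PV" for a x using mult[OF that(2,1)] by simp
    show "a \<otimes>\<^bsub>PV\<^esub> x \<in> ?J" if "a \<in> ?J" "x \<in> carrier PV" for a x using mult[OF that(2,1)] by (simp add: mult.commute)
  qed
  have "?S \<subseteq> ?J" using S by (auto simp: prod_poly_var keys_sum_single)
  then have IJ: "I \<subseteq> ?J"
    unfolding stanley_reisner_ideal_def by (rule R.genideal_minimal[OF J])
  have mon: "Poly_Mapping.single m c \<in> I" if m: "Poly_Mapping.keys m \<subseteq> V" "Poly_Mapping.keys m \<notin> K" for m c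
  proof -
    let ?u = "\<Sum>v\<in>Poly_Mapping.keys m. Poly_Mapping.single v (Suc 0)"
    have "(\<Prod>v\<in>Poly_Mapping.keys m. poly_var v) \<in> ?S" using m by auto
    then have u: "Poly_Mapping.single ?u 1 \<in> I"
      using R.genideal_self[OF S] unfolding prod_poly_var stanley_reisner_ideal_def by blast
    have lu: "Poly_Mapping.lookup ?u v = (if v \<in> Poly_Mapping.keys m then 1 else 0)" for v
      by (simp add: lookup_sum lookup_single when_def)
    have "m = (m - ?u) + ?u"
      by (rule poly_mapping_eqI) (auto simp: lookup_add lookup_minus lu in_keys_iff)
    then have "Poly_Mapping.single m c = Poly_Mapping.single (m - ?u) c * Poly_Mapping.single ?u 1"
      by (simp add: mult_single)
    moreover have "Poly_Mapping.single (m - ?u) c \<in> carrier PV"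
      by (rule poly_algebra_single) (use m in \<open>auto simp: in_keys_iff lookup_minus\<close>)
    ultimately show ?thesis using I.I_l_closed[OF u] by simp
  qed
  have zero: "0 \<in> I" using additive_subgroup.zero_closed[OF I.is_additive_subgroup] by simp
  have "p \<in> I" if "p \<in> ?J" for p
  proof -
    have "p = (\<Sum>m\<in>Poly_Mapping.keys p. Poly_Mapping.single m (Poly_Mapping.lookup p m))"
      using poly_sum_monomials[of p] by (simp add: mult_single)
    moreover have "(\<Sum>m\<in>X. Poly_Mapping.single m (Poly_Mapping.lookup p m)) \<in> I" if "X \<subseteq> Poly_Mapping.keys p" for X
    proof -
      have "finite X" using that by (rule finite_subset) simp
      then show ?thesis using that
      proof (induction X)
        case empty
        then show ?case using zero by simp
      next
        case (insert m X)
        have "Poly_Mapping.single m (Poly_Mapping.lookup p m) \<in> I"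
          by (rule mon) (use \<open>p \<in> ?J\<close> insert.prems in \<open>auto simp: poly_algebra_carrier\<close>)
        then show ?case using additive_subgroup.a_closed[OF I.is_additive_subgroup] insert by auto
      qed
    qed
    ultimately show ?thesis by (metis order_refl)
  qed
  then show "I = ?J" using IJ by blast
qed

lemma SR_simps:
  "carrier SR = (\<lambda>x. I +>\<^bsub>PV\<^esub> x) ` carrier PV"
  "zero SR = I" "one SR = I +>\<^bsub>PV\<^esub> 1"
  by (simp_all add: stanley_reisner_ring_def quot_module_simps)

lemma coset: "I +>\<^bsub>PV\<^esub> x = {h + x |h. h \<in> I}"
  by (auto simp: a_r_coset_def')

lemma SR_ops:
  assumes "x \<in> carrier PV" "y \<in> carrier PV"
  shows "(I +>\<^bsub>PV\<^esub> x) \<oplus>\<^bsub>SR\<^esub> (I +>\<^bsub>PV\<^esub> y) = I +>\<^bsub>PV\<^esub> (x + y)"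
    and "(I +>\<^bsub>PV\<^esub> x) \<otimes>\<^bsub>SR\<^esub> (I +>\<^bsub>PV\<^esub> y) = I +>\<^bsub>PV\<^esub> (x * y)"
    and "c \<odot>\<^bsub>SR\<^esub> (I +>\<^bsub>PV\<^esub> x) = I +>\<^bsub>PV\<^esub> (sc c x)"
proof -
  interpret I: ideal I PV by (rule ideal_I)
  show "(I +>\<^bsub>PV\<^esub> x) \<oplus>\<^bsub>SR\<^esub> (I +>\<^bsub>PV\<^esub> y) = I +>\<^bsub>PV\<^esub> (x + y)"
    using I.a_rcos_sum[OF assms] by (simp add: stanley_reisner_ring_def quot_module_simps)
  show "(I +>\<^bsub>PV\<^esub> x) \<otimes>\<^bsub>SR\<^esub> (I +>\<^bsub>PV\<^esub> y) = I +>\<^bsub>PV\<^esub> (x * y)"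
    using I.rcoset_mult_add[OF assms] by (simp add: stanley_reisner_ring_def quot_module_simps)
  have z: "0 \<in> I" using additive_subgroup.zero_closed[OF I.is_additive_subgroup] by simp
  have scI: "sc c h \<in> I" if "h \<in> I" for h
    using I.I_l_closed[OF that, of "Poly_Mapping.single 0 c"] by (simp add: poly_algebra_single)
  have addI: "h + k \<in> I" if "h \<in> I" "k \<in> I" for h k using additive_subgroup.a_closed[OF I.is_additive_subgroup that] by simp
  have "c \<odot>\<^bsub>SR\<^esub> (I +>\<^bsub>PV\<^esub> x) = {n + sc c (h + x) |n h. n \<in> I \<and> h \<in> I}"
    by (auto simp: stanley_reisner_ring_def quot_module_simps set_add_def' coset)
  also have "\<dots> = {h + sc c x |h. h \<in> I}"
  proof (intro equalityI subsetI)
    fix t assume "t \<in> {n + sc c (h + x) |n h. n \<in> I \<and> h \<in> I}"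
    then obtain n h where "t = (n + sc c h) + sc c x" "n \<in> I" "h \<in> I" by (auto simp: sc_simps add.assoc)
    then show "t \<in> {h + sc c x |h. h \<in> I}" using addI scI by blast
  next
    fix t assume "t \<in> {h + sc c x |h. h \<in> I}"
    then obtain n where "t = n + sc c (0 + x)" "n \<in> I" by auto
    then show "t \<in> {n + sc c (h + x) |n h. n \<in> I \<and> h \<in> I}" using z by blast
  qed
  finally show "c \<odot>\<^bsub>SR\<^esub> (I +>\<^bsub>PV\<^esub> x) = I +>\<^bsub>PV\<^esub> (sc c x)" by (simp add: coset)
qed

lemma SR_cases: "X \<in> carrier SR \<Longrightarrow> (\<And>x. x \<in> carrier PV \<Longrightarrow> X = I +>\<^bsub>PV\<^esub> x \<Longrightarrow> thesis) \<Longrightarrow> thesis"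
  by (auto simp: SR_simps)

lemma SR_coset: "x \<in> carrier PV \<Longrightarrow> I +>\<^bsub>PV\<^esub> x \<in> carrier SR"
  by (auto simp: SR_simps)

lemma SR_zero: "zero SR = I +>\<^bsub>PV\<^esub> 0"
  by (auto simp: SR_simps coset)

lemma SR_calg: "calg SR"
proof -
  note cl = SR_coset poly_closed
  note o = SR_ops
  have "cring SR"
  proof (rule cringI)
    show "abelian_group SR"
    proof (rule abelian_groupI)
      fix X assume "X \<in> carrier SR"
      then obtain x where x: "x \<in> carrier PV" "X = I +>\<^bsub>PV\<^esub> x" by (rule SR_cases)
      then have "(I +>\<^bsub>PV\<^esub> (- x)) \<oplus>\<^bsub>SR\<^esub> X = \<zero>\<^bsub>SR\<^esub>"
        by (simp add: SR_ops poly_algebra_uminus SR_zero)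
      then show "\<exists>Y\<in>carrier SR. Y \<oplus>\<^bsub>SR\<^esub> X = \<zero>\<^bsub>SR\<^esub>" using x SR_coset poly_algebra_uminus by blast
    qed (auto elim!: SR_cases simp: SR_zero SR_ops cl ac_simps)
    show "comm_monoid SR"
      by (rule comm_monoidI) (auto elim!: SR_cases simp: SR_simps(3) SR_ops cl ac_simps)
    show "(X \<oplus>\<^bsub>SR\<^esub> Y) \<otimes>\<^bsub>SR\<^esub> Z = X \<otimes>\<^bsub>SR\<^esub> Z \<oplus>\<^bsub>SR\<^esub> Y \<otimes>\<^bsub>SR\<^esub> Z"
      if "X \<in> carrier SR" "Y \<in> carrier SR" "Z \<in> carrier SR" for X Y Z
      using that by (auto elim!: SR_cases simp: SR_ops cl distrib_right)
  qed
  moreover have "calg_axioms SR"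
    by (rule calg_axioms.intro; (elim SR_cases)?) (auto simp: SR_ops cl sc_simps mult.assoc)
  ultimately show ?thesis by (rule calg.intro)
qed

definition "sr_proj = (\<lambda>x. I +>\<^bsub>PV\<^esub> x)"

text \<open>The normal form: as \<open>I\<close> is spanned by monomials, deleting those with
  support outside \<open>K\<close> selects the representative of a coset that contains none of
  them.\<close>

definition face_part :: "'v cpoly \<Rightarrow> 'v cpoly" where
  "face_part p = (\<Sum>m\<in>{m \<in> Poly_Mapping.keys p. Poly_Mapping.keys m \<in> K}. Poly_Mapping.single m (Poly_Mapping.lookup p m))"

lemma lookup_face_part: "Poly_Mapping.lookup (face_part p) m = (if Poly_Mapping.keys m \<in> K then Poly_Mapping.lookup p m else 0)"
  by (auto simp: face_part_def lookup_sum lookup_single when_def in_keys_iff)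

lemma face_part_add: "face_part (p + q) = face_part p + face_part q"
  by (rule poly_mapping_eqI) (simp add: lookup_face_part lookup_add)

lemma face_part_sc: "face_part (sc c p) = sc c (face_part p)"
  by (rule poly_mapping_eqI) (simp add: lookup_face_part lookup_sc)

lemma face_part_closed: "p \<in> carrier PV \<Longrightarrow> face_part p \<in> carrier PV"
  by (auto simp: poly_algebra_carrier in_keys_iff lookup_face_part split: if_splits)

lemma face_part_zero_iff: "x \<in> carrier PV \<Longrightarrow> face_part x = 0 \<longleftrightarrow> x \<in> I"
proof -
  assume x: "x \<in> carrier PV"
  have "face_part x = 0 \<longleftrightarrow> (\<forall>m. Poly_Mapping.lookup (face_part x) m = 0)"
    by (auto intro: poly_mapping_eqI)
  also have "\<dots> \<longleftrightarrow> x \<in> I" using x by (auto simp: ideal_eq lookup_face_part in_keys_iff)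
  finally show ?thesis .
qed

definition sr_section :: "'v cpoly set \<Rightarrow> 'v cpoly" where
  "sr_section X = the_elem (face_part ` X)"

lemma sr_section: "x \<in> carrier PV \<Longrightarrow> sr_section (sr_proj x) = face_part x"
proof -
  assume x: "x \<in> carrier PV"
  interpret I: ideal I PV by (rule ideal_I)
  have "face_part h = 0" if "h \<in> I" for h using that face_part_zero_iff[of h] I.a_Hcarr[OF that] by blast
  then have "face_part ` (sr_proj x) = {face_part x}"
    using additive_subgroup.zero_closed[OF I.is_additive_subgroup] by (force simp: sr_proj_def coset face_part_add image_iff)
  then show ?thesis by (simp add: sr_section_def)
qed

lemma face_part_idem: "face_part (face_part x) = face_part x"
  by (rule poly_mapping_eqI) (simp add: lookup_face_part)

lemma sr_proj_face_part: "x \<in> carrier PV \<Longrightarrow> sr_proj (face_part x) = sr_proj x"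
proof -
  assume x: "x \<in> carrier PV"
  interpret I: ideal I PV by (rule ideal_I)
  have fx: "face_part x \<in> carrier PV" using x by (rule face_part_closed)
  have "face_part (face_part x + sc (-1) x) = 0"
    by (simp only: face_part_add face_part_sc face_part_idem) (simp add: sc_simps)
  moreover have c: "face_part x - x \<in> carrier PV" by (rule poly_minus_closed[OF fx x])
  ultimately have "face_part x - x \<in> I" using face_part_zero_iff[OF c] by (simp add: sc_simps)
  then have "face_part x \<in> sr_proj x" by (auto simp: sr_proj_def coset intro!: exI[of _ "face_part x - x"])
  then show ?thesis
    unfolding sr_proj_def using I.a_repr_independence[OF _ x I.a_subgroup] by simp
qed

lemma presentation: "poly_presentation SR V sr_proj sr_section"
proof -
  have *: thesis if "X \<in> carrier SR" "\<And>x. x \<in> carrier PV \<Longrightarrow> X = sr_proj x \<Longrightarrow> thesis" for X thesis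
    using that SR_cases unfolding sr_proj_def by blast
  note ops = SR_ops[folded sr_proj_def]
  have hom: "alg_hom PV SR sr_proj"
    unfolding alg_hom_def
    by (auto simp: ops SR_simps(1) SR_simps(3)[folded sr_proj_def] intro!: ring_hom_memI) (simp add: sr_proj_def)
  show ?thesis
  proof (intro poly_presentation.intro resolution.intro poly_presentation_axioms.intro SR_calg hom)
    fix a assume "a \<in> carrier SR"
    then obtain x where x: "x \<in> carrier PV" "a = sr_proj x" by (rule *)
    show "sr_section a \<in> carrier PV" using x by (simp add: sr_section face_part_closed)
    show "sr_proj (sr_section a) = a" using x by (simp add: sr_section sr_proj_face_part)
    show "sr_section (c \<odot>\<^bsub>SR\<^esub> a) = sc c (sr_section a)" for c
      using x by (simp add: ops sr_section face_part_sc poly_smult_closed)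
    show "sr_section (sr_proj (Poly_Mapping.single m 1)) = Poly_Mapping.single m 1"
      if "m \<in> Poly_Mapping.keys (sr_section a)" for m
    proof -
      have m: "Poly_Mapping.keys m \<in> K" using that x by (auto simp: sr_section in_keys_iff lookup_face_part split: if_splits)
      then have "Poly_Mapping.single m 1 \<in> carrier PV" using K_sub by (intro poly_algebra_single)
      then show ?thesis using m
        by (auto simp: sr_section lookup_face_part lookup_single when_def intro!: poly_mapping_eqI)
    qed
    fix b assume "b \<in> carrier SR"
    then obtain y where y: "y \<in> carrier PV" "b = sr_proj y" by (rule *)
    show "sr_section (a \<oplus>\<^bsub>SR\<^esub> b) = sr_section a + sr_section b"
      using x y by (simp add: ops sr_section face_part_add poly_algebra_add)
  qed
qed

end

section \<open>Splitting extensions over the Stanley--Reisner ring of a flag complex\<close>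

definition up :: "'v \<Rightarrow> ('v \<Rightarrow> int) \<Rightarrow> 'v \<Rightarrow> int" where
  "up x c = c(x := c x + 1)"

lemma up_commute: "up x (up y c) = up y (up x c)"
  by (auto simp: up_def)

definition deg_fun :: "('v \<Rightarrow>\<^sub>0 nat) \<Rightarrow> 'v \<Rightarrow> int" where
  "deg_fun m v = int (Poly_Mapping.lookup m v)"

lemma deg_fun_inject: "deg_fun m = deg_fun m' \<longleftrightarrow> m = m'"
  by (auto simp: deg_fun_def fun_eq_iff intro: poly_mapping_eqI)

text \<open>Degrees in \<open>\<int>\<^sup>V\<close>; the coefficient in a degree that is not the exponent of a monomial is 0.\<close>

definition deg_coeff :: "'v cpoly \<Rightarrow> ('v \<Rightarrow> int) \<Rightarrow> complex" where
  "deg_coeff p c = (if \<exists>m. c = deg_fun m then Poly_Mapping.lookup p (THE m. c = deg_fun m) else 0)"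

lemma deg_coeff_deg_fun [simp]: "deg_coeff p (deg_fun m) = Poly_Mapping.lookup p m"
proof -
  have "(THE m'. deg_fun m = deg_fun m') = m" by (rule the_equality) (auto simp: deg_fun_inject)
  then show ?thesis by (auto simp: deg_coeff_def)
qed

lemma deg_coeff_add: "deg_coeff (p + q) c = deg_coeff p c + deg_coeff q c" and deg_coeff_minus: "deg_coeff (p - q) c = deg_coeff p c - deg_coeff q c"
  and deg_coeff_uminus: "deg_coeff (- p) c = - deg_coeff p c" and deg_coeff_zero: "deg_coeff 0 c = 0"
  by (auto simp: deg_coeff_def lookup_add lookup_minus)

lemma deg_coeff_eqI: "(\<And>m. deg_coeff p (deg_fun m) = deg_coeff q (deg_fun m)) \<Longrightarrow> p = q"
  by (auto intro: poly_mapping_eqI)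

lemma lookup_single_mult: "Poly_Mapping.lookup (Poly_Mapping.single a 1 * p) (a + m) = Poly_Mapping.lookup (p :: 'v cpoly) m"
proof -
  have "p \<in> carrier (poly_algebra UNIV)" by (simp add: poly_algebra_carrier)
  then show ?thesis
    by (induction rule: poly_induct_single)
       (auto simp: distrib_left lookup_add mult_single lookup_single when_def)
qed

lemma lookup_var_mult_0: "v \<notin> Poly_Mapping.keys m \<Longrightarrow> Poly_Mapping.lookup (poly_var v * p) m = 0"
proof (rule ccontr)
  assume v: "v \<notin> Poly_Mapping.keys m" and "Poly_Mapping.lookup (poly_var v * p) m \<noteq> 0"
  then have "m \<in> Poly_Mapping.keys (poly_var v * p)" by (simp add: in_keys_iff)
  then obtain b where "m = Poly_Mapping.single v 1 + b" using keys_mult[of "poly_var v" p] by (auto simp: poly_var_def)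
  then show False using v by (auto simp: keys_add_nat)
qed

locale flag_complex =
  fixes V :: "'v set" and cross :: "'v \<Rightarrow> 'v \<Rightarrow> bool"
  assumes finite_V: "finite V" and cross_sym: "cross x y \<Longrightarrow> cross y x" and cross_irrefl: "\<not> cross x x"
begin

definition "K = {F. F \<subseteq> V \<and> (\<forall>x\<in>F. \<forall>y\<in>F. \<not> cross x y)}"

sublocale complex_on V K
  by unfold_locales (auto simp: K_def)

lemma K_not_cross: "F \<in> K \<Longrightarrow> x \<in> F \<Longrightarrow> y \<in> F \<Longrightarrow> \<not> cross x y"
  by (auto simp: K_def)

text \<open>The degrees in which the Stanley--Reisner ring is nonzero; each such component is
  spanned by a single monomial.\<close>

definition live :: "('v \<Rightarrow> int) \<Rightarrow> bool" where
  "live c \<longleftrightarrow> (\<forall>v. c v \<ge> 0) \<and> {v. c v > 0} \<in> K"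

lemma deg_fun_exists:
  assumes "\<And>v. c v \<ge> 0" "finite {v. c v > 0}"
  shows "\<exists>m. c = deg_fun m"
proof
  show "c = deg_fun (\<Sum>v\<in>{v. c v > 0}. Poly_Mapping.single v (nat (c v)))"
  proof
    fix v
    have "c v = 0" if "\<not> c v > 0" using assms(1)[of v] that by simp
    then show "c v = deg_fun (\<Sum>v\<in>{v. c v > 0}. Poly_Mapping.single v (nat (c v))) v"
      using assms by (auto simp: deg_fun_def lookup_sum lookup_single when_def sum.delta)
  qed
qed

lemma K_finite: "F \<in> K \<Longrightarrow> finite F"
  using finite_V K_sub finite_subset by blast

lemma live_iff: "live c \<longleftrightarrow> (\<exists>m. c = deg_fun m \<and> Poly_Mapping.keys m \<in> K)"
proof
  assume l: "live c"
  then obtain m where m: "c = deg_fun m" using deg_fun_exists[of c] K_finite by (auto simp: live_def)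
  have "Poly_Mapping.keys m = {v. c v > 0}" by (auto simp: m deg_fun_def in_keys_iff)
  then show "\<exists>m. c = deg_fun m \<and> Poly_Mapping.keys m \<in> K" using l m by (auto simp: live_def)
next
  assume "\<exists>m. c = deg_fun m \<and> Poly_Mapping.keys m \<in> K"
  then obtain m where m: "c = deg_fun m" "Poly_Mapping.keys m \<in> K" by blast
  have "Poly_Mapping.keys m = {v. c v > 0}" by (auto simp: m deg_fun_def in_keys_iff)
  then show "live c" using m by (auto simp: live_def deg_fun_def)
qed

lemma live_deg_fun: "live (deg_fun m) \<longleftrightarrow> Poly_Mapping.keys m \<in> K"
  by (auto simp: live_iff deg_fun_inject)

lemma deg_coeff_not_live: "face_part p = p \<Longrightarrow> \<not> live c \<Longrightarrow> deg_coeff p c = 0"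
proof -
  assume p: "face_part p = p" and l: "\<not> live c"
  show ?thesis
  proof (cases "\<exists>m. c = deg_fun m")
    case True
    then obtain m where m: "c = deg_fun m" by blast
    then have "Poly_Mapping.keys m \<notin> K" using l live_deg_fun by simp
    then show ?thesis using lookup_face_part[of p m] p m by simp
  qed (simp add: deg_coeff_def)
qed

text \<open>Multiplication by \<open>poly_var w\<close> raises degrees by \<open>w\<close>. If
  \<open>c w = -1\<close> and the shifted degree is live, it belongs to a monomial not involving
  \<open>w\<close>, and both sides are zero because \<open>c\<close> is not the degree of a
  monomial.\<close>

lemma deg_coeff_act: "deg_coeff (face_part (poly_var w * p)) (up w c) = (if live (up w c) then deg_coeff p c else 0)"
proof (cases "live (up w c)")
  case True
  then obtain m where m: "up w c = deg_fun m" "Poly_Mapping.keys m \<in> K" by (auto simp: live_iff)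
  have c: "c = (deg_fun m)(w := deg_fun m w - 1)" unfolding m(1)[symmetric] by (simp add: up_def)
  show ?thesis
  proof (cases "w \<in> Poly_Mapping.keys m")
    case True
    define m' where "m' = m - Poly_Mapping.single w 1"
    have mm: "m = Poly_Mapping.single w 1 + m'"
      using True by (intro poly_mapping_eqI) (auto simp: m'_def lookup_add lookup_minus lookup_single when_def in_keys_iff)
    have "c = deg_fun m'" unfolding c mm
      by (auto simp: deg_fun_def fun_eq_iff lookup_add lookup_single when_def)
    then show ?thesis
      using m \<open>live _\<close> by (simp add: lookup_face_part) (simp add: mm poly_var_def lookup_single_mult)
  next
    case False
    then have "c w = -1" using c by (simp add: deg_fun_def in_keys_iff)
    then have "\<not> (\<exists>m. c = deg_fun m)" by (auto simp: deg_fun_def)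
    then show ?thesis using m \<open>live _\<close> lookup_var_mult_0[OF False, of p] by (simp add: lookup_face_part deg_coeff_def[of p])
  qed
next
  case False
  then show ?thesis using deg_coeff_not_live[of "face_part (poly_var w * p)"] by (simp add: face_part_idem)
qed

text \<open>\<open>T x y z\<close> is the coefficient, in degree \<open>c + x + y + z\<close>, of the obstruction \<open>\<phi> x y z\<close> below to lifting
  the syzygy between the generators \<open>x y\<close> and \<open>x z\<close>.  The last two conditions come from the Koszul
  relations between disjoint generators and between \<open>x y\<close> and \<open>x z\<close>.\<close>

definition coherent :: "('v \<Rightarrow> int) \<Rightarrow> ('v \<Rightarrow> 'v \<Rightarrow> 'v \<Rightarrow> complex) \<Rightarrow> bool" where
  "coherent c T \<longleftrightarrow>
    (\<forall>x\<in>V. \<forall>y\<in>V. \<forall>z\<in>V. \<not> live (up x (up y (up z c))) \<longrightarrow> T x y z = 0) \<and>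
    (\<forall>x\<in>V. \<forall>y\<in>V. \<forall>z\<in>V. T x z y = - T x y z) \<and>
    (\<forall>x\<in>V. \<forall>y\<in>V. \<forall>z\<in>V. T x y z + T y z x + T z x y = 0) \<and>
    (\<forall>w\<in>V. \<forall>x\<in>V. \<forall>y\<in>V. \<forall>z\<in>V. cross x y \<longrightarrow> cross x z \<longrightarrow> cross x w \<longrightarrow>
       live (up w (up x (up y (up z c)))) \<longrightarrow> T x y z + T x z w + T x w y = 0) \<and>
    (\<forall>w\<in>V. \<forall>x\<in>V. \<forall>y\<in>V. \<forall>z\<in>V. cross w x \<longrightarrow> cross x y \<longrightarrow> cross y z \<longrightarrow>
       live (up w (up x (up y (up z c)))) \<longrightarrow> T x w y + T y x z = 0) \<and>
    (\<forall>x\<in>V. \<forall>y\<in>V. \<forall>z\<in>V. cross x y \<longrightarrow> cross x z \<longrightarrow>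
       live (up x (up x (up y (up z c)))) \<longrightarrow> T x y z = 0)"

text \<open>\<open>\<alpha> x y\<close> is the coefficient in degree \<open>c + x + y\<close> of a
  correction to the value of the splitting on the generator \<open>x y\<close>. Multiplied by
  \<open>z\<close> it contributes in degree \<open>c + x + y + z\<close> only if
  \<open>c + x + y\<close> has no negative entry at \<open>z\<close>, that is, if
  \<open>c z \<ge> 0\<close>.\<close>

definition potential :: "('v \<Rightarrow> int) \<Rightarrow> ('v \<Rightarrow> 'v \<Rightarrow> 'v \<Rightarrow> complex) \<Rightarrow> ('v \<Rightarrow> 'v \<Rightarrow> complex) \<Rightarrow> bool" where
  "potential c T \<alpha> \<longleftrightarrow> (\<forall>x y. \<alpha> x y = \<alpha> y x) \<and>
    (\<forall>x\<in>V. \<forall>y\<in>V. \<forall>z\<in>V. cross x y \<longrightarrow> cross x z \<longrightarrow> live (up x (up y (up z c))) \<longrightarrow>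
      T x y z = (if c z \<ge> 0 then \<alpha> x y else 0) - (if c y \<ge> 0 then \<alpha> x z else 0))"

lemma poly_mult_I: "x \<in> carrier PV \<Longrightarrow> i \<in> carrier PV \<Longrightarrow> face_part i = 0 \<Longrightarrow> face_part (x * i) = 0"
  using ideal.I_l_closed[OF ideal_I, of i x] face_part_zero_iff[of i] face_part_zero_iff[of "x * i"]
  by (simp add: poly_algebra_mult)

interpretation P: poly_presentation SR V sr_proj sr_section by (rule presentation)

lemma nf_eq: "x \<in> carrier PV \<Longrightarrow> P.nf x = face_part x"
  by (simp add: P.nf_def sr_section)

lemma fp_mult: "x \<in> carrier PV \<Longrightarrow> y \<in> carrier PV \<Longrightarrow> face_part (x * face_part y) = face_part (x * y)"
  using P.nf_mult_nf[of x y] by (simp add: nf_eq face_part_closed poly_algebra_mult)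

lemma fp_mult2: "x \<in> carrier PV \<Longrightarrow> y \<in> carrier PV \<Longrightarrow> z \<in> carrier PV \<Longrightarrow>
  face_part (x * face_part (y * z)) = face_part (x * y * z)"
  by (simp add: fp_mult poly_algebra_mult mult.assoc)

lemma face_part_minus: "face_part (p - q) = face_part p - face_part q"
  by (rule poly_mapping_eqI) (simp add: lookup_face_part lookup_minus)

lemma face_part_0: "face_part 0 = 0"
  by (rule poly_mapping_eqI) (simp add: lookup_face_part)

lemma edge_I: "cross x y \<Longrightarrow> face_part (poly_var x * poly_var y) = 0"
  by (rule poly_mapping_eqI)
     (auto simp: lookup_face_part poly_var_def mult_single lookup_single when_def keys_add_nat dest: K_not_cross[of _ x y])

section \<open>The map on syzygies defined by a symmetric cocycle\<close>

context
  fixes \<beta> assumes \<beta>: "P.symmetric_cocycle \<beta>"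
begin

lemma \<beta>_closed: "x \<in> carrier PV \<Longrightarrow> y \<in> carrier PV \<Longrightarrow> \<beta> x y \<in> carrier PV"
  and \<beta>_sym: "x \<in> carrier PV \<Longrightarrow> y \<in> carrier PV \<Longrightarrow> \<beta> x y = \<beta> y x"
  and \<beta>_add: "x \<in> carrier PV \<Longrightarrow> y \<in> carrier PV \<Longrightarrow> z \<in> carrier PV \<Longrightarrow> \<beta> (x + y) z = \<beta> x z + \<beta> y z"
  and \<beta>_sc: "x \<in> carrier PV \<Longrightarrow> y \<in> carrier PV \<Longrightarrow> \<beta> (sc c x) y = sc c (\<beta> x y)"
  using \<beta> unfolding P.symmetric_cocycle_def by blast+

lemma \<beta>_nf: "x \<in> carrier PV \<Longrightarrow> y \<in> carrier PV \<Longrightarrow> face_part (\<beta> x y) = \<beta> x y"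
  using \<beta> \<beta>_closed[of x y] nf_eq[of "\<beta> x y"] unfolding P.symmetric_cocycle_def by metis

lemma \<beta>_cocycle: "x \<in> carrier PV \<Longrightarrow> y \<in> carrier PV \<Longrightarrow> i \<in> carrier PV \<Longrightarrow> face_part i = 0 \<Longrightarrow>
     face_part (x * \<beta> y i) = \<beta> (x * y) i - \<beta> x (y * i)"
  using \<beta> \<beta>_closed[of y i] nf_eq[of i] nf_eq[of "x * \<beta> y i"] poly_algebra_mult[of x V "\<beta> y i"]
  unfolding P.symmetric_cocycle_def by simp

lemma \<beta>_add_right: "x \<in> carrier PV \<Longrightarrow> y \<in> carrier PV \<Longrightarrow> z \<in> carrier PV \<Longrightarrow> \<beta> z (x + y) = \<beta> z x + \<beta> z y"
  using \<beta>_add[of x y z] \<beta>_sym[of _ z] by (simp add: poly_algebra_add)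

lemma \<beta>_sc_right: "x \<in> carrier PV \<Longrightarrow> y \<in> carrier PV \<Longrightarrow> \<beta> y (sc c x) = sc c (\<beta> y x)"
  using \<beta>_sc[of x y c] \<beta>_sym[of _ y] by (simp add: poly_smult_closed)

abbreviation "X \<equiv> poly_var"

text \<open>The extension evaluated on the syzygy \<open>z (x y) - y (x z)\<close>: if the
  generators are lifted with zero component in \<open>A\<close>, this combination of the lifts is an
  element of \<open>A\<close>, namely this one.\<close>

definition "\<phi> x y z = \<beta> (X z) (X x * X y) - \<beta> (X y) (X x * X z)"

context
  fixes x y z assumes xyz: "x \<in> V" "y \<in> V" "z \<in> V"
begin

lemma \<phi>_closed: "\<phi> x y z \<in> carrier PV"
  and \<phi>_nf: "face_part (\<phi> x y z) = \<phi> x y z"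
  and \<phi>_antisym: "\<phi> x z y = - \<phi> x y z"
  and \<phi>_tri: "\<phi> x y z + \<phi> y z x + \<phi> z x y = 0"
  using xyz by (simp_all add: \<phi>_def poly_minus_closed \<beta>_closed \<beta>_nf poly_var_closed poly_algebra_mult face_part_minus)
    (simp add: mult.commute)

text \<open>By the cocycle condition \<open>p\<close> moves into the first argument; the terms left
  over are two copies of \<beta> at \<open>p\<close> and the product of all three variables, which
  cancel.\<close>

lemma act_\<phi>:
  assumes "cross x y" "cross x z" "p \<in> carrier PV"
  shows "face_part (p * \<phi> x y z) = \<beta> (p * X z) (X x * X y) - \<beta> (p * X y) (X x * X z)"
proof -
  have c: "X x \<in> carrier PV" "X y \<in> carrier PV" "X z \<in> carrier PV"
    "X x * X y \<in> carrier PV" "X x * X z \<in> carrier PV"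
    using xyz by (auto intro: poly_var_closed poly_algebra_mult)
  have e: "X y * (X x * X z) = X z * (X x * X y)" by (simp add: ac_simps)
  show ?thesis
    unfolding \<phi>_def right_diff_distrib face_part_minus
    using \<beta>_cocycle[OF assms(3) c(3) c(4) edge_I[OF assms(1)]] \<beta>_cocycle[OF assms(3) c(2) c(5) edge_I[OF assms(2)]]
    unfolding e by simp
qed

end

text \<open>The relation among the syzygies of three generators sharing \<open>x\<close>; after
  \<open>act_\<phi>\<close> the six terms cancel in pairs.\<close>

lemma \<phi>_cycle:
  assumes "w \<in> V" "x \<in> V" "y \<in> V" "z \<in> V" "cross x y" "cross x z" "cross x w"
  shows "face_part (X w * \<phi> x y z) + face_part (X y * \<phi> x z w) + face_part (X z * \<phi> x w y) = 0"
  using assms by (simp add: act_\<phi> poly_var_closed mult.commute)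

text \<open>After the terms at \<open>x y\<close> cancel, what is left is
  \<open>\<beta> (X z * X y) (X x * X w)\<close> minus its transpose. This is the Koszul relation
  between the generators \<open>w x\<close> and \<open>y z\<close>, routed through
  \<open>x y\<close>.\<close>

lemma \<phi>_path:
  assumes "w \<in> V" "x \<in> V" "y \<in> V" "z \<in> V" "cross w x" "cross x y" "cross y z"
  shows "face_part (X z * \<phi> x w y) + face_part (X w * \<phi> y x z) = 0"
proof -
  have "\<beta> (X z * X y) (X x * X w) = \<beta> (X x * X w) (X z * X y)"
    by (rule \<beta>_sym) (use assms in \<open>auto intro: poly_var_closed poly_algebra_mult\<close>)
  then show ?thesis
    using assms cross_sym by (simp add: act_\<phi> poly_var_closed mult.commute)
qed

text \<open>The Koszul syzygy between \<open>x y\<close> and \<open>x z\<close> is \<open>x\<close>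
  times the linear one, and \<beta> takes it to zero by symmetry.\<close>

lemma \<phi>_self:
  assumes "x \<in> V" "y \<in> V" "z \<in> V" "cross x y" "cross x z"
  shows "face_part (X x * \<phi> x y z) = 0"
proof -
  have "\<beta> (X x * X z) (X x * X y) = \<beta> (X x * X y) (X x * X z)"
    by (rule \<beta>_sym) (use assms in \<open>auto intro: poly_var_closed poly_algebra_mult\<close>)
  then show ?thesis
    using assms by (simp add: act_\<phi> poly_var_closed mult.commute)
qed

text \<open>The relations among the \<phi> read in a single degree; in a live target degree,
  \<open>deg_coeff_act\<close> strips the multiplying variable.\<close>

lemma \<phi>_coherent: "coherent c (\<lambda>x y z. deg_coeff (\<phi> x y z) (up x (up y (up z c))))"
  unfolding coherent_def
proof (intro conjI ballI impI)
  fix x y z assume xyz: "x \<in> V" "y \<in> V" "z \<in> V"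
  let ?d = "up x (up y (up z c))"
  have rot: "up y (up z (up x c)) = ?d" "up z (up x (up y c)) = ?d" "up x (up z (up y c)) = ?d"
    by (simp_all add: up_commute)
  show "deg_coeff (\<phi> x y z) ?d = 0" if "\<not> live ?d" using that by (rule deg_coeff_not_live[OF \<phi>_nf[OF xyz]])
  show "deg_coeff (\<phi> x z y) (up x (up z (up y c))) = - deg_coeff (\<phi> x y z) ?d"
    using xyz by (simp add: rot \<phi>_antisym[of x y z] deg_coeff_uminus)
  show "deg_coeff (\<phi> x y z) ?d + deg_coeff (\<phi> y z x) (up y (up z (up x c))) + deg_coeff (\<phi> z x y) (up z (up x (up y c))) = 0"
    using \<phi>_tri[OF xyz] by (simp add: rot deg_coeff_add[symmetric] deg_coeff_zero)
  show "deg_coeff (\<phi> x y z) ?d = 0" if "cross x y" "cross x z" "live (up x ?d)"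
    using \<phi>_self[OF xyz that(1,2)] deg_coeff_act[of x "\<phi> x y z" ?d] that(3) by (simp add: deg_coeff_zero)
next
  fix w x y z assume V: "w \<in> V" "x \<in> V" "y \<in> V" "z \<in> V"
    and cr: "cross x y" "cross x z" "cross x w" and l: "live (up w (up x (up y (up z c))))"
  let ?D = "up w (up x (up y (up z c)))"
  have r: "up y (up x (up z (up w c))) = ?D" "up z (up x (up w (up y c))) = ?D" by (simp_all add: up_commute)
  have "deg_coeff (face_part (X w * \<phi> x y z)) ?D + deg_coeff (face_part (X y * \<phi> x z w)) ?D + deg_coeff (face_part (X z * \<phi> x w y)) ?D = 0"
    using \<phi>_cycle[OF V cr] by (simp add: deg_coeff_add[symmetric] deg_coeff_zero)
  then show "deg_coeff (\<phi> x y z) (up x (up y (up z c))) + deg_coeff (\<phi> x z w) (up x (up z (up w c))) + deg_coeff (\<phi> x w y) (up x (up w (up y c))) = 0"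
    using deg_coeff_act[of w "\<phi> x y z" "up x (up y (up z c))"] deg_coeff_act[of y "\<phi> x z w" "up x (up z (up w c))"]
      deg_coeff_act[of z "\<phi> x w y" "up x (up w (up y c))"] l unfolding r by simp
next
  fix w x y z assume V: "w \<in> V" "x \<in> V" "y \<in> V" "z \<in> V"
    and cr: "cross w x" "cross x y" "cross y z" and l: "live (up w (up x (up y (up z c))))"
  let ?D = "up w (up x (up y (up z c)))"
  have r: "up z (up x (up w (up y c))) = ?D" "up w (up y (up x (up z c))) = ?D" by (simp_all add: up_commute)
  have "deg_coeff (face_part (X z * \<phi> x w y)) ?D + deg_coeff (face_part (X w * \<phi> y x z)) ?D = 0"
    using \<phi>_path[OF V cr] by (simp add: deg_coeff_add[symmetric] deg_coeff_zero)
  then show "deg_coeff (\<phi> x w y) (up x (up w (up y c))) + deg_coeff (\<phi> y x z) (up y (up x (up z c))) = 0"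
    using deg_coeff_act[of z "\<phi> x w y" "up x (up w (up y c))"] deg_coeff_act[of w "\<phi> y x z" "up y (up x (up z c))"] l unfolding r by simp
qed


abbreviation "monomial k \<equiv> Poly_Mapping.single k (1::complex)"

section \<open>From corrected generators to a splitting of the ideal\<close>

context
  fixes al
  assumes al_sym: "\<And>x y. al x y = al y x"
    and al_closed: "\<And>x y. x \<in> V \<Longrightarrow> y \<in> V \<Longrightarrow> al x y \<in> carrier PV"
    and al_\<phi>: "\<And>x y z. x \<in> V \<Longrightarrow> y \<in> V \<Longrightarrow> z \<in> V \<Longrightarrow> cross x y \<Longrightarrow> cross x z \<Longrightarrow>
      \<phi> x y z = face_part (X z * al x y) - face_part (X y * al x z)"
begin

text \<open>The value of a splitting on the monomial \<open>k x y\<close> when it sends \<open>x y\<close> to \<open>al x y\<close>; independent of the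
  choice of the crossing pair in the monomial.\<close>

definition "edge_val k x y = face_part (monomial k * al x y) - \<beta> (monomial k) (X x * X y)"

lemma edge_val_sym: "edge_val k x y = edge_val k y x"
  by (simp add: edge_val_def al_sym[of x y] mult.commute)

lemma mon_add: "monomial (k + k') = monomial k * monomial k'"
  by (simp add: mult_single)

lemma mon_var: "monomial (Poly_Mapping.single x 1) = X x"
  by (simp add: poly_var_def)

lemma edge_val_closed:
  assumes "Poly_Mapping.keys k \<subseteq> V" "x \<in> V" "y \<in> V"
  shows "edge_val k x y \<in> carrier PV" "face_part (edge_val k x y) = edge_val k x y"
proof -
  have c: "monomial k \<in> carrier PV" "X x * X y \<in> carrier PV" "monomial k * al x y \<in> carrier PV"
    using assms al_closed by (auto intro!: poly_algebra_single poly_algebra_mult poly_var_closed)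
  show "edge_val k x y \<in> carrier PV" "face_part (edge_val k x y) = edge_val k x y"
    unfolding edge_val_def using c by (simp_all add: poly_minus_closed face_part_closed \<beta>_closed face_part_minus face_part_idem \<beta>_nf)
qed

text \<open>For crossing pairs with a common diagonal, the claim is \<open>monomial k\<close>
  applied to \<open>al_\<phi>\<close>, the equation stating that the corrected lifts satisfy the
  syzygy between the two generators.\<close>

lemma edge_val_share:
  assumes k: "Poly_Mapping.keys k \<subseteq> V" and V: "x \<in> V" "y \<in> V" "z \<in> V" and cr: "cross x y" "cross x z"
  shows "edge_val (k + Poly_Mapping.single z 1) x y = edge_val (k + Poly_Mapping.single y 1) x z"
proof -
  have c: "monomial k \<in> carrier PV" "X y \<in> carrier PV" "X z \<in> carrier PV" "al x y \<in> carrier PV" "al x z \<in> carrier PV"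
    using k V al_closed by (auto intro!: poly_algebra_single poly_var_closed)
  have "face_part (monomial k * X z * al x y) - face_part (monomial k * X y * al x z) = face_part (monomial k * \<phi> x y z)"
    unfolding al_\<phi>[OF V cr] right_diff_distrib face_part_minus using c by (simp add: fp_mult2)
  also have "\<dots> = \<beta> (monomial k * X z) (X x * X y) - \<beta> (monomial k * X y) (X x * X z)"
    by (rule act_\<phi>[OF V cr c(1)])
  finally show ?thesis
    unfolding edge_val_def mon_add mon_var by (simp add: algebra_simps)
qed

text \<open>The \<open>al\<close> term contains the factor \<open>x' y'\<close> and lies in the
  ideal. Expanding the \<beta> term by the cocycle condition leaves an expression that is unchanged
  when the two pairs are exchanged, by symmetry of \<beta>; such pairs impose no condition on
  \<open>al\<close>.\<close>

lemma edge_val_disjoint: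
  assumes k: "Poly_Mapping.keys k \<subseteq> V" and V: "x \<in> V" "y \<in> V" "x' \<in> V" "y' \<in> V" and cr: "cross x y" "cross x' y'"
  shows "edge_val (k + Poly_Mapping.single x' 1 + Poly_Mapping.single y' 1) x y =
    edge_val (k + Poly_Mapping.single x 1 + Poly_Mapping.single y 1) x' y'"
proof -
  have F: "edge_val (k + Poly_Mapping.single x' 1 + Poly_Mapping.single y' 1) x y =
     - face_part (monomial k * \<beta> (X x' * X y') (X x * X y)) - \<beta> (monomial k) ((X x' * X y') * (X x * X y))"
    if V: "x \<in> V" "y \<in> V" "x' \<in> V" "y' \<in> V" and cr: "cross x y" "cross x' y'" for x y x' y'
  proof -
    have c: "monomial k \<in> carrier PV" "X x' * X y' \<in> carrier PV" "X x * X y \<in> carrier PV" "al x y \<in> carrier PV"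
      using k V al_closed by (auto intro!: poly_algebra_single poly_var_closed poly_algebra_mult)
    have "face_part ((monomial k * al x y) * (X x' * X y')) = 0"
      by (rule poly_mult_I[OF poly_algebra_mult[OF c(1,4)] c(2) edge_I[OF cr(2)]])
    moreover have e: "monomial k * X x' * X y' * al x y = (monomial k * al x y) * (X x' * X y')" by (simp add: ac_simps)
    ultimately have "edge_val (k + Poly_Mapping.single x' 1 + Poly_Mapping.single y' 1) x y = - \<beta> (monomial k * (X x' * X y')) (X x * X y)"
      unfolding edge_val_def mon_add mon_var e by (simp add: mult.assoc[symmetric])
    then show ?thesis using \<beta>_cocycle[OF c(1,2,3) edge_I[OF cr(1)]] by simp
  qed
  have "\<beta> (X x' * X y') (X x * X y) = \<beta> (X x * X y) (X x' * X y')"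
    by (rule \<beta>_sym) (use V in \<open>auto intro!: poly_var_closed poly_algebra_mult\<close>)
  then show ?thesis
    unfolding F[OF V cr] F[OF V(3,4,1,2) cr(2,1)] by (simp add: mult.commute)
qed

text \<open>Two crossing pairs dividing the same monomial share a diagonal or are disjoint, and
  either case is a single exchange: the cofactors have a common part \<open>j\<close> and differ by
  the exchanged variables.\<close>

lemma edge_val_indep:
  assumes k: "Poly_Mapping.keys k \<subseteq> V" "Poly_Mapping.keys k' \<subseteq> V"
    and V: "x \<in> V" "y \<in> V" "x' \<in> V" "y' \<in> V" and cr: "cross x y" "cross x' y'"
    and eq: "k + Poly_Mapping.single x 1 + Poly_Mapping.single y 1 = k' + Poly_Mapping.single x' 1 + Poly_Mapping.single y' 1"
  shows "edge_val k x y = edge_val k' x' y'"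
proof -
  have share: "edge_val k x y = edge_val k' x y'"
    if k: "Poly_Mapping.keys k \<subseteq> V" "Poly_Mapping.keys k' \<subseteq> V" and V: "x \<in> V" "y \<in> V" "y' \<in> V" and cr: "cross x y" "cross x y'"
      and eq: "k + Poly_Mapping.single x 1 + Poly_Mapping.single y 1 = k' + Poly_Mapping.single x 1 + Poly_Mapping.single y' 1"
    for k k' x y y'
  proof -
    have "k + Poly_Mapping.single y 1 + Poly_Mapping.single x 1 = k' + Poly_Mapping.single y' 1 + Poly_Mapping.single x 1"
      using eq by (simp only: ac_simps)
    then have eq': "k + Poly_Mapping.single y 1 = k' + Poly_Mapping.single y' 1" by (simp only: add_right_cancel)
    show ?thesis
    proof (cases "y = y'")
      case True
      then show ?thesis using eq' by simp
    next
      case False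
      have l: "Poly_Mapping.lookup k v + (if y = v then 1 else 0) = Poly_Mapping.lookup k' v + (if y' = v then 1 else 0)" for v
        using arg_cong[OF eq', of "\<lambda>m. Poly_Mapping.lookup m v"] by (auto simp: lookup_add lookup_single when_def split: if_splits)
      define j where "j = k - Poly_Mapping.single y' 1"
      have kj: "k = j + Poly_Mapping.single y' 1"
        using l[of y'] False by (intro poly_mapping_eqI) (auto simp: j_def lookup_add lookup_minus lookup_single when_def)
      then have "k' + Poly_Mapping.single y' 1 = j + Poly_Mapping.single y 1 + Poly_Mapping.single y' 1"
        using eq' by (simp only: ac_simps)
      then have "k' = j + Poly_Mapping.single y 1" by (simp only: add_right_cancel)
      moreover have "Poly_Mapping.keys j \<subseteq> V" using k(1) unfolding kj keys_add_nat by simp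
      ultimately show ?thesis using edge_val_share[OF _ V cr] kj by simp
    qed
  qed
  consider "x = x'" | "x = y'" | "y = x'" | "y = y'" | "x \<noteq> x'" "x \<noteq> y'" "y \<noteq> x'" "y \<noteq> y'" by blast
  then show ?thesis
  proof cases
    case 1
    then show ?thesis using share[OF k V(1,2,4) cr(1)] cr eq by simp
  next
    case 2
    then show ?thesis using share[OF k V(1,2,3) cr(1)] cr cross_sym eq edge_val_sym[of k' x' y'] by (simp add: ac_simps)
  next
    case 3
    then show ?thesis using share[OF k V(2,1,4)] cr cross_sym eq edge_val_sym[of k x y] by (simp add: ac_simps)
  next
    case 4
    then show ?thesis using share[OF k V(2,1,3)] cr cross_sym eq edge_val_sym[of k x y] edge_val_sym[of k' x' y'] by (simp add: ac_simps)
  next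
    case 5
    have ne: "x' \<noteq> y'" "x \<noteq> y" using cr cross_irrefl by blast+
    have l: "Poly_Mapping.lookup k v + (if x = v then 1 else 0) + (if y = v then 1 else 0) =
        Poly_Mapping.lookup k' v + (if x' = v then 1 else 0) + (if y' = v then 1 else 0)" for v
      using arg_cong[OF eq, of "\<lambda>m. Poly_Mapping.lookup m v"] by (auto simp: lookup_add lookup_single when_def split: if_splits)
    define j where "j = k - Poly_Mapping.single x' 1 - Poly_Mapping.single y' 1"
    have kj: "k = j + Poly_Mapping.single x' 1 + Poly_Mapping.single y' 1"
      using l[of y'] l[of x'] 5 ne by (intro poly_mapping_eqI) (auto simp: j_def lookup_add lookup_minus lookup_single when_def)
    then have "k' + (Poly_Mapping.single x' 1 + Poly_Mapping.single y' 1) =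
        (j + Poly_Mapping.single x 1 + Poly_Mapping.single y 1) + (Poly_Mapping.single x' 1 + Poly_Mapping.single y' 1)"
      using eq by (simp add: ac_simps)
    then have "k' = j + Poly_Mapping.single x 1 + Poly_Mapping.single y 1" by simp
    moreover have "Poly_Mapping.keys j \<subseteq> V" using k(1) unfolding kj keys_add_nat by simp
    ultimately show ?thesis using edge_val_disjoint[OF _ V cr] kj by simp
  qed
qed

definition nonface :: "('v \<Rightarrow>\<^sub>0 nat) \<Rightarrow> bool" where "nonface m \<longleftrightarrow> Poly_Mapping.keys m \<subseteq> V \<and> Poly_Mapping.keys m \<notin> K"

lemma nonface_split:
  assumes "nonface m"
  obtains k x y where "m = k + Poly_Mapping.single x 1 + Poly_Mapping.single y 1" "x \<in> V" "y \<in> V" "cross x y"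
    "Poly_Mapping.keys k \<subseteq> V"
proof -
  obtain x y where xy: "x \<in> Poly_Mapping.keys m" "y \<in> Poly_Mapping.keys m" "cross x y"
    using assms by (auto simp: nonface_def K_def)
  then have ne: "x \<noteq> y" using cross_irrefl by blast
  define k where "k = m - Poly_Mapping.single x 1 - Poly_Mapping.single y 1"
  have m: "m = k + Poly_Mapping.single x 1 + Poly_Mapping.single y 1"
    using xy ne by (intro poly_mapping_eqI) (auto simp: k_def lookup_add lookup_minus lookup_single when_def in_keys_iff)
  have "Poly_Mapping.keys k \<subseteq> V" using assms unfolding nonface_def m keys_add_nat by simp
  moreover have "x \<in> V" "y \<in> V" using xy assms by (auto simp: nonface_def)
  ultimately show ?thesis using that[OF m _ _ xy(3)] by blast
qed

definition "mon_split m = (SOME e. \<exists>k x y. e = edge_val k x y \<and> m = k + Poly_Mapping.single x 1 + Poly_Mapping.single y 1 \<and>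
   x \<in> V \<and> y \<in> V \<and> cross x y \<and> Poly_Mapping.keys k \<subseteq> V)"

lemma mon_split_eq:
  assumes "x \<in> V" "y \<in> V" "cross x y" "Poly_Mapping.keys k \<subseteq> V"
  shows "mon_split (k + Poly_Mapping.single x 1 + Poly_Mapping.single y 1) = edge_val k x y"
  unfolding mon_split_def
proof (rule some_equality)
  let ?m = "k + Poly_Mapping.single x 1 + Poly_Mapping.single y 1"
  show "\<exists>k' x' y'. edge_val k x y = edge_val k' x' y' \<and> ?m = k' + Poly_Mapping.single x' 1 + Poly_Mapping.single y' 1 \<and>
      x' \<in> V \<and> y' \<in> V \<and> cross x' y' \<and> Poly_Mapping.keys k' \<subseteq> V" using assms by blast
  fix e assume "\<exists>k' x' y'. e = edge_val k' x' y' \<and> ?m = k' + Poly_Mapping.single x' 1 + Poly_Mapping.single y' 1 \<and>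
      x' \<in> V \<and> y' \<in> V \<and> cross x' y' \<and> Poly_Mapping.keys k' \<subseteq> V"
  then obtain k' x' y' where e: "e = edge_val k' x' y'" and m: "?m = k' + Poly_Mapping.single x' 1 + Poly_Mapping.single y' 1"
    and V': "x' \<in> V" "y' \<in> V" "cross x' y'" "Poly_Mapping.keys k' \<subseteq> V" by blast
  show "e = edge_val k x y"
    unfolding e by (rule edge_val_indep[OF assms(4) V'(4) assms(1,2) V'(1,2) assms(3) V'(3) m, symmetric])
qed

text \<open>A crossing pair of \<open>m\<close> also serves for \<open>a + m\<close>, so both values
  use the same pair, and the equation is the cocycle condition for \<open>a\<close>, the cofactor
  and the generator.\<close>

lemma mon_split_mult:
  assumes m: "nonface m" and a: "Poly_Mapping.keys a \<subseteq> V"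
  shows "mon_split m \<in> carrier PV" "face_part (mon_split m) = mon_split m"
    "\<beta> (monomial a) (monomial m) = face_part (monomial a * mon_split m) - mon_split (a + m)"
proof -
  obtain k x y where mk: "m = k + Poly_Mapping.single x 1 + Poly_Mapping.single y 1" and xy: "x \<in> V" "y \<in> V" "cross x y"
    and k: "Poly_Mapping.keys k \<subseteq> V" using nonface_split[OF m] by metis
  have L: "mon_split m = edge_val k x y" unfolding mk by (rule mon_split_eq[OF xy k])
  show "mon_split m \<in> carrier PV" "face_part (mon_split m) = mon_split m" unfolding L using edge_val_closed k xy by auto
  have am: "a + m = (a + k) + Poly_Mapping.single x 1 + Poly_Mapping.single y 1" unfolding mk by (simp add: ac_simps)
  have ideal_split: "mon_split (a + m) = edge_val (a + k) x y" unfolding am by (rule mon_split_eq[OF xy]) (use a k in \<open>simp add: keys_add_nat\<close>)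
  have c: "monomial a \<in> carrier PV" "monomial k \<in> carrier PV" "al x y \<in> carrier PV" "X x * X y \<in> carrier PV"
    using a k xy al_closed by (auto intro!: poly_algebra_single poly_var_closed poly_algebra_mult)
  have "face_part (monomial a * edge_val k x y) = face_part (monomial a * monomial k * al x y) - (\<beta> (monomial a * monomial k) (X x * X y) - \<beta> (monomial a) (monomial k * (X x * X y)))"
    unfolding edge_val_def right_diff_distrib face_part_minus
    using c \<beta>_cocycle[OF c(1,2,4) edge_I[OF xy(3)]] by (simp add: fp_mult2)
  moreover have "monomial m = monomial k * (X x * X y)" unfolding mk mon_add mon_var by (simp add: mult.assoc)
  ultimately show "\<beta> (monomial a) (monomial m) = face_part (monomial a * mon_split m) - mon_split (a + m)"
    unfolding L ideal_split by (simp add: edge_val_def[of "a + k"] mon_add)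
qed

definition "ideal_split i = (\<Sum>m\<in>Poly_Mapping.keys i. sc (Poly_Mapping.lookup i m) (mon_split m))"

lemma ideal_split_superset: "finite M \<Longrightarrow> Poly_Mapping.keys i \<subseteq> M \<Longrightarrow> ideal_split i = (\<Sum>m\<in>M. sc (Poly_Mapping.lookup i m) (mon_split m))"
  unfolding ideal_split_def by (rule sum.mono_neutral_left) (auto simp: in_keys_iff)

lemma ideal_split_add: "ideal_split (i + j) = ideal_split i + ideal_split j"
proof -
  let ?M = "Poly_Mapping.keys i \<union> Poly_Mapping.keys j"
  have "ideal_split (i + j) = (\<Sum>m\<in>?M. sc (Poly_Mapping.lookup (i + j) m) (mon_split m))"
    by (rule ideal_split_superset) (use Poly_Mapping.keys_add[of i j] in auto)
  then show ?thesis
    by (simp add: ideal_split_superset[of ?M i] ideal_split_superset[of ?M j] lookup_add sc_simps sum.distrib)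
qed

lemma ideal_split_sc: "ideal_split (sc c i) = sc c (ideal_split i)"
proof -
  have "ideal_split (sc c i) = (\<Sum>m\<in>Poly_Mapping.keys i. sc (Poly_Mapping.lookup (sc c i) m) (mon_split m))"
    by (rule ideal_split_superset) (auto simp: in_keys_iff lookup_sc)
  then show ?thesis by (simp add: ideal_split_def lookup_sc sc_simps(5)[symmetric] sum_distrib_left)
qed

lemma ideal_split_mon: "ideal_split (monomial m) = mon_split m"
  by (simp add: ideal_split_def)

lemma ideal_split_zero: "ideal_split 0 = 0"
  by (simp add: ideal_split_def)

lemma ideal_split_sum: "ideal_split (sum F M) = (\<Sum>m\<in>M. ideal_split (F m))"
  by (induction M rule: infinite_finite_induct) (auto simp: ideal_split_zero ideal_split_add)

lemma nonface_keys: "i \<in> carrier PV \<Longrightarrow> face_part i = 0 \<Longrightarrow> m \<in> Poly_Mapping.keys i \<Longrightarrow> nonface m"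
  using lookup_face_part[of i m] by (auto simp: nonface_def poly_algebra_carrier in_keys_iff)

lemma \<beta>_zero_right: "x \<in> carrier PV \<Longrightarrow> \<beta> x 0 = 0"
  using \<beta>_sc_right[OF poly_zero_closed, of x 0] by (simp add: sc_simps)

lemma \<beta>_sum_right: "x \<in> carrier PV \<Longrightarrow> (\<And>m. m \<in> M \<Longrightarrow> F m \<in> carrier PV) \<Longrightarrow> \<beta> x (sum F M) = (\<Sum>m\<in>M. \<beta> x (F m))"
  by (induction M rule: infinite_finite_induct) (auto simp: \<beta>_zero_right \<beta>_add_right poly_sum_closed)

lemma face_part_sum: "face_part (sum F M) = (\<Sum>m\<in>M. face_part (F m))"
  by (induction M rule: infinite_finite_induct) (auto simp: face_part_0 face_part_add)

text \<open>Both sides of the splitting equation are linear in \<open>x\<close> and in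
  \<open>i\<close>, which reduces it to monomials, where it is
  \<open>mon_split_mult\<close>.\<close>

lemma ideal_split_splitting: "P.splitting \<beta> ideal_split"
  unfolding P.splitting_def
proof (intro conjI ballI allI impI)
  fix i assume i: "i \<in> carrier PV" and "P.nf i = 0"
  then have i0: "face_part i = 0" by (simp add: nf_eq)
  note nk = nonface_keys[OF i i0]
  have c: "mon_split m \<in> carrier PV" "face_part (mon_split m) = mon_split m" if "m \<in> Poly_Mapping.keys i" for m
    using mon_split_mult(1,2)[OF nk[OF that], of 0] by auto
  show Lc: "ideal_split i \<in> carrier PV"
    unfolding ideal_split_def by (rule poly_sum_closed) (simp add: poly_smult_closed c)
  show "P.nf (ideal_split i) = ideal_split i"
    unfolding nf_eq[OF Lc] unfolding ideal_split_def face_part_sum by (simp add: face_part_sc c)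
  show "ideal_split (sc c i) = sc c (ideal_split i)" for c by (rule ideal_split_sc)
  fix x assume x: "x \<in> carrier PV"
  have "\<beta> x i = face_part (x * ideal_split i) - ideal_split (x * i)"
    using x
  proof (induction rule: poly_induct_single)
    case zero
    then show ?case using \<beta>_sc[OF poly_zero_closed i, of 0] by (simp add: face_part_0 ideal_split_zero)
  next
    case (step a k q)
    have a: "monomial a \<in> carrier PV" using step(1) by (rule poly_algebra_single)
    have mc: "monomial m \<in> carrier PV" if "m \<in> Poly_Mapping.keys i" for m
      using nk[OF that] by (intro poly_algebra_single) (simp add: nonface_def)
    have isum: "i = (\<Sum>m\<in>Poly_Mapping.keys i. sc (Poly_Mapping.lookup i m) (monomial m))" using poly_sum_monomials[of i] by simp
    have 1: "\<beta> (monomial a) i = (\<Sum>m\<in>Poly_Mapping.keys i. sc (Poly_Mapping.lookup i m) (\<beta> (monomial a) (monomial m)))"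
    proof -
      have "\<beta> (monomial a) i = \<beta> (monomial a) (\<Sum>m\<in>Poly_Mapping.keys i. sc (Poly_Mapping.lookup i m) (monomial m))" using isum by simp
      also have "\<dots> = (\<Sum>m\<in>Poly_Mapping.keys i. \<beta> (monomial a) (sc (Poly_Mapping.lookup i m) (monomial m)))"
        by (rule \<beta>_sum_right[OF a]) (simp add: poly_smult_closed mc)
      finally show ?thesis using \<beta>_sc_right[OF mc a] by simp
    qed
    have 2: "ideal_split (monomial a * i) = (\<Sum>m\<in>Poly_Mapping.keys i. sc (Poly_Mapping.lookup i m) (mon_split (a + m)))"
    proof -
      have "monomial a * i = monomial a * (\<Sum>m\<in>Poly_Mapping.keys i. sc (Poly_Mapping.lookup i m) (monomial m))" using isum by simp
      also have "\<dots> = (\<Sum>m\<in>Poly_Mapping.keys i. sc (Poly_Mapping.lookup i m) (monomial (a + m)))"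
        by (simp add: sum_distrib_left mon_add mult.left_commute)
      finally have "ideal_split (monomial a * i) = ideal_split (\<Sum>m\<in>Poly_Mapping.keys i. sc (Poly_Mapping.lookup i m) (monomial (a + m)))" by simp
      then show ?thesis unfolding ideal_split_sum by (simp only: ideal_split_sc ideal_split_mon)
    qed
    have 3: "face_part (monomial a * ideal_split i) = (\<Sum>m\<in>Poly_Mapping.keys i. sc (Poly_Mapping.lookup i m) (face_part (monomial a * mon_split m)))"
      unfolding ideal_split_def sum_distrib_left face_part_sum
      by (simp add: face_part_sc[symmetric] mult.left_commute)
    have "\<beta> (monomial a) i = face_part (monomial a * ideal_split i) - ideal_split (monomial a * i)"
      unfolding 1 2 3 sum_subtractf[symmetric]
      by (rule sum.cong[OF refl]) (simp add: mon_split_mult(3)[OF nk step(1)] sc_simps)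
    moreover have "Poly_Mapping.single a k = sc k (monomial a)" by (simp add: mult_single)
    moreover have "\<beta> (sc k (monomial a) + q) i = sc k (\<beta> (monomial a) i) + \<beta> q i"
      using a step(2) i by (simp add: \<beta>_add \<beta>_sc poly_smult_closed)
    moreover have "face_part ((sc k (monomial a) + q) * ideal_split i) = sc k (face_part (monomial a * ideal_split i)) + face_part (q * ideal_split i)"
      by (simp add: distrib_right face_part_add mult.assoc face_part_sc)
    moreover have "ideal_split ((sc k (monomial a) + q) * i) = sc k (ideal_split (monomial a * i)) + ideal_split (q * i)"
      by (simp add: distrib_right ideal_split_add mult.assoc ideal_split_sc)
    ultimately show ?case using step(3) by (simp only: sc_simps) (simp add: algebra_simps)
  qed
  then show "\<beta> x i = P.nf (x * ideal_split i) - ideal_split (x * i)"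
    using x Lc by (simp add: nf_eq poly_algebra_mult)
next
  fix i j show "ideal_split (i + j) = ideal_split i + ideal_split j" by (rule ideal_split_add)
qed

end

definition "dn x (c :: 'v \<Rightarrow> int) = c(x := c x - 1)"

lemma dn_up: "dn x (up x c) = c" "up x (dn x c) = c"
  by (auto simp: dn_def up_def)

lemma live_up: "live (up z d) \<Longrightarrow> live d \<longleftrightarrow> d z \<ge> 0"
proof
  assume l: "live (up z d)" and z: "d z \<ge> 0"
  have "d v \<ge> 0" for v
    using l z by (cases "v = z") (auto simp: live_def up_def split: if_splits)
  moreover have "{v. d v > 0} \<subseteq> {v. up z d v > 0}" by (auto simp: up_def)
  then have "{v. d v > 0} \<in> K" using l K_down unfolding live_def by blast
  ultimately show "live d" by (simp add: live_def)
qed (simp add: live_def)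

text \<open>A potential is chosen in every degree and the potentials are assembled into polynomials
  \<open>al x y\<close>. Only finitely many degrees carry a nonzero obstruction; taking the zero
  potential in the others keeps the sums finite.\<close>

lemma splitting_exists:
  assumes CL: "\<And>c T. coherent c T \<Longrightarrow> \<exists>\<alpha>. potential c T \<alpha>"
  shows "\<exists>\<Lambda>. P.splitting \<beta> \<Lambda>"
proof -
  define T where "T c x y z = deg_coeff (\<phi> x y z) (up x (up y (up z c)))" for c x y z
  define C where "C = {c. \<exists>x\<in>V. \<exists>y\<in>V. \<exists>z\<in>V. T c x y z \<noteq> 0}"
  define \<alpha> where "\<alpha> c = (if c \<in> C then (SOME \<alpha>. potential c (T c) \<alpha>) else (\<lambda>x y. 0))" for c
  have pot: "potential c (T c) (\<alpha> c)" for c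
  proof (cases "c \<in> C")
    case True
    have "coherent c (T c)" using \<phi>_coherent[of c] by (simp add: T_def[abs_def])
    then show ?thesis using True someI_ex[OF CL[of c "T c"]] by (simp add: \<alpha>_def)
  next
    case False
    then show ?thesis by (auto simp: \<alpha>_def potential_def C_def)
  qed
  have finC: "finite C"
  proof (rule finite_subset)
    show "C \<subseteq> (\<Union>x\<in>V. \<Union>y\<in>V. \<Union>z\<in>V. (\<lambda>m. dn z (dn y (dn x (deg_fun m)))) ` Poly_Mapping.keys (\<phi> x y z))"
    proof
      fix c assume "c \<in> C"
      then obtain x y z where xyz: "x \<in> V" "y \<in> V" "z \<in> V" and nz: "T c x y z \<noteq> 0" by (auto simp: C_def)
      then obtain m where m: "up x (up y (up z c)) = deg_fun m" by (auto simp: T_def deg_coeff_def split: if_splits)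
      then have "m \<in> Poly_Mapping.keys (\<phi> x y z)" using nz by (simp add: T_def in_keys_iff)
      moreover have "c = dn z (dn y (dn x (deg_fun m)))" by (simp add: m[symmetric] dn_up)
      ultimately show "c \<in> (\<Union>x\<in>V. \<Union>y\<in>V. \<Union>z\<in>V. (\<lambda>m. dn z (dn y (dn x (deg_fun m)))) ` Poly_Mapping.keys (\<phi> x y z))"
        using xyz by blast
    qed
  qed (simp add: finite_V)
  define M where "M x y = {m. Poly_Mapping.keys m \<in> K \<and> dn x (dn y (deg_fun m)) \<in> C}" for x y
  have finM: "finite (M x y)" for x y
  proof (rule finite_imageD)
    show "finite ((\<lambda>m. dn x (dn y (deg_fun m))) ` M x y)" by (rule finite_subset[OF _ finC]) (auto simp: M_def)
    show "inj_on (\<lambda>m. dn x (dn y (deg_fun m))) (M x y)"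
      by (rule inj_onI) (metis dn_up(2) deg_fun_inject)
  qed
  define al where "al x y = (\<Sum>m\<in>M x y. Poly_Mapping.single m (\<alpha> (dn x (dn y (deg_fun m))) x y))" for x y
  have dn_commute: "dn x (dn y c) = dn y (dn x c)" for x y c by (auto simp: dn_def)
  have \<alpha>_sym: "\<alpha> c x y = \<alpha> c y x" for c x y using pot[of c] by (simp add: potential_def)
  have l_al: "Poly_Mapping.lookup (al x y) m = (if Poly_Mapping.keys m \<in> K then \<alpha> (dn x (dn y (deg_fun m))) x y else 0)" for x y m
  proof -
    have "Poly_Mapping.lookup (al x y) m = (if m \<in> M x y then \<alpha> (dn x (dn y (deg_fun m))) x y else 0)"
      using finM[of x y] by (simp add: al_def lookup_sum lookup_single when_def)
    then show ?thesis by (auto simp: M_def \<alpha>_def)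
  qed
  have deg_coeff_al: "deg_coeff (al x y) (up x (up y c)) = (if live (up x (up y c)) then \<alpha> c x y else 0)" for x y c
  proof (cases "\<exists>m. up x (up y c) = deg_fun m")
    case True
    then obtain m where m: "up x (up y c) = deg_fun m" by blast
    have "dn x (dn y (deg_fun m)) = c" by (simp add: m[symmetric] dn_up up_commute[of x y])
    then show ?thesis by (simp add: m l_al live_deg_fun)
  next
    case False
    then show ?thesis by (auto simp: deg_coeff_def live_iff)
  qed
  show ?thesis
  proof (rule exI, rule ideal_split_splitting)
    show "al x y = al y x" for x y
      by (rule poly_mapping_eqI) (simp add: l_al dn_commute[of x y] \<alpha>_sym[of _ x y])
    show "al x y \<in> carrier PV" for x y
      unfolding poly_algebra_carrier by (auto simp: in_keys_iff[of _ "al x y"] l_al dest!: K_sub split: if_splits)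
    fix x y z assume V: "x \<in> V" "y \<in> V" "z \<in> V" and cr: "cross x y" "cross x z"
    show "\<phi> x y z = face_part (X z * al x y) - face_part (X y * al x z)"
    proof (cases "y = z")
      case True
      then show ?thesis by (simp add: \<phi>_def)
    next
      case False
      have ne: "x \<noteq> y" "x \<noteq> z" using cr cross_irrefl by auto
      show ?thesis
      proof (rule deg_coeff_eqI)
        fix m
        define c where "c = dn z (dn y (dn x (deg_fun m)))"
        have D: "deg_fun m = up x (up y (up z c))" by (simp add: c_def dn_up)
        have D1: "up x (up y (up z c)) = up z (up x (up y c))" and D2: "up x (up y (up z c)) = up y (up x (up z c))"
          by (simp_all add: up_commute)
        \<comment> \<open>As \<open>x\<close>, \<open>y\<close>, \<open>z\<close> are distinct, the
          entry of \<open>up x (up y c)\<close> at \<open>z\<close> is \<open>c z\<close>, whose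
          sign decides liveness by \<open>live_up\<close>; this is the condition in
          \<open>potential\<close>.\<close>
        have 1: "deg_coeff (face_part (X z * al x y)) (up x (up y (up z c))) =
            (if live (up x (up y (up z c))) \<and> c z \<ge> 0 then \<alpha> c x y else 0)"
          using live_up[of z "up x (up y c)"] deg_coeff_act[of z "al x y" "up x (up y c)"] deg_coeff_al[of x y c] ne False
          unfolding D1 by (simp add: up_def)
        have 2: "deg_coeff (face_part (X y * al x z)) (up x (up y (up z c))) =
            (if live (up x (up y (up z c))) \<and> c y \<ge> 0 then \<alpha> c x z else 0)"
          using live_up[of y "up x (up z c)"] deg_coeff_act[of y "al x z" "up x (up z c)"] deg_coeff_al[of x z c] ne False
          unfolding D2 by (simp add: up_def)
        show "deg_coeff (\<phi> x y z) (deg_fun m) = deg_coeff (face_part (X z * al x y) - face_part (X y * al x z)) (deg_fun m)"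
          unfolding D deg_coeff_minus 1 2
        proof (cases "live (up x (up y (up z c)))")
          case True
          then have "T c x y z = (if c z \<ge> 0 then \<alpha> c x y else 0) - (if c y \<ge> 0 then \<alpha> c x z else 0)"
            using pot[of c] V cr unfolding potential_def by blast
          then show "deg_coeff (\<phi> x y z) (up x (up y (up z c))) = (if live (up x (up y (up z c))) \<and> c z \<ge> 0 then \<alpha> c x y else 0) -
            (if live (up x (up y (up z c))) \<and> c y \<ge> 0 then \<alpha> c x z else 0)"
            using True by (simp add: T_def)
        qed (simp add: deg_coeff_not_live[OF \<phi>_nf[OF V]])
      qed
    qed
  qed
qed

end

theorem T2_SR_trivial:
  assumes "\<And>c T. coherent c T \<Longrightarrow> \<exists>\<alpha>. potential c T \<alpha>"
  shows "carrier (T2 SR) = {\<zero>\<^bsub>T2 SR\<^esub>}"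
  by (rule P.T2_trivial) (rule splitting_exists[OF _ assms])

end

section \<open>Solving the equations of one degree\<close>

context flag_complex
begin

definition ups :: "'v set \<Rightarrow> ('v \<Rightarrow> int) \<Rightarrow> 'v \<Rightarrow> int" where
  "ups S c = (\<lambda>v. if v \<in> S then c v + 1 else c v)"

lemma ups3: "x \<noteq> y \<Longrightarrow> x \<noteq> z \<Longrightarrow> y \<noteq> z \<Longrightarrow> up x (up y (up z c)) = ups {x, y, z} c"
  by (auto simp: up_def ups_def)

lemma ups4: "w \<notin> {x, y, z} \<Longrightarrow> x \<noteq> y \<Longrightarrow> x \<noteq> z \<Longrightarrow> y \<noteq> z \<Longrightarrow> up w (up x (up y (up z c))) = ups {w, x, y, z} c"
  by (auto simp: up_def ups_def)

lemma live_ups: "live (ups S c) \<longleftrightarrow> (\<forall>v. v \<notin> S \<longrightarrow> c v \<ge> 0) \<and> (\<forall>v\<in>S. c v \<ge> -1) \<and>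
    {v. c v > 0} \<union> {v\<in>S. c v \<ge> 0} \<in> K"
proof -
  have "{v. ups S c v > 0} = {v. c v > 0} \<union> {v\<in>S. c v \<ge> 0}" by (auto simp: ups_def)
  moreover have "(\<forall>v. ups S c v \<ge> 0) \<longleftrightarrow> (\<forall>v. v \<notin> S \<longrightarrow> c v \<ge> 0) \<and> (\<forall>v\<in>S. c v \<ge> -1)"
    by (auto simp: ups_def)
  ultimately show ?thesis by (simp add: live_def)
qed

lemma K_insert: "U \<in> K \<Longrightarrow> z \<in> V \<Longrightarrow> (\<And>u. u \<in> U \<Longrightarrow> \<not> cross z u) \<Longrightarrow> insert z U \<in> K"
  using cross_sym cross_irrefl by (auto simp: K_def)

lemma live_up_again: "live d \<Longrightarrow> d x > 0 \<Longrightarrow> live (up x d)"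
proof -
  assume l: "live d" and x: "d x > 0"
  have "{v. up x d v > 0} = {v. d v > 0}" using x by (auto simp: up_def)
  moreover have "up x d v \<ge> 0" for v using l by (auto simp: live_def up_def intro: order_trans)
  ultimately show "live (up x d)" using l by (simp add: live_def)
qed

text \<open>The proof distinguishes the number of elements of \<open>b = {v. c v < 0}\<close>, which contains \<open>p\<close> as soon as
  \<open>T p y z \<noteq> 0\<close>: \<open>cone\<close> settles \<open>b = {p}\<close> and \<open>conn\<close> settles \<open>b = {p, q}\<close>, while \<open>b = {p, y, z}\<close>
  contradicts \<open>T p y z \<noteq> 0\<close>.\<close>

lemma potential_exists:
  assumes cone: "\<And>p U y. p \<in> V \<Longrightarrow> U \<in> K \<Longrightarrow> p \<notin> U \<Longrightarrow> y \<in> V \<Longrightarrow> cross p y \<Longrightarrow> (\<And>u. u \<in> U \<Longrightarrow> \<not> cross y u) \<Longrightarrow>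
      \<exists>u\<in>V. cross p u \<and> (\<forall>v\<in>U. \<not> cross u v) \<and> (\<forall>z\<in>V. cross p z \<longrightarrow> (\<forall>v\<in>U. \<not> cross z v) \<longrightarrow> \<not> cross u z)"
    and conn: "\<And>p q U f z z'. p \<in> V \<Longrightarrow> q \<in> V \<Longrightarrow> cross p q \<Longrightarrow> U \<in> K \<Longrightarrow> p \<notin> U \<Longrightarrow> q \<notin> U \<Longrightarrow>
      (\<And>z z'. z \<in> V - {p, q} \<Longrightarrow> cross p z \<or> cross q z \<Longrightarrow> (\<And>v. v \<in> U \<Longrightarrow> \<not> cross z v) \<Longrightarrow>
        z' \<in> V - {p, q} \<Longrightarrow> cross p z' \<or> cross q z' \<Longrightarrow> (\<And>v. v \<in> U \<Longrightarrow> \<not> cross z' v) \<Longrightarrow> \<not> cross z z' \<Longrightarrow> f z = (f z' :: complex)) \<Longrightarrow>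
      z \<in> V - {p, q} \<Longrightarrow> cross p z \<or> cross q z \<Longrightarrow> (\<And>v. v \<in> U \<Longrightarrow> \<not> cross z v) \<Longrightarrow>
      z' \<in> V - {p, q} \<Longrightarrow> cross p z' \<or> cross q z' \<Longrightarrow> (\<And>v. v \<in> U \<Longrightarrow> \<not> cross z' v) \<Longrightarrow> f z = f z'"
    and coh: "coherent c T"
  shows "\<exists>\<alpha>. potential c T \<alpha>"
proof (cases "\<forall>x\<in>V. \<forall>y\<in>V. \<forall>z\<in>V. cross x y \<longrightarrow> cross x z \<longrightarrow> T x y z = 0")
  case True
  then have "potential c T (\<lambda>x y. 0)" by (simp add: potential_def)
  then show ?thesis by blast
next
  case False
  have T0: "T x y z = 0" if "x \<in> V" "y \<in> V" "z \<in> V" "\<not> live (up x (up y (up z c)))" for x y z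
    using coh that unfolding coherent_def by blast
  have asym: "T x z y = - T x y z" if "x \<in> V" "y \<in> V" "z \<in> V" for x y z
    using coh that unfolding coherent_def by blast
  have tri: "T x y z + T y z x + T z x y = 0" if "x \<in> V" "y \<in> V" "z \<in> V" for x y z
    using coh that unfolding coherent_def by blast
  have cyc: "T x y z + T x z w + T x w y = 0"
    if "w \<in> V" "x \<in> V" "y \<in> V" "z \<in> V" "cross x y" "cross x z" "cross x w" "live (up w (up x (up y (up z c))))" for w x y z
    using coh that unfolding coherent_def by blast
  have path: "T x w y + T y x z = 0"
    if "w \<in> V" "x \<in> V" "y \<in> V" "z \<in> V" "cross w x" "cross x y" "cross y z" "live (up w (up x (up y (up z c))))" for w x y z
    using coh that unfolding coherent_def by blast
  have self: "T x y z = 0" if "x \<in> V" "y \<in> V" "z \<in> V" "cross x y" "cross x z" "live (up x (up x (up y (up z c))))" for x y z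
    using coh that unfolding coherent_def by blast
  have diag: "T x y y = 0" if "x \<in> V" "y \<in> V" for x y using asym[of x y y] that by simp
  have neq: "x \<noteq> y" if "cross x y" for x y using that cross_irrefl by blast
  let ?U = "{v. c v > 0}"
  have live3: "live (up x (up y (up z c))) \<longleftrightarrow> (\<forall>v. v \<notin> {x, y, z} \<longrightarrow> c v \<ge> 0) \<and> (\<forall>v\<in>{x, y, z}. c v \<ge> -1) \<and>
      ?U \<union> {v\<in>{x, y, z}. c v \<ge> 0} \<in> K" if "cross x y" "cross x z" "y \<noteq> z" for x y z
    unfolding ups3[OF neq[OF that(1)] neq[OF that(2)] that(3)] by (rule live_ups)
  have K_sub': "G \<in> K" if "F \<in> K" "G \<subseteq> F" for F G using K_down that by blast
  \<comment> \<open>If \<open>c x \<ge> 0\<close>, then \<open>x\<close> is in the support of the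
    degree \<open>c + x + y + z\<close>; raising it once more keeps the degree live, and the Koszul
    condition \<open>self\<close> gives zero.\<close>
  have in_b: "T x y z = 0" if V: "x \<in> V" "y \<in> V" "z \<in> V" and cr: "cross x y" "cross x z" and x: "c x \<ge> 0" for x y z
  proof (cases "y = z \<or> \<not> live (up x (up y (up z c)))")
    case True
    then show ?thesis using diag T0 V by blast
  next
    case F: False
    then have "live (up x (up y (up z c)))" by blast
    moreover have "up x (up y (up z c)) x > 0" using x by (auto simp: up_def)
    ultimately have "live (up x (up x (up y (up z c))))" by (rule live_up_again)
    then show ?thesis using self V cr by blast
  qed
  \<comment> \<open>Otherwise the support of a live degree would contain \<open>x\<close> together
    with \<open>y\<close> or \<open>z\<close>, a crossing pair.\<close>
  have clash: "c x < 0 \<or> c y < 0 \<and> c z < 0" if "cross x y" "cross x z" "y \<noteq> z" "live (up x (up y (up z c)))" for x y z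
  proof (rule ccontr)
    assume *: "\<not> ?thesis"
    have l: "?U \<union> {v\<in>{x, y, z}. c v \<ge> 0} \<in> K" using live3[OF that(1-3)] that(4) by blast
    have "x \<in> ?U \<union> {v\<in>{x, y, z}. c v \<ge> 0}" using * by auto
    moreover have "y \<in> ?U \<union> {v\<in>{x, y, z}. c v \<ge> 0} \<or> z \<in> ?U \<union> {v\<in>{x, y, z}. c v \<ge> 0}" using * by auto
    ultimately show False using K_not_cross[OF l] that(1,2) by blast
  qed
  obtain p y0 z0 where V0: "p \<in> V" "y0 \<in> V" "z0 \<in> V" and cr0: "cross p y0" "cross p z0" and nz: "T p y0 z0 \<noteq> 0"
    using False by blast
  have yz0: "y0 \<noteq> z0" using nz diag V0 by blast
  have "live (up p (up y0 (up z0 c)))" using nz T0 V0 by blast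
  then have l0: "\<And>v. v \<notin> {p, y0, z0} \<Longrightarrow> c v \<ge> 0" "\<And>v. v \<in> {p, y0, z0} \<Longrightarrow> c v \<ge> -1"
      "?U \<union> {v\<in>{p, y0, z0}. c v \<ge> 0} \<in> K"
    using live3[OF cr0 yz0] by blast+
  have cp: "c p = -1" using in_b[OF V0 cr0] nz l0(2)[of p] by fastforce
  have UK: "?U \<in> K" by (rule K_sub'[OF l0(3)]) auto
  have UV: "?U \<subseteq> V" by (rule K_sub[OF UK])
  have c1: "c v \<ge> -1" for v using l0(1,2)[of v] by fastforce
  \<comment> \<open>Case \<open>b = {p, q}\<close>: the potential is supported on the pair
    \<open>{p, q}\<close>, and its value there has to be the common value of the
    obstructions.\<close>
  have two: "\<exists>\<alpha>. potential c T \<alpha>" if q: "q \<in> V" "cross p q" "c q < 0" and z: "z \<in> V" "cross p z" "c z \<ge> 0" "q \<noteq> z"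
    and others: "\<And>v. v \<notin> {p, q} \<Longrightarrow> c v \<ge> 0" and zU: "\<And>v. v \<in> ?U \<Longrightarrow> \<not> cross z v" for q z
  proof -
    have cq: "c q = -1" using q(3) c1[of q] by simp
    have pq: "p \<noteq> q" using neq[OF q(2)] .
    have qp: "cross q p" using cross_sym[OF q(2)] .
    \<comment> \<open>A live degree must raise both negative entries, so a triple that omits
      \<open>p\<close> or \<open>q\<close> contributes nothing.\<close>
    have Tqp: "T r x y = 0" if "r \<in> {p, q}" "x \<in> V" "y \<in> V" "x \<notin> {p, q}" "y \<notin> {p, q}" for r x y
    proof -
      obtain r' where r': "r' \<in> {p, q}" "r' \<noteq> r" using pq by blast
      have "\<not> live (up r (up x (up y c)))"
      proof
        assume "live (up r (up x (up y c)))"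
        then have "up r (up x (up y c)) r' \<ge> 0" unfolding live_def by blast
        moreover have "up r (up x (up y c)) r' = c r'" using r' that by (auto simp: up_def)
        ultimately show False using r' cp cq by auto
      qed
      then show ?thesis using T0 that V0 q by blast
    qed
    \<comment> \<open>A diagonal may cross only one of \<open>p\<close> and \<open>q\<close>, and
      the relations concern the triple based at one that it crosses; \<open>both\<close> shows that
      the two choices agree if it crosses both.\<close>
    define f where "f x = (if cross p x then T p q x else T q p x)" for x
    have liveN: "live (up p (up q (up x c)))" "live (up q (up p (up x c)))"
      if "x \<in> V - {p, q}" "\<And>v. v \<in> ?U \<Longrightarrow> \<not> cross x v" for x
    proof -
      have "insert x ?U \<in> K" using K_insert[OF UK] that by blast
      moreover have "?U \<union> {v\<in>{p, q, x}. c v \<ge> 0} = insert x ?U" using cp cq others[of x] that by auto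
      ultimately have "live (ups {p, q, x} c)" unfolding live_ups using others cp cq c1 by auto
      then show "live (up p (up q (up x c)))" "live (up q (up p (up x c)))"
        using ups3[of p q x c] that pq by (auto simp: up_commute[of q p])
    qed
    have both: "T p q x = T q p x" if x: "x \<in> V - {p, q}" "cross p x" "cross q x" for x
    proof -
      have "T x p q = 0" using in_b[of x p q] x V0 q cross_sym others[of x] by auto
      moreover have "T q x p = - T q p x" using asym x V0 q by blast
      ultimately show ?thesis using tri[of p q x] x V0 q by auto
    qed
    have live4: "live (up w (up p (up q (up x c))))"
      if "x \<in> V - {p, q}" "\<And>v. v \<in> ?U \<Longrightarrow> \<not> cross x v" "w \<in> V - {p, q}" "\<And>v. v \<in> ?U \<Longrightarrow> \<not> cross w v" "\<not> cross x w" "x \<noteq> w" for x w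
    proof -
      have "insert w (insert x ?U) \<in> K"
        by (rule K_insert[OF K_insert[OF UK]]) (use that cross_sym in auto)
      moreover have "?U \<union> {v\<in>{w, p, q, x}. c v \<ge> 0} = insert w (insert x ?U)" using cp cq others[of x] others[of w] that by auto
      ultimately have "live (ups {w, p, q, x} c)" unfolding live_ups using others cp cq c1 by auto
      then show ?thesis using ups4[of w p q x c] that pq by auto
    qed
    \<comment> \<open>Two such diagonals that do not cross can be raised together with
      \<open>p\<close> and \<open>q\<close>. If they cross a common one of these two, the relation
      is \<open>cyc\<close> based there; otherwise they are the ends of a path through
      \<open>p\<close> and \<open>q\<close>, and it is \<open>path\<close>.\<close>
    have step: "f x = f w" if x: "x \<in> V - {p, q}" "cross p x \<or> cross q x" "\<And>v. v \<in> ?U \<Longrightarrow> \<not> cross x v"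
      and w: "w \<in> V - {p, q}" "cross p w \<or> cross q w" "\<And>v. v \<in> ?U \<Longrightarrow> \<not> cross w v" and nc: "\<not> cross x w" for x w
    proof (cases "x = w")
      case False
      note l4 = live4[OF x(1,3) w(1,3) nc False]
      have xV: "x \<in> V" "w \<in> V" "x \<notin> {p, q}" "w \<notin> {p, q}" using x w by auto
      have l4': "live (up w (up q (up p (up x c))))" using l4 by (simp add: up_commute[of q p])
      have l4'': "live (up x (up p (up q (up w c))))" "live (up x (up q (up p (up w c))))"
        using live4[OF w(1,3) x(1,3)] nc False cross_sym by (auto simp: up_commute[of q p])
      consider "cross p x" "cross p w" | "cross q x" "cross q w" | "cross p x" "cross q w" | "cross q x" "cross p w"
        using x w by blast
      then show ?thesis
      proof cases
        case 1
        have "T p q x + T p x w + T p w q = 0" using cyc[of w p q x] xV V0 q 1 l4 by blast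
        then have "T p q x = T p q w" using Tqp[of p x w] asym[of p q w] xV V0 q by simp
        then show ?thesis using 1 by (simp add: f_def)
      next
        case 2
        have "T q p x + T q x w + T q w p = 0" using cyc[of w q p x] xV V0 q qp 2 l4' by blast
        then have "T q p x = T q p w" using Tqp[of q x w] asym[of q p w] xV V0 q by simp
        then show ?thesis using both[of x] both[of w] x w 2 by (auto simp: f_def)
      next
        case 3
        have "T p x q + T q p w = 0" using path[of x p q w] xV V0 q 3 l4'' cross_sym by blast
        then have "T p q x = T q p w" using asym[of p q x] xV V0 q by simp
        then show ?thesis using both[of w] w 3 by (auto simp: f_def)
      next
        case 4
        have "T p w q + T q p x = 0" using path[of w p q x] xV V0 q 4 l4 cross_sym by blast
        then have "T p q w = T q p x" using asym[of p q w] xV V0 q by simp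
        then show ?thesis using both[of x] x 4 by (auto simp: f_def)
      qed
    qed simp
    have zN: "z \<in> V - {p, q}" using z q cp by auto
    have const: "f x = T p q z" if x: "x \<in> V - {p, q}" "cross p x \<or> cross q x" "\<And>v. v \<in> ?U \<Longrightarrow> \<not> cross x v" for x
    proof -
      have "f x = f z"
        by (rule conn[OF V0(1) q(1,2) UK _ _ step x zN _ zU]) (use cp cq z in auto)
      then show ?thesis using z by (simp add: f_def)
    qed
    define \<alpha> where "\<alpha> x y = (if x = p \<and> y = q \<or> x = q \<and> y = p then T p q z else 0)" for x y
    have "potential c T \<alpha>"
      unfolding potential_def
    proof (intro conjI allI ballI impI)
      show "\<alpha> x y = \<alpha> y x" for x y by (auto simp: \<alpha>_def)
      fix x y w assume V: "x \<in> V" "y \<in> V" "w \<in> V" and cr: "cross x y" "cross x w" and l: "live (up x (up y (up w c)))"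
      show "T x y w = (if c w \<ge> 0 then \<alpha> x y else 0) - (if c y \<ge> 0 then \<alpha> x w else 0)"
      proof (cases "y = w")
        case True
        then show ?thesis using diag V by simp
      next
        case yw: False
        note L = l[unfolded live3[OF cr yw]]
        note nx = neq[OF cr(1)] neq[OF cr(2)]
        show ?thesis
        proof (cases "c x < 0")
          case False
          then have "c y < 0" "c w < 0" using clash[OF cr yw l] by auto
          then show ?thesis using in_b[OF V cr] False by simp
        next
          case True
          then have xb: "x = p \<or> x = q" using others[of x] by fastforce
          have comp: "v \<in> ?U \<Longrightarrow> \<not> cross k v" if "k \<in> {x, y, w}" "c k \<ge> 0" for k v
            using L K_not_cross[of "?U \<union> {v\<in>{x, y, w}. c v \<ge> 0}" k v] that by blast
          have val: "T x r k = T p q z" if "r \<in> {p, q}" "r \<noteq> x" "k \<in> {y, w}" "k \<notin> {p, q}" for r k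
          proof -
            have k: "k \<in> V - {p, q}" "cross x k" "c k \<ge> 0" using that V cr others by auto
            then have "f k = T p q z" using const[OF k(1)] comp[of k] that xb by blast
            moreover have "T x r k = f k"
              using that xb k both[OF k(1)] by (auto simp: f_def)
            ultimately show ?thesis by simp
          qed
          \<comment> \<open>The negative entry other than the one at \<open>x\<close> must be raised
            as well, so it is at \<open>y\<close> or \<open>w\<close>.\<close>
          have "\<exists>r. r \<in> {p, q} \<and> r \<noteq> x \<and> (r = y \<or> r = w)"
          proof -
            obtain r where r: "r \<in> {p, q}" "r \<noteq> x" using pq by blast
            then have "c r < 0" using cp cq by auto
            then have "r = y \<or> r = w" using L r(2) by fastforce
            then show ?thesis using r by blast
          qed
          then obtain r where r: "r \<in> {p, q}" "r \<noteq> x" "r = y \<or> r = w" by blast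
          have pqx: "{p, q} = {x, r}" using xb r pq by auto
          have cr': "c r < 0" using r cp cq by auto
          from r(3) show ?thesis
          proof
            assume ry: "r = y"
            then have "w \<notin> {p, q}" using pqx yw nx by auto
            then have "T x y w = T p q z" "c w \<ge> 0" using val[OF r(1,2), of w] ry others by auto
            moreover have "\<alpha> x y = T p q z" using xb r ry pq by (auto simp: \<alpha>_def)
            ultimately show ?thesis using cr' ry by simp
          next
            assume rw: "r = w"
            then have "y \<notin> {p, q}" using pqx yw nx by auto
            then have "T x w y = T p q z" "c y \<ge> 0" using val[OF r(1,2), of y] rw others by auto
            moreover have "\<alpha> x w = T p q z" using xb r rw pq by (auto simp: \<alpha>_def)
            ultimately show ?thesis using cr' rw asym[OF V(1,3,2)] by simp
          qed
        qed
      qed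
    qed
    then show ?thesis by blast
  qed
  have comp0: "\<And>v. v \<in> ?U \<Longrightarrow> \<not> cross k v" if "k \<in> {y0, z0}" "c k \<ge> 0" for k
    using K_not_cross[OF l0(3)] that by blast
  consider (b3) "c y0 < 0" "c z0 < 0" | (b2y) "c y0 < 0" "c z0 \<ge> 0" | (b2z) "c y0 \<ge> 0" "c z0 < 0" | (b1) "c y0 \<ge> 0" "c z0 \<ge> 0"
    by linarith
  then show ?thesis
  proof cases
    case b2y
    have "\<And>v. v \<notin> {p, y0} \<Longrightarrow> c v \<ge> 0" using l0(1) b2y by blast
    then show ?thesis using two[of y0 z0] V0 cr0 b2y yz0 comp0 by blast
  next
    case b2z
    have "\<And>v. v \<notin> {p, z0} \<Longrightarrow> c v \<ge> 0" using l0(1) b2z by blast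
    then show ?thesis using two[of z0 y0] V0 cr0 b2z yz0 comp0 by blast
  next
    case b3
    have cyz: "c y0 = -1" "c z0 = -1" using b3 c1[of y0] c1[of z0] by auto
    have np: "p \<noteq> y0" "p \<noteq> z0" using cr0 neq by blast+
    show ?thesis
    proof (cases "\<exists>u\<in>?U. cross p u")
      case True
      \<comment> \<open>\<open>cyc\<close> is used with \<open>u\<close> as the fourth diagonal: the
        other two triples omit \<open>y0\<close> or \<open>z0\<close>, so their degrees keep a
        negative entry and their values vanish.\<close>
      then obtain u where u: "c u > 0" "cross p u" by blast
      have uV: "u \<in> V" using UV u by blast
      have nu: "u \<notin> {p, y0, z0}" using u cp cyz by auto
      have "live (ups {u, p, y0, z0} c)"
        unfolding live_ups
      proof (intro conjI)
        have "?U \<union> {v \<in> {u, p, y0, z0}. 0 \<le> c v} = ?U" using u cp cyz by auto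
        then show "?U \<union> {v \<in> {u, p, y0, z0}. 0 \<le> c v} \<in> K" using UK by simp
      qed (use l0 c1 in auto)
      then have "live (up u (up p (up y0 (up z0 c))))" using ups4[of u p y0 z0 c] nu np yz0 by simp
      then have "T p y0 z0 + T p z0 u + T p u y0 = 0" using cyc[of u p y0 z0] uV V0 cr0 u by blast
      moreover have "T p z0 u = 0"
      proof (rule T0[OF V0(1,3) uV])
        have "up p (up z0 (up u c)) y0 < 0" using cyz np nu yz0 by (auto simp: up_def)
        then show "\<not> live (up p (up z0 (up u c)))" unfolding live_def by (meson not_less)
      qed
      moreover have "T p u y0 = 0"
      proof (rule T0[OF V0(1) uV V0(2)])
        have "up p (up u (up y0 c)) z0 < 0" using cyz np nu yz0 by (auto simp: up_def)
        then show "\<not> live (up p (up u (up y0 c)))" unfolding live_def by (meson not_less)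
      qed
      ultimately show ?thesis using nz by simp
    next
      case False
      \<comment> \<open>Nothing in the support crosses \<open>p\<close>, so \<open>p\<close> can be
        raised twice without leaving the live degrees, and \<open>self\<close> applies.\<close>
      have "insert p ?U \<in> K" by (rule K_insert[OF UK V0(1)]) (use False in blast)
      moreover have "{v. up p (up p (up y0 (up z0 c))) v > 0} = insert p ?U"
        using cp cyz np yz0 by (auto simp: up_def)
      moreover have "up p (up p (up y0 (up z0 c))) v \<ge> 0" for v
        using l0(1)[of v] cp cyz np yz0 by (auto simp: up_def)
      ultimately have "live (up p (up p (up y0 (up z0 c))))" unfolding live_def by simp
      then show ?thesis using self[OF V0 cr0] nz by blast
    qed
  next
    case b1
    have others: "c v \<ge> 0" if "v \<noteq> p" for v using l0(1)[of v] b1 that by blast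
    obtain u where u: "u \<in> V" "cross p u" "\<And>v. v \<in> ?U \<Longrightarrow> \<not> cross u v"
      and ucone: "\<And>z. z \<in> V \<Longrightarrow> cross p z \<Longrightarrow> (\<And>v. v \<in> ?U \<Longrightarrow> \<not> cross z v) \<Longrightarrow> \<not> cross u z"
      using cone[OF V0(1) UK _ V0(2) cr0(1)] cp comp0[of y0] b1 by fastforce
    \<comment> \<open>The values \<open>T p y w\<close> form an antisymmetric 1-cocycle on the
      diagonals that cross \<open>p\<close> and are compatible with the support; on a cone with apex
      \<open>u\<close> a primitive is \<open>y \<mapsto> T p y u\<close>.\<close>
    define \<alpha> where "\<alpha> x y = (if x = p then T p y u else if y = p then T p x u else 0)" for x y
    have "potential c T \<alpha>"
      unfolding potential_def
    proof (intro conjI allI ballI impI)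
      show "\<alpha> x y = \<alpha> y x" for x y by (auto simp: \<alpha>_def)
      fix x y w assume V: "x \<in> V" "y \<in> V" "w \<in> V" and cr: "cross x y" "cross x w" and l: "live (up x (up y (up w c)))"
      show "T x y w = (if c w \<ge> 0 then \<alpha> x y else 0) - (if c y \<ge> 0 then \<alpha> x w else 0)"
      proof (cases "y = w")
        case True
        then show ?thesis using diag V by simp
      next
        case yw: False
        note L = l[unfolded live3[OF cr yw]]
        note nx = neq[OF cr(1)] neq[OF cr(2)]
        have "x = p"
        proof (rule ccontr)
          assume "x \<noteq> p"
          then have "c y < 0" "c w < 0" using clash[OF cr yw l] others[of x] by auto
          then have "y = p" "w = p" using others by fastforce+
          then show False using yw by simp
        qed
        then have np: "y \<noteq> p" "w \<noteq> p" using nx by auto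
        then have c0: "c y \<ge> 0" "c w \<ge> 0" using others by auto
        have comp: "v \<in> ?U \<Longrightarrow> \<not> cross k v" if "k \<in> {y, w}" for k v
          using L K_not_cross[of "?U \<union> {v\<in>{x, y, w}. c v \<ge> 0}" k v] that c0 by blast
        have nyw: "\<not> cross y w"
          using L K_not_cross[of "?U \<union> {v\<in>{x, y, w}. c v \<ge> 0}" y w] c0 by blast
        have "T p y w = T p y u - T p w u"
        proof (cases "u = y \<or> u = w")
          case True
          then show ?thesis using diag[OF V0(1) V(2)] diag[OF V0(1) V(3)] asym[OF V0(1) V(2,3)] by auto
        next
          case False
          have nu: "\<not> cross u y" "\<not> cross u w" using ucone[of y] ucone[of w] comp V cr \<open>x = p\<close> by blast+
          have "insert u (insert y (insert w ?U)) \<in> K"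
            by (intro K_insert UK) (use V u nu nyw comp in auto)
          moreover have "?U \<union> {v \<in> {u, p, y, w}. 0 \<le> c v} = insert u (insert y (insert w ?U))"
            using cp c0 others[of u] neq[OF u(2)] by auto
          ultimately have "live (ups {u, p, y, w} c)" unfolding live_ups using others c1 by auto
          then have "live (up u (up p (up y (up w c))))" using ups4[of u p y w c] False np neq[OF u(2)] yw by auto
          then have "T p y w + T p w u + T p u y = 0" using cyc[of u p y w] V V0 u cr \<open>x = p\<close> by blast
          then show ?thesis using asym[of p y u] V V0 u by (simp add: eq_neg_iff_add_eq_0 algebra_simps)
        qed
        then show ?thesis using \<open>x = p\<close> c0 by (simp add: \<alpha>_def)
      qed
    qed
    then show ?thesis by blast
  qed
qed

end

section \<open>Diagonals of a polygon\<close>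

definition chord :: "nat \<Rightarrow> nat \<Rightarrow> nat \<times> nat" where
  "chord a b = (if a < b then (a, b) else (b, a))"

definition ends :: "nat \<times> nat \<Rightarrow> nat set" where
  "ends z = {fst z, snd z}"

text \<open>The inequalities are weak, so that a chord sharing an end with \<open>u\<close> still
  lies on a side of \<open>u\<close>.\<close>

definition inner :: "nat \<times> nat \<Rightarrow> nat \<times> nat \<Rightarrow> bool" where
  "inner u z \<longleftrightarrow> (\<forall>e\<in>ends z. fst u \<le> e \<and> e \<le> snd u)"

definition outer :: "nat \<times> nat \<Rightarrow> nat \<times> nat \<Rightarrow> bool" where
  "outer u z \<longleftrightarrow> (\<forall>e\<in>ends z. e \<le> fst u \<or> snd u \<le> e)"

lemma diagonal_less: "z \<in> diagonals n \<Longrightarrow> fst z < snd z"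
  by (auto simp: diagonals_def)

lemma ends_bounds: "z \<in> diagonals n \<Longrightarrow> e \<in> ends z \<Longrightarrow> 1 \<le> e \<and> e \<le> n"
  by (auto simp: diagonals_def ends_def)

lemma crossing_sym: "crossing d e \<Longrightarrow> crossing e d"
  by (auto simp: crossing_def)

text \<open>A side of the polygon crosses no diagonal, so crossing one certifies that a pair of
  labels is a diagonal.\<close>

lemma diagonal_crossing:
  assumes "crossing z w" "w \<in> diagonals n" "fst z \<ge> 1" "snd z \<le> n"
  shows "z \<in> diagonals n"
  using assms by (cases z) (auto simp: diagonals_def crossing_def)

lemma not_crossing_cases: "fst u < snd u \<Longrightarrow> fst z < snd z \<Longrightarrow> \<not> crossing u z \<Longrightarrow> inner u z \<or> outer u z"
  by (auto simp: crossing_def inner_def outer_def ends_def)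

text \<open>A chord crossing \<open>z\<close> has an end strictly between the ends of
  \<open>z\<close>, hence strictly inside the arc of \<open>u\<close>; as it does not cross
  \<open>u\<close>, it stays there. \<open>outer_step\<close> is the same on the other side.\<close>

lemma inner_step:
  assumes "fst u < snd u" "fst z < snd z" "fst p < snd p" "crossing z p" "\<not> crossing u p" "inner u z"
  shows "inner u p"
  using assms by (auto simp: crossing_def inner_def ends_def)

lemma outer_step:
  assumes "fst u < snd u" "fst z < snd z" "fst p < snd p" "crossing z p" "\<not> crossing u p" "outer u z"
  shows "outer u p"
  using assms by (auto simp: crossing_def outer_def ends_def)

text \<open>If \<open>u\<close> crosses none of the chords of a connected union, this union lies on one side of \<open>u\<close>.\<close>

lemma hull:
  assumes o: "fst u < snd u" "fst z < snd z" "fst p < snd p" "fst q < snd q"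
    and c: "crossing z p" "crossing p q" and nc: "\<not> crossing u z" "\<not> crossing u p" "\<not> crossing u q"
    and e: "s \<in> ends z" "t \<in> ends p \<union> ends q" "s \<noteq> t"
  shows "\<not> crossing u (chord s t)"
proof -
  have "inner u z \<and> inner u p \<and> inner u q \<or> outer u z \<and> outer u p \<and> outer u q"
    using not_crossing_cases[OF o(1,2) nc(1)] inner_step[OF o(1,2,3) c(1) nc(2)] inner_step[OF o(1,3,4) c(2) nc(3)]
      outer_step[OF o(1,2,3) c(1) nc(2)] outer_step[OF o(1,3,4) c(2) nc(3)] by blast
  then show ?thesis
    using e o(1) by (auto simp: crossing_def chord_def inner_def outer_def)
qed

lemma flag_diagonals: "flag_complex (diagonals n) crossing"
proof
  have "diagonals n \<subseteq> {0..n} \<times> {0..n}" by (auto simp: diagonals_def)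
  then show "finite (diagonals n)" by (rule finite_subset) simp
qed (auto simp: crossing_def)

lemma share_not_crossing: "fst z < snd z \<Longrightarrow> s \<in> ends z \<Longrightarrow> \<not> crossing z (chord s t)"
  by (auto simp: crossing_def chord_def ends_def)

lemma crossing_chord:
  assumes "a < b" "s \<noteq> e"
  shows "crossing (a, b) (chord s e) \<longleftrightarrow> a < e \<and> e < b \<and> (s < a \<or> b < s) \<or> a < s \<and> s < b \<and> (e < a \<or> b < e)"
  using assms by (auto simp: crossing_def chord_def)

section \<open>Chords compatible with a fixed non-crossing set\<close>

context
  fixes n :: nat and U :: "(nat \<times> nat) set"
  assumes U: "U \<subseteq> diagonals n" "\<And>u v. u \<in> U \<Longrightarrow> v \<in> U \<Longrightarrow> \<not> crossing u v"
begin

abbreviation (input) "free z \<equiv> (\<forall>u\<in>U. \<not> crossing z u)"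

text \<open>\<open>hull\<close> applied to every element of \<open>U\<close>: a chord joining ends
  of a connected union of compatible chords is compatible again.\<close>

lemma free_chord:
  assumes "z \<in> diagonals n" "p \<in> diagonals n" "q \<in> diagonals n" "crossing z p" "crossing p q"
    "free z" "free p" "free q" "s \<in> ends z" "t \<in> ends p \<union> ends q" "s \<noteq> t"
  shows "free (chord s t)"
proof
  fix u assume u: "u \<in> U"
  have "\<not> crossing u (chord s t)"
    using hull[OF diagonal_less[OF subsetD[OF U(1) u]] diagonal_less diagonal_less diagonal_less assms(4,5) _ _ _ assms(9-11)] assms(1,2,3,6,7,8) u crossing_sym
    by blast
  then show "\<not> crossing (chord s t) u" using crossing_sym by blast
qed

text \<open>The chords crossing a fixed chord \<open>p\<close> are pairs of an end on one side and an end on the other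
  side of \<open>p\<close>, and two of them do not cross iff they are comparable in the product order for which
  an extreme chord exists.\<close>

lemma cone:
  assumes p: "p \<in> diagonals n" and y: "y \<in> diagonals n" "crossing p y" "free y"
  shows "\<exists>u\<in>diagonals n. crossing p u \<and> free u \<and>
    (\<forall>z\<in>diagonals n. crossing p z \<longrightarrow> free z \<longrightarrow> \<not> crossing u z)"
proof -
  define N where "N = {z \<in> diagonals n. crossing p z \<and> free z}"
  have finN: "finite N"
    using flag_complex.finite_V[OF flag_diagonals, of n] by (simp add: N_def)
  have yN: "y \<in> N" using y by (simp add: N_def)
  \<comment> \<open>For a chord crossing \<open>p\<close>, \<open>lo\<close> is its end between the
    ends of \<open>p\<close> and \<open>hi\<close> the other one; adding \<open>n\<close> to labels
    before \<open>fst p\<close> makes \<open>hi\<close> increase along the whole opposite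
    side.\<close>
  define lo where "lo z = (if fst p < fst z then fst z else snd z)" for z :: "nat \<times> nat"
  define hi where "hi z = (if fst p < fst z then snd z else fst z + n)" for z :: "nat \<times> nat"
  \<comment> \<open>The apex will join the smallest \<open>lo\<close> to the largest
    \<open>hi\<close>, so that every chord of \<open>N\<close> is nested in it, with common ends
    allowed.\<close>
  obtain z1 where z1: "z1 \<in> N" "\<And>z. z \<in> N \<Longrightarrow> lo z1 \<le> lo z"
    using arg_min_if_finite(1)[OF finN, of lo] arg_min_least[OF finN, of _ lo] yN by (metis empty_iff)
  obtain z2 where z2: "z2 \<in> N" "\<And>z. z \<in> N \<Longrightarrow> hi z \<le> hi z2"
  proof -
    have "Max (hi ` N) \<in> hi ` N" using finN yN by (intro Max_in) auto
    then obtain z2 where "z2 \<in> N" "hi z2 = Max (hi ` N)" by force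
    then show ?thesis using that[of z2] finN by simp
  qed
  show ?thesis
  proof (cases "free p")
    case False
    \<comment> \<open>An element of \<open>U\<close> that crosses \<open>p\<close> is itself an
      apex: it crosses neither an element of \<open>U\<close> nor a chord compatible with
      \<open>U\<close>.\<close>
    then obtain u where "u \<in> U" "crossing p u" by blast
    then show ?thesis using U crossing_sym by blast
  next
    case True
    \<comment> \<open>The label behind \<open>hi z2\<close>, with the shift by \<open>n\<close>
      undone.\<close>
    define t where "t = (if fst p < fst z2 then snd z2 else fst z2)"
    have st: "lo z1 \<in> ends z1" "t \<in> ends z2" by (auto simp: lo_def t_def ends_def)
    have b1: "1 \<le> lo z1" "lo z1 \<le> n" "1 \<le> t" "t \<le> n"
      using ends_bounds[of z1 n] ends_bounds[of z2 n] st z1(1) z2(1) by (auto simp: N_def)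
    have cr: "crossing p z1" "crossing p z2" "z1 \<in> diagonals n" "z2 \<in> diagonals n" "free z1" "free z2"
      using z1(1) z2(1) by (auto simp: N_def)
    have less: "fst p < snd p" "fst z1 < snd z1" "fst z2 < snd z2" using p cr diagonal_less by auto
    have s_in: "fst p < lo z1" "lo z1 < snd p" and t_out: "t < fst p \<or> snd p < t" "hi z2 = (if t < fst p then t + n else t)"
      using cr(1,2) less by (auto simp: lo_def t_def hi_def crossing_def)
    have ne: "lo z1 \<noteq> t" using s_in t_out by auto
    let ?u = "chord (lo z1) t"
    have pu: "crossing p ?u" using s_in t_out less by (auto simp: crossing_def chord_def)
    have uD: "?u \<in> diagonals n"
      by (rule diagonal_crossing[OF crossing_sym[OF pu] p]) (use b1 in \<open>auto simp: chord_def\<close>)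
    have fu: "free ?u"
      by (rule free_chord[OF cr(3) p cr(4) crossing_sym[OF cr(1)] cr(2) cr(5) True cr(6) st(1) _ ne]) (use st in blast)
    have "\<not> crossing ?u z" if z: "z \<in> diagonals n" "crossing p z" "free z" for z
    proof -
      have zN: "z \<in> N" using z by (simp add: N_def)
      have "fst z < snd z" "1 \<le> fst z" "snd z \<le> n" using z diagonal_less by (auto simp: diagonals_def)
      moreover have "lo z1 \<le> lo z" "hi z \<le> hi z2" using z1(2) z2(2) zN by auto
      ultimately show ?thesis
        using z(2) s_in t_out b1 less unfolding lo_def[of z] hi_def[of z] crossing_def chord_def
        by (auto split: if_splits)
    qed
    then show ?thesis using pu uD fu by blast
  qed
qed

text \<open>Every chord other than \<open>p\<close>, \<open>q\<close> that crosses one of the crossing chords \<open>p\<close>, \<open>q\<close> has an end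
  \<open>s\<close> distinct from their four ends, and the two chords from \<open>s\<close> to the opposite ends of \<open>p\<close> and of
  \<open>q\<close> link it to every other such chord.\<close>

lemma hubs:
  fixes i j k l s s' :: nat
  assumes "i < j" "j < k" "k < l" "s \<notin> {i, j, k, l}" "s' \<notin> {i, j, k, l}"
  shows "\<exists>e\<in>{i, j, k, l}. \<exists>e'\<in>{i, j, k, l}.
    (crossing (i, k) (chord s e) \<or> crossing (j, l) (chord s e)) \<and>
    (crossing (i, k) (chord s' e') \<or> crossing (j, l) (chord s' e')) \<and> \<not> crossing (chord s e) (chord s' e')"
proof -
  have "t < i \<or> i < t \<and> t < j \<or> j < t \<and> t < k \<or> k < t \<and> t < l \<or> l < t" if "t \<notin> {i, j, k, l}" for t
    using that by auto
  \<comment> \<open>The first four alternatives cover \<open>s\<close> and \<open>s'\<close> in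
    equal or adjacent arcs, where one common end serves both; the last four cover opposite arcs,
    where two ends are used, chosen so that the chords to them do not cross.\<close>
  from this[OF assms(4)] this[OF assms(5)]
  have "(s < j \<or> l < s) \<and> (s' < j \<or> l < s') \<or>
      (i < s \<and> s < k) \<and> (i < s' \<and> s' < k) \<or>
      (j < s \<and> s < l) \<and> (j < s' \<and> s' < l) \<or>
      (s < i \<or> k < s) \<and> (s' < i \<or> k < s') \<or>
      (i < s \<and> s < j) \<and> (k < s' \<and> s' < l) \<or>
      (k < s \<and> s < l) \<and> (i < s' \<and> s' < j) \<or>
      (j < s \<and> s < k) \<and> (s' < i \<or> l < s') \<or>
      (s < i \<or> l < s) \<and> (j < s' \<and> s' < k)"
    using assms(1-3) by (elim disjE conjE) auto
  note regions = this
  let ?P = "\<lambda>e e'. (crossing (i, k) (chord s e) \<or> crossing (j, l) (chord s e)) \<and>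
    (crossing (i, k) (chord s' e') \<or> crossing (j, l) (chord s' e')) \<and> \<not> crossing (chord s e) (chord s' e')"
  show ?thesis
  proof -
    note cr = crossing_chord[of i k] crossing_chord[of j l]
    have P0: "?P k k" if "(s < j \<or> l < s)" "(s' < j \<or> l < s')"
    proof -
      have "crossing (i, k) (chord s k) \<or> crossing (j, l) (chord s k)" using that(1) assms by (auto simp: cr)
      moreover have "crossing (i, k) (chord s' k) \<or> crossing (j, l) (chord s' k)" using that(2) assms by (auto simp: cr)
      moreover have "\<not> crossing (chord s k) (chord s' k)" using that assms by (auto simp: crossing_def chord_def)
      ultimately show ?thesis by blast
    qed
    have P1: "?P l l" if "(i < s \<and> s < k)" "(i < s' \<and> s' < k)"
    proof -
      have "crossing (i, k) (chord s l) \<or> crossing (j, l) (chord s l)" using that(1) assms by (auto simp: cr)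
      moreover have "crossing (i, k) (chord s' l) \<or> crossing (j, l) (chord s' l)" using that(2) assms by (auto simp: cr)
      moreover have "\<not> crossing (chord s l) (chord s' l)" using that assms by (auto simp: crossing_def chord_def)
      ultimately show ?thesis by blast
    qed
    have P2: "?P i i" if "(j < s \<and> s < l)" "(j < s' \<and> s' < l)"
    proof -
      have "crossing (i, k) (chord s i) \<or> crossing (j, l) (chord s i)" using that(1) assms by (auto simp: cr)
      moreover have "crossing (i, k) (chord s' i) \<or> crossing (j, l) (chord s' i)" using that(2) assms by (auto simp: cr)
      moreover have "\<not> crossing (chord s i) (chord s' i)" using that assms by (auto simp: crossing_def chord_def)
      ultimately show ?thesis by blast
    qed
    have P3: "?P j j" if "(s < i \<or> k < s)" "(s' < i \<or> k < s')"
    proof -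
      have "crossing (i, k) (chord s j) \<or> crossing (j, l) (chord s j)" using that(1) assms by (auto simp: cr)
      moreover have "crossing (i, k) (chord s' j) \<or> crossing (j, l) (chord s' j)" using that(2) assms by (auto simp: cr)
      moreover have "\<not> crossing (chord s j) (chord s' j)" using that assms by (auto simp: crossing_def chord_def)
      ultimately show ?thesis by blast
    qed
    have P4: "?P l j" if "(i < s \<and> s < j)" "(k < s' \<and> s' < l)"
    proof -
      have "crossing (i, k) (chord s l) \<or> crossing (j, l) (chord s l)" using that(1) assms by (auto simp: cr)
      moreover have "crossing (i, k) (chord s' j) \<or> crossing (j, l) (chord s' j)" using that(2) assms by (auto simp: cr)
      moreover have "\<not> crossing (chord s l) (chord s' j)" using that assms by (auto simp: crossing_def chord_def)
      ultimately show ?thesis by blast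
    qed
    have P5: "?P j l" if "(k < s \<and> s < l)" "(i < s' \<and> s' < j)"
    proof -
      have "crossing (i, k) (chord s j) \<or> crossing (j, l) (chord s j)" using that(1) assms by (auto simp: cr)
      moreover have "crossing (i, k) (chord s' l) \<or> crossing (j, l) (chord s' l)" using that(2) assms by (auto simp: cr)
      moreover have "\<not> crossing (chord s j) (chord s' l)" using that assms by (auto simp: crossing_def chord_def)
      ultimately show ?thesis by blast
    qed
    have P6: "?P i k" if "(j < s \<and> s < k)" "(s' < i \<or> l < s')"
    proof -
      have "crossing (i, k) (chord s i) \<or> crossing (j, l) (chord s i)" using that(1) assms by (auto simp: cr)
      moreover have "crossing (i, k) (chord s' k) \<or> crossing (j, l) (chord s' k)" using that(2) assms by (auto simp: cr)
      moreover have "\<not> crossing (chord s i) (chord s' k)" using that assms by (auto simp: crossing_def chord_def)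
      ultimately show ?thesis by blast
    qed
    have P7: "?P k i" if "(s < i \<or> l < s)" "(j < s' \<and> s' < k)"
    proof -
      have "crossing (i, k) (chord s k) \<or> crossing (j, l) (chord s k)" using that(1) assms by (auto simp: cr)
      moreover have "crossing (i, k) (chord s' i) \<or> crossing (j, l) (chord s' i)" using that(2) assms by (auto simp: cr)
      moreover have "\<not> crossing (chord s k) (chord s' i)" using that assms by (auto simp: crossing_def chord_def)
      ultimately show ?thesis by blast
    qed
    have ex: "?thesis" if "?P e e'" "e \<in> {i, j, k, l}" "e' \<in> {i, j, k, l}" for e e'
      by (rule bexI[where x=e], rule bexI[where x=e'], rule that(1), rule that(3), rule that(2))
    from regions show ?thesis
    proof
      assume h: "(s < j \<or> l < s) \<and> (s' < j \<or> l < s')"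
      show ?thesis by (rule ex[OF P0[OF conjunct1[OF h] conjunct2[OF h]]]) simp_all
    next
      assume "(i < s \<and> s < k) \<and> (i < s' \<and> s' < k) \<or> (j < s \<and> s < l) \<and> (j < s' \<and> s' < l) \<or> (s < i \<or> k < s) \<and> (s' < i \<or> k < s') \<or> (i < s \<and> s < j) \<and> (k < s' \<and> s' < l) \<or> (k < s \<and> s < l) \<and> (i < s' \<and> s' < j) \<or> (j < s \<and> s < k) \<and> (s' < i \<or> l < s') \<or> (s < i \<or> l < s) \<and> (j < s' \<and> s' < k)"
      then show ?thesis
    proof
      assume h: "(i < s \<and> s < k) \<and> (i < s' \<and> s' < k)"
      show ?thesis by (rule ex[OF P1[OF conjunct1[OF h] conjunct2[OF h]]]) simp_all
    next
      assume "(j < s \<and> s < l) \<and> (j < s' \<and> s' < l) \<or> (s < i \<or> k < s) \<and> (s' < i \<or> k < s') \<or> (i < s \<and> s < j) \<and> (k < s' \<and> s' < l) \<or> (k < s \<and> s < l) \<and> (i < s' \<and> s' < j) \<or> (j < s \<and> s < k) \<and> (s' < i \<or> l < s') \<or> (s < i \<or> l < s) \<and> (j < s' \<and> s' < k)"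
      then show ?thesis
    proof
      assume h: "(j < s \<and> s < l) \<and> (j < s' \<and> s' < l)"
      show ?thesis by (rule ex[OF P2[OF conjunct1[OF h] conjunct2[OF h]]]) simp_all
    next
      assume "(s < i \<or> k < s) \<and> (s' < i \<or> k < s') \<or> (i < s \<and> s < j) \<and> (k < s' \<and> s' < l) \<or> (k < s \<and> s < l) \<and> (i < s' \<and> s' < j) \<or> (j < s \<and> s < k) \<and> (s' < i \<or> l < s') \<or> (s < i \<or> l < s) \<and> (j < s' \<and> s' < k)"
      then show ?thesis
    proof
      assume h: "(s < i \<or> k < s) \<and> (s' < i \<or> k < s')"
      show ?thesis by (rule ex[OF P3[OF conjunct1[OF h] conjunct2[OF h]]]) simp_all
    next
      assume "(i < s \<and> s < j) \<and> (k < s' \<and> s' < l) \<or> (k < s \<and> s < l) \<and> (i < s' \<and> s' < j) \<or> (j < s \<and> s < k) \<and> (s' < i \<or> l < s') \<or> (s < i \<or> l < s) \<and> (j < s' \<and> s' < k)"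
      then show ?thesis
    proof
      assume h: "(i < s \<and> s < j) \<and> (k < s' \<and> s' < l)"
      show ?thesis by (rule ex[OF P4[OF conjunct1[OF h] conjunct2[OF h]]]) simp_all
    next
      assume "(k < s \<and> s < l) \<and> (i < s' \<and> s' < j) \<or> (j < s \<and> s < k) \<and> (s' < i \<or> l < s') \<or> (s < i \<or> l < s) \<and> (j < s' \<and> s' < k)"
      then show ?thesis
    proof
      assume h: "(k < s \<and> s < l) \<and> (i < s' \<and> s' < j)"
      show ?thesis by (rule ex[OF P5[OF conjunct1[OF h] conjunct2[OF h]]]) simp_all
    next
      assume "(j < s \<and> s < k) \<and> (s' < i \<or> l < s') \<or> (s < i \<or> l < s) \<and> (j < s' \<and> s' < k)"
      then show ?thesis
    proof
      assume h: "(j < s \<and> s < k) \<and> (s' < i \<or> l < s')"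
      show ?thesis by (rule ex[OF P6[OF conjunct1[OF h] conjunct2[OF h]]]) simp_all
    next
      assume "(s < i \<or> l < s) \<and> (j < s' \<and> s' < k)"
      then show ?thesis
    proof
      assume h: "(s < i \<or> l < s)" "(j < s' \<and> s' < k)"
      show ?thesis by (rule ex[OF P7[OF h]]) simp_all
    qed
    qed
    qed
    qed
    qed
    qed
    qed
    qed
  qed
qed

text \<open>The value of \<open>f\<close> passes from \<open>z\<close> to a chord at its new end,
  from there to such a chord for \<open>z'\<close>, and on to \<open>z'\<close>. The outer two steps
  hold because the chords share an end, the middle one by \<open>hubs\<close>.\<close>

lemma connected_aux:
  assumes p: "p \<in> diagonals n" and q: "q \<in> diagonals n" and pq: "fst p < fst q" "fst q < snd p" "snd p < snd q"
    and const: "\<And>z z'. z \<in> diagonals n - {p, q} \<Longrightarrow> crossing p z \<or> crossing q z \<Longrightarrow> free z \<Longrightarrow>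
        z' \<in> diagonals n - {p, q} \<Longrightarrow> crossing p z' \<or> crossing q z' \<Longrightarrow> free z' \<Longrightarrow> \<not> crossing z z' \<Longrightarrow> f z = f z'"
    and z: "z \<in> diagonals n - {p, q}" "crossing p z \<or> crossing q z" "free z"
    and z': "z' \<in> diagonals n - {p, q}" "crossing p z' \<or> crossing q z'" "free z'"
    and fp: "free p" and fq: "free q"
  shows "f z = f z'"
proof -
  let ?E = "{fst p, fst q, snd p, snd q}"
  have less: "fst p < snd p" "fst q < snd q" using p q diagonal_less by auto
  have cpq: "crossing p q" using pq by (auto simp: crossing_def)
  \<comment> \<open>A chord with both ends among the four is \<open>p\<close>, \<open>q\<close> or a
    side of their quadrilateral, and those sides cross neither \<open>p\<close> nor
    \<open>q\<close>.\<close>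
  have new_end: "\<exists>s\<in>ends z. s \<notin> ?E" if "z \<in> diagonals n - {p, q}" "crossing p z \<or> crossing q z" for z
  proof -
    have "fst z < snd z" using that diagonal_less by auto
    moreover have "fst z \<noteq> fst p \<or> snd z \<noteq> snd p" "fst z \<noteq> fst q \<or> snd z \<noteq> snd q" using that prod_eqI by blast+
    ultimately show ?thesis using that(2) pq by (auto simp: ends_def crossing_def)
  qed
  obtain s where s: "s \<in> ends z" "s \<notin> ?E" using new_end[OF z(1,2)] by blast
  obtain s' where s': "s' \<in> ends z'" "s' \<notin> ?E" using new_end[OF z'(1,2)] by blast
  obtain e e' where e: "e \<in> ?E" "e' \<in> ?E" and
    h: "crossing p (chord s e) \<or> crossing q (chord s e)" "crossing p (chord s' e') \<or> crossing q (chord s' e')"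
      "\<not> crossing (chord s e) (chord s' e')"
    using hubs[OF pq s(2) s'(2)] by auto
  \<comment> \<open>Crossing \<open>p\<close> or \<open>q\<close> makes the chord a diagonal, its
    new end makes it different from both, and \<open>free_chord\<close> keeps it compatible with
    \<open>U\<close>.\<close>
  have hub: "chord s e \<in> diagonals n - {p, q} \<and> free (chord s e)"
    if z: "z \<in> diagonals n - {p, q}" "crossing p z \<or> crossing q z" "free z" and s: "s \<in> ends z" "s \<notin> ?E" and e: "e \<in> ?E"
      and h: "crossing p (chord s e) \<or> crossing q (chord s e)" for z s e
  proof -
    have zD: "z \<in> diagonals n" using z by blast
    have ne: "s \<noteq> e" using s e by auto
    have eE: "e \<in> ends p \<union> ends q" "e \<in> ends q \<union> ends p" using e by (auto simp: ends_def)
    have "1 \<le> s \<and> s \<le> n" "1 \<le> e \<and> e \<le> n" using ends_bounds zD p q s eE by blast+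
    then have "1 \<le> fst (chord s e)" "snd (chord s e) \<le> n" by (auto simp: chord_def)
    then have "chord s e \<in> diagonals n" using diagonal_crossing crossing_sym h p q by blast
    moreover have "chord s e \<noteq> p" "chord s e \<noteq> q" using s(2) by (auto simp: chord_def)
    moreover have "free (chord s e)"
      using z(2)
    proof
      assume "crossing p z"
      then show ?thesis
        by (intro free_chord[OF zD p q crossing_sym cpq z(3) fp fq s(1) eE(1) ne])
    next
      assume "crossing q z"
      then show ?thesis
        by (intro free_chord[OF zD q p crossing_sym crossing_sym[OF cpq] z(3) fq fp s(1) eE(2) ne])
    qed
    ultimately show ?thesis by blast
  qed
  have w: "chord s e \<in> diagonals n - {p, q}" "free (chord s e)" using hub[OF z s e(1) h(1)] by auto
  have w': "chord s' e' \<in> diagonals n - {p, q}" "free (chord s' e')" using hub[OF z' s' e(2) h(2)] by auto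
  have lz: "fst z < snd z" "fst z' < snd z'" using z z' diagonal_less by auto
  have "f z = f (chord s e)"
    by (rule const[OF z w(1) h(1) w(2) share_not_crossing[OF lz(1) s(1)]])
  also have "\<dots> = f (chord s' e')"
    by (rule const[OF w(1) h(1) w(2) w'(1) h(2) w'(2) h(3)])
  also have "\<dots> = f z'"
    by (rule const[OF z' w'(1) h(2) w'(2) share_not_crossing[OF lz(2) s'(1)], symmetric])
  finally show ?thesis .
qed

lemma connected:
  assumes p: "p \<in> diagonals n" and q: "q \<in> diagonals n" and pq: "crossing p q" and U': "p \<notin> U" "q \<notin> U"
    and const: "\<And>z z'. z \<in> diagonals n - {p, q} \<Longrightarrow> crossing p z \<or> crossing q z \<Longrightarrow> free z \<Longrightarrow>
        z' \<in> diagonals n - {p, q} \<Longrightarrow> crossing p z' \<or> crossing q z' \<Longrightarrow> free z' \<Longrightarrow> \<not> crossing z z' \<Longrightarrow> f z = f z'"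
    and z: "z \<in> diagonals n - {p, q}" "crossing p z \<or> crossing q z" "free z"
    and z': "z' \<in> diagonals n - {p, q}" "crossing p z' \<or> crossing q z'" "free z'"
  shows "f z = f z'"
proof (cases "free p \<and> free q")
  case False
  \<comment> \<open>Such a \<open>u\<close> is itself one of the chords in question and crosses none
    of the others, so it links all of them.\<close>
  then obtain u where u: "u \<in> U" "crossing p u \<or> crossing q u" by blast
  then have uN: "u \<in> diagonals n - {p, q}" "free u" using U U' by blast+
  have "f z = f u" by (rule const[OF z uN(1) u(2) uN(2)]) (use z u in blast)
  also have "\<dots> = f z'" by (rule const[OF z' uN(1) u(2) uN(2), symmetric]) (use z' u in blast)
  finally show ?thesis .
next
  case True
  from pq consider "fst p < fst q" "fst q < snd p" "snd p < snd q" | "fst q < fst p" "fst p < snd q" "snd q < snd p"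
    by (auto simp: crossing_def)
  then show ?thesis
  proof cases
    case 1
    show ?thesis
      by (rule connected_aux[where f=f, OF p q 1 const]) (use z z' True in blast)+
  next
    case 2
    have c: "f z = f z'" if "z \<in> diagonals n - {q, p}" "crossing q z \<or> crossing p z" "free z"
        "z' \<in> diagonals n - {q, p}" "crossing q z' \<or> crossing p z'" "free z'" "\<not> crossing z z'" for z z'
      using const[of z z'] that by blast
    show ?thesis
      by (rule connected_aux[where f=f, OF q p 2 c]) (use z z' True in blast)+
  qed
qed

end

theorem theorem5p3:
  fixes n :: nat
  assumes "n \<ge> 3"
  shows "carrier (T2 (assoc_SR_ring n)) = {\<zero>\<^bsub>T2 (assoc_SR_ring n)\<^esub>}"
proof -
  interpret flag_complex "diagonals n" crossing by (rule flag_diagonals)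
  have K: "K = assoc_complex n" by (simp add: K_def assoc_complex_def)
  have KD: "U \<subseteq> diagonals n" "\<And>u v. u \<in> U \<Longrightarrow> v \<in> U \<Longrightarrow> \<not> crossing u v" if "U \<in> K" for U
    using K_sub K_not_cross that by blast+
  have "\<exists>\<alpha>. potential c T \<alpha>" if "coherent c T" for c T
  proof (rule potential_exists[OF _ _ that])
    fix p U y
    assume p: "p \<in> diagonals n" and UK: "U \<in> K" and y: "y \<in> diagonals n" "crossing p y" "\<And>u. u \<in> U \<Longrightarrow> \<not> crossing y u"
    show "\<exists>u\<in>diagonals n. crossing p u \<and> (\<forall>v\<in>U. \<not> crossing u v) \<and>
        (\<forall>z\<in>diagonals n. crossing p z \<longrightarrow> (\<forall>v\<in>U. \<not> crossing z v) \<longrightarrow> \<not> crossing u z)"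
      by (rule cone[where U=U, OF KD[OF UK] p y(1,2)]) (use y(3) in blast)+
  next
    fix p q U z z' and f :: "nat \<times> nat \<Rightarrow> complex"
    assume a: "p \<in> diagonals n" "q \<in> diagonals n" "crossing p q" and UK: "U \<in> K" and U': "p \<notin> U" "q \<notin> U"
      and const: "\<And>z z'. z \<in> diagonals n - {p, q} \<Longrightarrow> crossing p z \<or> crossing q z \<Longrightarrow> (\<And>v. v \<in> U \<Longrightarrow> \<not> crossing z v) \<Longrightarrow>
        z' \<in> diagonals n - {p, q} \<Longrightarrow> crossing p z' \<or> crossing q z' \<Longrightarrow> (\<And>v. v \<in> U \<Longrightarrow> \<not> crossing z' v) \<Longrightarrow>
        \<not> crossing z z' \<Longrightarrow> f z = f z'"
      and z: "z \<in> diagonals n - {p, q}" "crossing p z \<or> crossing q z" "\<And>v. v \<in> U \<Longrightarrow> \<not> crossing z v"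
      and z': "z' \<in> diagonals n - {p, q}" "crossing p z' \<or> crossing q z'" "\<And>v. v \<in> U \<Longrightarrow> \<not> crossing z' v"
    have c: "f z = f z'" if "z \<in> diagonals n - {p, q}" "crossing p z \<or> crossing q z" "\<forall>v\<in>U. \<not> crossing z v"
        "z' \<in> diagonals n - {p, q}" "crossing p z' \<or> crossing q z'" "\<forall>v\<in>U. \<not> crossing z' v" "\<not> crossing z z'" for z z'
      using const[of z z'] that by blast
    show "f z = f z'"
      by (rule connected[where f=f, OF KD[OF UK] a U' c]) (use z z' in blast)+
  qed
  from T2_SR_trivial[OF this] show ?thesis
    unfolding assoc_SR_ring_def K .
qed

end
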